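(* Let $\mathcal G$ be a connected noncompact metric graph with at least one terminal point, and consider the critical energy ($p=6$). Then: $\mu_{\mathcal G}=\mu_{\mathbb R^+}$; for every $\mu\in(\mu_{\mathbb R^+},\mu_{\mathbb R}]$, $\mathcal E_{\mathcal G}(\mu)=-\infty$; and for $\mu=\mu_{\mathbb R^+}$, $\mathcal E_{\mathcal G}(\mu)=0$, and this value is attained if and only if $\mathcal G$ is a halfline.
   Context: Metric graphs have finitely many edges and vertices, bounded edges identified with $[0,\ell_e]$ and halflines with $[0,\infty)$ (whose far endpoints are vertices at infinity); noncompact means at least one halfline. A terminal point is a vertex of degree one that is not a vertex at infinity (the free endpoint of a bounded edge). $H^1(\mathcal G)$: continuous functions, $H^1$ on each edge; $H^1_\mu(\mathcal G)$: those with $\|u\|_2^2=\mu$. $E(u,\mathcal G)=\frac12\int|u'|^2-\frac16\int|u|^6$, $\mathcal E_{\mathcal G}(\mu)=\inf_{H^1_\mu(\mathcal G)}E(\cdot,\mathcal G)$. For a graph $X$, $K_X=\sup_{u\in H^1(X),u\ne0}\frac{\|u\|_6^6}{\|u\|_2^4\|u'\|_2^2}$ and $\mu_X=\sqrt{3/K_X}$; in particular $\mu_{\mathbb R}=\pi\sqrt3/2$ and $\mu_{\mathbb R^+}=\pi\sqrt3/4$. *)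

theory Defs
  imports "HOL-Analysis.Analysis"
begin

text \<open>A metric graph: finitely many vertices, finitely many bounded edges (each identified
with [0, len e], endpoint 0 at src e and endpoint len e at tgt e) and finitely many halflines
(each identified with [0,\<infinity>), endpoint 0 at src h; the vertex at infinity is not modelled).\<close>

record ('v, 'e) mgraph =
  verts  :: "'v set"
  bedges :: "'e set"
  hedges :: "'e set"
  src    :: "'e \<Rightarrow> 'v"
  tgt    :: "'e \<Rightarrow> 'v"
  len    :: "'e \<Rightarrow> real"

definition metric_graph :: "('v, 'e) mgraph \<Rightarrow> bool" where
  "metric_graph G \<longleftrightarrow> finite (verts G) \<and> finite (bedges G) \<and> finite (hedges G) \<and>
     bedges G \<inter> hedges G = {} \<and>
     (\<forall>e\<in>bedges G. src G e \<in> verts G \<and> tgt G e \<in> verts G \<and> len G e > 0) \<and>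
     (\<forall>h\<in>hedges G. src G h \<in> verts G)"

definition edges :: "('v, 'e) mgraph \<Rightarrow> 'e set" where
  "edges G = bedges G \<union> hedges G"

definition edge_dom :: "('v, 'e) mgraph \<Rightarrow> 'e \<Rightarrow> real set" where
  "edge_dom G e = (if e \<in> bedges G then {0..len G e} else {0..})"

definition mg_adj :: "('v, 'e) mgraph \<Rightarrow> ('v \<times> 'v) set" where
  "mg_adj G = {(src G e, tgt G e) | e. e \<in> bedges G} \<union> {(tgt G e, src G e) | e. e \<in> bedges G}"

definition mg_connected :: "('v, 'e) mgraph \<Rightarrow> bool" where
  "mg_connected G \<longleftrightarrow> (\<forall>v\<in>verts G. \<forall>w\<in>verts G. (v, w) \<in> (mg_adj G)\<^sup>*)"

definition noncompact :: "('v, 'e) mgraph \<Rightarrow> bool" where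
  "noncompact G \<longleftrightarrow> hedges G \<noteq> {}"

text \<open>Degree (a self-loop counts twice; halflines count once at their finite endpoint).\<close>
definition degree :: "('v, 'e) mgraph \<Rightarrow> 'v \<Rightarrow> nat" where
  "degree G v = card {e \<in> bedges G. src G e = v} + card {e \<in> bedges G. tgt G e = v}
                + card {h \<in> hedges G. src G h = v}"

definition terminal_point :: "('v, 'e) mgraph \<Rightarrow> 'v \<Rightarrow> bool" where
  "terminal_point G v \<longleftrightarrow> v \<in> verts G \<and> degree G v = 1"

text \<open>G is (metrically) a halfline: for a connected graph, exactly one halfline and all vertices
of degree at most 2, i.e. a chain of bounded edges ending in a halfline (degree-2 vertices
being irrelevant for the metric structure).\<close>
definition is_halfline :: "('v, 'e) mgraph \<Rightarrow> bool" where
  "is_halfline G \<longleftrightarrow> card (hedges G) = 1 \<and> (\<forall>v\<in>verts G. degree G v \<le> 2)"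

text \<open>u \<in> H^1(G) with (weak) derivative u': on every edge u is the integral of u'
(absolutely continuous representative), u and u' are square integrable, and u is continuous
at the vertices.\<close>
definition H1_pair :: "('v, 'e) mgraph \<Rightarrow> ('e \<Rightarrow> real \<Rightarrow> real) \<Rightarrow> ('e \<Rightarrow> real \<Rightarrow> real) \<Rightarrow> bool" where
  "H1_pair G u u' \<longleftrightarrow>
     (\<forall>e\<in>edges G.
        (\<forall>x\<in>edge_dom G e. set_integrable lborel {0..x} (u' e) \<and>
            u e x = u e 0 + (LINT t:{0..x}|lborel. u' e t)) \<and>
        set_integrable lborel (edge_dom G e) (\<lambda>x. (u e x)\<^sup>2) \<and>
        set_integrable lborel (edge_dom G e) (\<lambda>x. (u' e x)\<^sup>2)) \<and>
     (\<forall>v\<in>verts G. \<exists>c.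
        (\<forall>e\<in>bedges G. (src G e = v \<longrightarrow> u e 0 = c) \<and> (tgt G e = v \<longrightarrow> u e (len G e) = c)) \<and>
        (\<forall>h\<in>hedges G. src G h = v \<longrightarrow> u h 0 = c))"

definition mass :: "('v, 'e) mgraph \<Rightarrow> ('e \<Rightarrow> real \<Rightarrow> real) \<Rightarrow> real" where
  "mass G u = (\<Sum>e\<in>edges G. LINT x:edge_dom G e|lborel. (u e x)\<^sup>2)"

definition L6 :: "('v, 'e) mgraph \<Rightarrow> ('e \<Rightarrow> real \<Rightarrow> real) \<Rightarrow> real" where
  "L6 G u = (\<Sum>e\<in>edges G. LINT x:edge_dom G e|lborel. (u e x) ^ 6)"

definition energy :: "('v, 'e) mgraph \<Rightarrow> ('e \<Rightarrow> real \<Rightarrow> real) \<Rightarrow> ('e \<Rightarrow> real \<Rightarrow> real) \<Rightarrow> real" where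
  "energy G u u' = 1/2 * mass G u' - 1/6 * L6 G u"

text \<open>Ground state energy level E_G(mu) (an extended real; may be -\<infinity>).\<close>
definition ground_energy :: "('v, 'e) mgraph \<Rightarrow> real \<Rightarrow> ereal" where
  "ground_energy G \<mu> = Inf {ereal (energy G u u') | u u'. H1_pair G u u' \<and> mass G u = \<mu>}"

text \<open>Gagliardo-Nirenberg constant K_G and critical mass mu_G = sqrt(3/K_G).\<close>
definition GN_const :: "('v, 'e) mgraph \<Rightarrow> ereal" where
  "GN_const G = Sup {ereal (L6 G u / ((mass G u)\<^sup>2 * mass G u')) | u u'.
                      H1_pair G u u' \<and> mass G u \<noteq> 0}"

definition crit_mass :: "('v, 'e) mgraph \<Rightarrow> real" where
  "crit_mass G = sqrt (3 / real_of_ereal (GN_const G))"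

end

theory Submission
  imports Defs "HOL-Real_Asymp.Real_Asymp"
begin

text \<open>The sharp inequality comes from a calibration instead of a rearrangement. Let \<open>M = sup |u|\<close> and
  let \<open>\<Phi>(t)\<close> be the primitive of \<open>t sqrt (M\<^sup>4 - t\<^sup>4)\<close>. Pointwise
  \<open>u'\<^sup>2 + k\<^sup>2 (M\<^sup>4 u\<^sup>2 - u\<^sup>6) \<ge> 2 k |u'| |u| sqrt (M\<^sup>4 - u\<^sup>4)\<close>, and the right-hand side integrates to
  at least \<open>2 k \<Phi>(M) = k \<pi> M\<^sup>4 / 4\<close>: since \<open>u\<close> tends to 0 along a halfline and the graph is connected,
  \<open>\<Phi>(u)\<close> takes every value between 0 and \<open>\<Phi>(M)\<close>. With \<open>k = \<pi> / (4 mass)\<close> the terms in \<open>M\<close> cancel and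
  \<open>16 / \<pi>\<^sup>2\<close> remains as the Gagliardo-Nirenberg constant. In the equality case \<open>|u'|\<close> is determined by \<open>u\<close>,
  which forces \<open>u\<close> to have no zeros, and the images of the edges under \<open>\<Phi>(u)\<close> are nondegenerate
  intervals with null overlaps, whose lengths are the variations along the edges; so there are no
  loops, no second halfline and no vertex of degree 3.
  Optimality follows by concentrating a truncated soliton \<open>1 / sqrt (cosh x)\<close> at the terminal point.\<close>

section \<open>Absolutely continuous functions on an edge\<close>

text \<open>The weight t sqrt (M^4 - t^4) comes from the first integral u'^2 = k^2 (M^4 u^2 - u^6)
  of the soliton, so the calibration is an equality along a soliton decreasing from its maximum. A
  rearrangement would count the preimages of each level; here it is enough that every level has one,
  and a soliton with its peak at a terminal point has only one, which is why the constant is that of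
  the halfline. The obstacle is the equality case. Where |u| = M the weight vanishes, so a zero
  deficit says nothing about an edge on which u is constantly M, and the image of such an edge has
  length 0, which the counting of overlaps cannot see. For this reason the calibration carries a
  parameter \<open>A\<close> that may exceed sup |u|: increasing it makes such an edge visible. At p
  = 6 both terms of the energy are multiplied by k^2 when x is replaced by k x at fixed mass. So one
  compactly supported profile of negative energy drives the infimum to minus infinity, and k tending
  to 0 gives the value 0 at the critical mass.\<close>

definition ray_dom :: "real set \<Rightarrow> bool" where
  "ray_dom D \<longleftrightarrow> D = {0..} \<or> (\<exists>l\<ge>0. D = {0..l})"

text \<open>The clause of \<open>H1_pair\<close> about a single edge, with the domain as a
  parameter, so that the one-dimensional analysis is free of graphs and serves bounded edges and
  halflines alike.\<close>

definition edge_H1 :: "real set \<Rightarrow> (real \<Rightarrow> real) \<Rightarrow> (real \<Rightarrow> real) \<Rightarrow> bool" where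
  "edge_H1 D f f' \<longleftrightarrow>
     (\<forall>x\<in>D. set_integrable lborel {0..x} f' \<and> f x = f 0 + (LINT t:{0..x}|lborel. f' t)) \<and>
     set_integrable lborel D (\<lambda>x. (f x)\<^sup>2) \<and> set_integrable lborel D (\<lambda>x. (f' x)\<^sup>2)"

lemma ray_domD:
  assumes "ray_dom D"
  shows "0 \<in> D" "x \<in> D \<Longrightarrow> 0 \<le> x" "x \<in> D \<Longrightarrow> {0..x} \<subseteq> D" "D \<in> sets borel" "is_interval D"
    "x \<in> D \<Longrightarrow> 0 \<le> y \<Longrightarrow> {y..x} \<subseteq> D"
  using assms by (auto simp: ray_dom_def is_interval_cc is_interval_ci)

lemma set_integral_Icc_split:
  fixes f :: "real \<Rightarrow> real"
  assumes "set_integrable lborel {a..c} f" "a \<le> b" "b \<le> c"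
  shows "(LINT t:{a..c}|lborel. f t) = (LINT t:{a..b}|lborel. f t) + (LINT t:{b..c}|lborel. f t)"
proof -
  have 1: "set_integrable lborel {a..b} f" "set_integrable lborel {b..c} f"
    using assms by (auto intro: set_integrable_subset)
  show ?thesis
    using assms 1 Henstock_Kurzweil_Integration.integral_combine[of a b c f]
      set_borel_integral_eq_integral[OF assms(1)] set_borel_integral_eq_integral[OF 1(1)]
      set_borel_integral_eq_integral[OF 1(2)]
    by simp
qed

lemma set_integral_mono_subset:
  fixes f :: "real \<Rightarrow> real"
  assumes "set_integrable lborel D f" "B \<in> sets borel" "B \<subseteq> D" "\<And>x. x \<in> D \<Longrightarrow> 0 \<le> f x"
  shows "(LINT t:B|lborel. f t) \<le> (LINT t:D|lborel. f t)"
proof -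
  have "set_integrable lborel B f" using assms by (auto intro: set_integrable_subset)
  then show ?thesis
    using assms unfolding set_lebesgue_integral_def set_integrable_def
    by (intro integral_mono) (auto simp: indicator_def)
qed

context
  fixes D :: "real set" and f f' :: "real \<Rightarrow> real"
  assumes D: "ray_dom D" and H: "edge_H1 D f f'"
begin

lemma edge_H1_diff:
  assumes "x \<in> D" "y \<in> D" "x \<le> y"
  shows "set_integrable lborel {x..y} f'" "f y - f x = (LINT t:{x..y}|lborel. f' t)"
proof -
  have i: "set_integrable lborel {0..y} f'" using H assms by (auto simp: edge_H1_def)
  have x0: "0 \<le> x" using ray_domD[OF D] assms by auto
  show "set_integrable lborel {x..y} f'" using i x0 by (auto intro: set_integrable_subset)
  have "f y = f 0 + (LINT t:{0..y}|lborel. f' t)" "f x = f 0 + (LINT t:{0..x}|lborel. f' t)"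
    using H assms by (auto simp: edge_H1_def)
  then show "f y - f x = (LINT t:{x..y}|lborel. f' t)"
    using set_integral_Icc_split[OF i x0 assms(3)] by simp
qed

lemma edge_H1_continuous_Icc:
  assumes "y \<in> D"
  shows "continuous_on {0..y} f"
proof -
  have sub: "{0..y} \<subseteq> D" using ray_domD[OF D] assms by auto
  have i: "set_integrable lborel {0..y} f'" using H assms by (auto simp: edge_H1_def)
  then have "continuous_on {0..y} (\<lambda>x. f 0 + integral {0..x} f')"
    by (intro continuous_intros indefinite_integral_continuous_1 set_borel_integral_eq_integral(1))
  moreover have "f x = f 0 + integral {0..x} f'" if "x \<in> {0..y}" for x
    using H sub that set_borel_integral_eq_integral(2)[of "{0..x}" f'] by (auto simp: edge_H1_def)
  ultimately show ?thesis by (metis (no_types, lifting) continuous_on_cong)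
qed

lemma edge_H1_continuous: "continuous_on D f"
proof (cases "D = {0..}")
  case True
  have "continuous (at x within D) f" if "x \<in> D" for x
  proof -
    have "x + 1 \<in> D" using that True by simp
    then have "continuous (at x within {0..x+1}) f"
      using edge_H1_continuous_Icc that True by (auto simp: continuous_on_eq_continuous_within)
    moreover have "at x within {0..x+1} = at x within D"
      by (rule at_within_nhd[of _ "{x-1<..<x+1}"]) (auto simp: True)
    ultimately show ?thesis by simp
  qed
  then show ?thesis by (simp add: continuous_on_eq_continuous_within)
next
  case False
  then show ?thesis using edge_H1_continuous_Icc D by (auto simp: ray_dom_def)
qed

lemma edge_H1_measurable:
  "set_borel_measurable lborel D f" "set_borel_measurable lborel D f'"
proof -
  show "set_borel_measurable lborel D f"
    using borel_measurable_continuous_on_indicator[OF _ edge_H1_continuous] ray_domD[OF D]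
    by (simp add: set_borel_measurable_def)
  have i: "(\<lambda>t. indicator {0..x} t *\<^sub>R f' t) \<in> borel_measurable borel" if "x \<in> D" for x
    using H that by (auto simp: edge_H1_def set_integrable_def dest!: borel_measurable_integrable)
  show "set_borel_measurable lborel D f'"
  proof (cases "D = {0..}")
    case True
    \<comment> \<open>The definition gives measurability of \<open>f'\<close> only through bounded
      intervals; on the halfline it is obtained as a limit of truncations.\<close>
    have "(\<lambda>t. indicator {0..} t *\<^sub>R f' t) \<in> borel_measurable borel"
    proof (rule borel_measurable_LIMSEQ_real)
      fix x :: real
      obtain N :: nat where N: "x \<le> real N" using real_arch_simple by blast
      have "eventually (\<lambda>n. indicator {0..real n} x *\<^sub>R f' x = indicator {0..} x *\<^sub>R f' x) sequentially"
        using eventually_ge_at_top[of N] by eventually_elim (use N in \<open>auto simp: indicator_def\<close>)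
      then show "(\<lambda>n. indicator {0..real n} x *\<^sub>R f' x) \<longlonglongrightarrow> indicator {0..} x *\<^sub>R f' x"
        by (rule tendsto_eventually)
    qed (use i True in auto)
    then show ?thesis using True by (simp add: set_borel_measurable_def)
  next
    case False
    then show ?thesis using i D by (auto simp: ray_dom_def set_borel_measurable_def)
  qed
qed

lemma edge_H1_measurable_comp:
  assumes c: "continuous_on {-A..A} g" and A: "\<And>t. t \<in> D \<Longrightarrow> \<bar>f t\<bar> \<le> A"
  shows "set_borel_measurable lborel D (\<lambda>t. g (f t))"
    "set_borel_measurable lborel D (\<lambda>t. g (f t) * \<bar>f' t\<bar>)"
proof -
  have mem: "f t \<in> {-A..A}" if "t \<in> D" for t using A[OF that] by (simp add: abs_le_iff)
  have "continuous_on D (\<lambda>t. g (f t))"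
    by (rule continuous_on_compose2[OF c edge_H1_continuous]) (use mem in blast)
  then have m: "(\<lambda>t. indicator D t *\<^sub>R g (f t)) \<in> borel_measurable borel"
    using borel_measurable_continuous_on_indicator ray_domD[OF D] by blast
  then show "set_borel_measurable lborel D (\<lambda>t. g (f t))" by (simp add: set_borel_measurable_def)
  have m': "(\<lambda>t. indicator D t *\<^sub>R f' t) \<in> borel_measurable borel"
    using edge_H1_measurable by (simp add: set_borel_measurable_def)
  have "(\<lambda>t. (indicator D t *\<^sub>R g (f t)) * \<bar>indicator D t *\<^sub>R f' t\<bar>) \<in> borel_measurable borel"
    using m m' by measurable
  moreover have "(\<lambda>t. (indicator D t *\<^sub>R g (f t)) * \<bar>indicator D t *\<^sub>R f' t\<bar>)
      = (\<lambda>t. indicator D t *\<^sub>R (g (f t) * \<bar>f' t\<bar>))" by (auto simp: indicator_def)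
  ultimately show "set_borel_measurable lborel D (\<lambda>t. g (f t) * \<bar>f' t\<bar>)"
    by (simp add: set_borel_measurable_def)
qed

lemma edge_H1_abs_deriv_integrable:
  assumes "x \<in> D" "y \<in> D" "x \<le> y"
  shows "set_integrable lborel {x..y} (\<lambda>t. \<bar>f' t\<bar>)"
    and "\<bar>f y - f x\<bar> \<le> (LINT t:{x..y}|lborel. \<bar>f' t\<bar>)"
proof -
  show "set_integrable lborel {x..y} (\<lambda>t. \<bar>f' t\<bar>)"
    using edge_H1_diff[OF assms] by (auto intro: set_integrable_abs)
  show "\<bar>f y - f x\<bar> \<le> (LINT t:{x..y}|lborel. \<bar>f' t\<bar>)"
    using edge_H1_diff[OF assms] set_integral_norm_bound[of lborel "{x..y}" f'] by simp
qed

lemma edge_H1_weighted_integrable_Icc: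
  assumes xy: "x \<in> D" "y \<in> D" "x \<le> y" and c: "continuous_on {-A..A} g"
    and A: "\<And>t. t \<in> {x..y} \<Longrightarrow> \<bar>f t\<bar> \<le> A"
  shows "set_integrable lborel {x..y} (\<lambda>t. g (f t) * \<bar>f' t\<bar>)"
proof -
  have sub: "{x..y} \<subseteq> D" using ray_domD[OF D] xy by auto
  have mem: "f t \<in> {-A..A}" if "t \<in> {x..y}" for t using A[OF that] by (simp add: abs_le_iff)
  have gc: "continuous_on {x..y} (\<lambda>t. g (f t))"
    by (rule continuous_on_compose2[OF c continuous_on_subset[OF edge_H1_continuous sub]])
       (use mem in blast)
  obtain B where "\<forall>v \<in> (\<lambda>t. g (f t)) ` {x..y}. norm v \<le> B"
    using compact_imp_bounded[OF compact_continuous_image[OF gc]] unfolding bounded_iff by auto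
  then have B: "\<bar>g (f t)\<bar> \<le> B" if "t \<in> {x..y}" for t using that by auto
  have m: "(\<lambda>t. indicator {x..y} t *\<^sub>R g (f t)) \<in> borel_measurable borel"
    using borel_measurable_continuous_on_indicator[OF _ gc] by simp
  have m': "(\<lambda>t. indicator {x..y} t *\<^sub>R f' t) \<in> borel_measurable borel"
    using edge_H1_diff(1)[OF xy] by (auto simp: set_integrable_def dest!: borel_measurable_integrable)
  have "(\<lambda>t. (indicator {x..y} t *\<^sub>R g (f t)) * \<bar>indicator {x..y} t *\<^sub>R f' t\<bar>) \<in> borel_measurable borel"
    using m m' by measurable
  moreover have "(\<lambda>t. (indicator {x..y} t *\<^sub>R g (f t)) * \<bar>indicator {x..y} t *\<^sub>R f' t\<bar>)
      = (\<lambda>t. indicator {x..y} t *\<^sub>R (g (f t) * \<bar>f' t\<bar>))" by (auto simp: indicator_def)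
  ultimately have m1: "set_borel_measurable lborel {x..y} (\<lambda>t. g (f t) * \<bar>f' t\<bar>)"
    by (simp add: set_borel_measurable_def)
  have m2: "set_integrable lborel {x..y} (\<lambda>t. B * \<bar>f' t\<bar>)"
    using edge_H1_abs_deriv_integrable[OF xy] by simp
  have m3: "norm (g (f t) * \<bar>f' t\<bar>) \<le> norm (B * \<bar>f' t\<bar>)" if "t \<in> {x..y}" for t
    using B[OF that] by (simp add: abs_mult mult_right_mono)
  show ?thesis by (rule set_integrable_bound[OF m2 m1]) (rule AE_I2, use m3 in blast)
qed

text \<open>An inequality form of the chain rule for the absolutely continuous \<open>f\<close>: the local estimate
  comes from the mean value theorem for \<open>\<Phi>\<close>, and \<open>Bolzano\<close> makes it global, so that
  differentiability almost everywhere of \<open>f\<close> is never used.\<close>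

lemma edge_H1_variation:
  assumes xy: "x \<in> D" "y \<in> D" "x \<le> y" and c: "continuous_on {-A..A} g"
    and A: "\<And>t. t \<in> {x..y} \<Longrightarrow> \<bar>f t\<bar> \<le> A"
    and cPhi: "continuous_on {-A..A} \<Phi>"
    and dPhi: "\<And>s. -A < s \<Longrightarrow> s < A \<Longrightarrow> (\<Phi> has_real_derivative \<Phi>' s) (at s)"
    and g: "\<And>s. -A < s \<Longrightarrow> s < A \<Longrightarrow> \<bar>\<Phi>' s\<bar> \<le> g s"
    and g0: "\<And>s. s \<in> {-A..A} \<Longrightarrow> 0 \<le> g s"
  shows "\<bar>\<Phi> (f y) - \<Phi> (f x)\<bar> \<le> (LINT t:{x..y}|lborel. g (f t) * \<bar>f' t\<bar>)"
proof -
  have sub: "{x..y} \<subseteq> D" using ray_domD[OF D] xy by auto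
  have fc: "continuous_on {x..y} f" by (rule continuous_on_subset[OF edge_H1_continuous sub])
  have mem: "f t \<in> {-A..A}" if "t \<in> {x..y}" for t
    using A[OF that] by (auto simp: abs_le_iff)
  have int: "set_integrable lborel {a..b} (\<lambda>t. g (f t) * \<bar>f' t\<bar>)"
            "set_integrable lborel {a..b} (\<lambda>t. \<bar>f' t\<bar>)" if "a \<in> {x..y}" "b \<in> {x..y}" "a \<le> b" for a b
    using that sub A by (auto intro!: edge_H1_weighted_integrable_Icc[OF _ _ _ c] edge_H1_abs_deriv_integrable)
  \<comment> \<open>\<open>\<Phi>\<close> is differentiable only in the open interval, because the
    arcsin in \<open>calib\<close> reaches its branch point at \<open>t = A\<close>; at the ends the
    mean value theorem works with continuity. The point \<open>s\<close> lies between the two values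
    of \<open>f\<close>.\<close>
  have MVT: "\<exists>s. min a b \<le> s \<and> s \<le> max a b \<and> s \<in> {-A..A} \<and> \<bar>\<Phi> b - \<Phi> a\<bar> \<le> g s * \<bar>b - a\<bar>"
    if ab: "a \<in> {-A..A}" "b \<in> {-A..A}" for a b
  proof -
    have *: "\<exists>s. a < s \<and> s < b \<and> \<bar>\<Phi> b - \<Phi> a\<bar> \<le> g s * \<bar>b - a\<bar>"
      if "a < b" "a \<in> {-A..A}" "b \<in> {-A..A}" for a b
    proof -
      have "\<exists>l z. a < z \<and> z < b \<and> DERIV \<Phi> z :> l \<and> \<Phi> b - \<Phi> a = (b - a) * l"
      proof (rule MVT)
        show "continuous_on {a..b} \<Phi>" using that by (intro continuous_on_subset[OF cPhi]) auto
        show "\<Phi> differentiable (at z)" if "a < z" "z < b" for z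
          using dPhi[of z] that \<open>a \<in> _\<close> \<open>b \<in> _\<close> by (auto simp: real_differentiable_def)
      qed (rule that(1))
      then obtain l z where z: "a < z" "z < b" "DERIV \<Phi> z :> l" "\<Phi> b - \<Phi> a = (b - a) * l" by blast
      have zA: "-A < z" "z < A" using z that by auto
      have "l = \<Phi>' z" using z dPhi[OF zA] DERIV_unique by blast
      then have "\<bar>\<Phi> b - \<Phi> a\<bar> \<le> g z * \<bar>b - a\<bar>"
        using z(4) g[OF zA] that by (simp add: abs_mult mult.commute mult_left_mono)
      then show ?thesis using z by blast
    qed
    consider "a < b" | "a = b" | "b < a" by linarith
    then show ?thesis
    proof cases
      case 1
      obtain s where "a < s" "s < b" "\<bar>\<Phi> b - \<Phi> a\<bar> \<le> g s * \<bar>b - a\<bar>" using *[OF 1 ab] by auto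
      then show ?thesis using that 1 by (intro exI[of _ s]) auto
    next
      case 2
      then show ?thesis using that by (intro exI[of _ a]) auto
    next
      case 3
      obtain s where "b < s" "s < a" "\<bar>\<Phi> a - \<Phi> b\<bar> \<le> g s * \<bar>a - b\<bar>" using *[OF 3 ab(2,1)] by auto
      then show ?thesis using that 3 by (intro exI[of _ s]) (auto simp: abs_minus_commute)
    qed
  qed
  \<comment> \<open>The slack \<epsilon> absorbs the oscillation of \<open>g\<close> over a short
    piece. Being multiplied by the integral of |f'|, it is additive over adjacent pieces, as
    \<open>Bolzano\<close> requires.\<close>
  have eps: "\<bar>\<Phi> (f y) - \<Phi> (f x)\<bar> \<le> (LINT t:{x..y}|lborel. g (f t) * \<bar>f' t\<bar>)
      + \<epsilon> * (LINT t:{x..y}|lborel. \<bar>f' t\<bar>)" if \<epsilon>: "\<epsilon> > 0" for \<epsilon>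
  proof -
    define P where "P a b \<longleftrightarrow> (a \<in> {x..y} \<and> b \<in> {x..y} \<longrightarrow>
      \<bar>\<Phi> (f b) - \<Phi> (f a)\<bar> \<le> (LINT t:{a..b}|lborel. g (f t) * \<bar>f' t\<bar>) + \<epsilon> * (LINT t:{a..b}|lborel. \<bar>f' t\<bar>))"
      for a b
    have "P x y" using xy(3)
    proof (induction rule: Bolzano)
      case (trans a b c)
      show ?case unfolding P_def
      proof (intro impI)
        assume ac: "a \<in> {x..y} \<and> c \<in> {x..y}"
        then have b: "b \<in> {x..y}" using trans by auto
        have "\<bar>\<Phi> (f c) - \<Phi> (f a)\<bar> \<le> \<bar>\<Phi> (f b) - \<Phi> (f a)\<bar> + \<bar>\<Phi> (f c) - \<Phi> (f b)\<bar>" by linarith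
        also have "\<dots> \<le> ((LINT t:{a..b}|lborel. g (f t) * \<bar>f' t\<bar>) + \<epsilon> * (LINT t:{a..b}|lborel. \<bar>f' t\<bar>))
           + ((LINT t:{b..c}|lborel. g (f t) * \<bar>f' t\<bar>) + \<epsilon> * (LINT t:{b..c}|lborel. \<bar>f' t\<bar>))"
          using trans ac b by (intro add_mono) (auto simp: P_def)
        also have "\<dots> = (LINT t:{a..c}|lborel. g (f t) * \<bar>f' t\<bar>) + \<epsilon> * (LINT t:{a..c}|lborel. \<bar>f' t\<bar>)"
          using set_integral_Icc_split[OF int(1), of a c b] set_integral_Icc_split[OF int(2), of a c b]
            trans(3,4) ac by (simp add: algebra_simps)
        finally show "\<bar>\<Phi> (f c) - \<Phi> (f a)\<bar> \<le>
          (LINT t:{a..c}|lborel. g (f t) * \<bar>f' t\<bar>) + \<epsilon> * (LINT t:{a..c}|lborel. \<bar>f' t\<bar>)" .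
      qed
    next
      case (local z)
      then have z: "z \<in> {x..y}" by simp
      obtain e where e: "e > 0" "\<And>s. s \<in> {-A..A} \<Longrightarrow> dist s (f z) < e \<Longrightarrow> dist (g s) (g (f z)) < \<epsilon>/2"
        using c mem[OF z] half_gt_zero[OF \<epsilon>] unfolding continuous_on_iff by blast
      obtain d where d: "d > 0" "\<And>t. t \<in> {x..y} \<Longrightarrow> dist t z < d \<Longrightarrow> dist (f t) (f z) < e"
        using fc z e(1) unfolding continuous_on_iff by blast
      have "P a b" if ab: "a \<le> z" "z \<le> b" "b - a < d" for a b
        unfolding P_def
      proof (intro impI)
        assume m: "a \<in> {x..y} \<and> b \<in> {x..y}"
        have near: "dist (f t) (f z) < e" if "t \<in> {a..b}" for t
          using d(2)[of t] that ab m by (auto simp: dist_real_def)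
        obtain s where s: "min (f a) (f b) \<le> s" "s \<le> max (f a) (f b)" "s \<in> {-A..A}"
          "\<bar>\<Phi> (f b) - \<Phi> (f a)\<bar> \<le> g s * \<bar>f b - f a\<bar>" using MVT[of "f a" "f b"] m mem by blast
        have "dist s (f z) < e" using s(1,2) near[of a] near[of b] ab by (auto simp: dist_real_def)
        then have gs: "dist (g s) (g (f z)) < \<epsilon>/2" using e s by blast
        have ge: "g s \<le> g (f t) + \<epsilon>" if "t \<in> {a..b}" for t
        proof -
          have "dist (g (f t)) (g (f z)) < \<epsilon>/2" using e(2)[OF mem near[OF that]] that m by auto
          then show ?thesis using gs unfolding dist_real_def by linarith
        qed
        have "\<bar>\<Phi> (f b) - \<Phi> (f a)\<bar> \<le> g s * (LINT t:{a..b}|lborel. \<bar>f' t\<bar>)"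
          using ab m sub by (intro order_trans[OF s(4)] mult_left_mono edge_H1_abs_deriv_integrable(2) g0[OF s(3)]) auto
        also have "\<dots> = (LINT t:{a..b}|lborel. g s * \<bar>f' t\<bar>)" by simp
        also have "\<dots> \<le> (LINT t:{a..b}|lborel. g (f t) * \<bar>f' t\<bar> + \<epsilon> * \<bar>f' t\<bar>)"
        proof (rule set_integral_mono)
          fix t assume "t \<in> {a..b}"
          then show "g s * \<bar>f' t\<bar> \<le> g (f t) * \<bar>f' t\<bar> + \<epsilon> * \<bar>f' t\<bar>"
            using mult_right_mono[OF ge, of t "\<bar>f' t\<bar>"] by (simp add: algebra_simps)
        qed (use int[of a b] m ab in auto)
        also have "\<dots> = (LINT t:{a..b}|lborel. g (f t) * \<bar>f' t\<bar>) + \<epsilon> * (LINT t:{a..b}|lborel. \<bar>f' t\<bar>)"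
          using int[of a b] m ab by simp
        finally show "\<bar>\<Phi> (f b) - \<Phi> (f a)\<bar> \<le>
          (LINT t:{a..b}|lborel. g (f t) * \<bar>f' t\<bar>) + \<epsilon> * (LINT t:{a..b}|lborel. \<bar>f' t\<bar>)" .
      qed
      then show ?case using d(1) by blast
    qed
    then show ?thesis using xy by (simp add: P_def)
  qed
  show ?thesis
  proof (rule field_le_epsilon)
    fix e :: real assume "e > 0"
    define I where "I = (LINT t:{x..y}|lborel. \<bar>f' t\<bar>)"
    have I: "I \<ge> 0" unfolding I_def set_lebesgue_integral_def by (rule integral_nonneg_AE) auto
    \<comment> \<open>Dividing by \<open>I + 1\<close> keeps the choice of \<epsilon> valid when
      \<open>I = 0\<close>.\<close>
    have "e / (I + 1) * I \<le> e" using \<open>e > 0\<close> I by (simp add: field_simps)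
    then show "\<bar>\<Phi> (f y) - \<Phi> (f x)\<bar> \<le> (LINT t:{x..y}|lborel. g (f t) * \<bar>f' t\<bar>) + e"
      using eps[of "e / (I + 1)"] \<open>e > 0\<close> I by (simp add: I_def)
  qed
qed

end

section \<open>The calibration on an edge\<close>

text \<open>The function \<Phi> of the overview in closed form, from the substitution s = t^2, with
  a free parameter \<open>A\<close> in place of M.\<close>

definition calib :: "real \<Rightarrow> real \<Rightarrow> real" where
  "calib A t = (t\<^sup>2 * sqrt (A^4 - t^4) + A^4 * arcsin (t\<^sup>2 / A\<^sup>2)) / 4"

text \<open>The absolute value of the derivative of \<open>calib A\<close>; its square is the
  polynomial A^4 t^2 - t^6, which integrates to mass and sixth-power terms.\<close>

definition weight :: "real \<Rightarrow> real \<Rightarrow> real" where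
  "weight A t = \<bar>t\<bar> * sqrt (A^4 - t^4)"

lemma power4_le:
  assumes "\<bar>t\<bar> \<le> A" shows "t^4 \<le> (A::real)^4"
  using power_mono[OF assms, of 4] by simp

lemma power4_less:
  assumes "\<bar>t\<bar> < A" shows "t^4 < (A::real)^4"
  using power_strict_mono[OF assms, of 4] by simp

lemma calib_deriv:
  assumes t: "-A < t" "t < A"
  shows "(calib A has_real_derivative t * sqrt (A^4 - t^4)) (at t)"
proof -
  have A: "A > 0" using t by linarith
  have lt: "t^4 < A^4" using power4_less[of t A] t by (simp add: abs_less_iff)
  define S where "S = sqrt (A^4 - t^4)"
  have S: "S > 0" "S\<^sup>2 = A^4 - t^4" using lt by (auto simp: S_def)
  have t2: "t\<^sup>2 < A\<^sup>2" using power_strict_mono[of "\<bar>t\<bar>" A 2] t by (simp add: abs_less_iff)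
  have q: "-1 < t\<^sup>2 / A\<^sup>2" "t\<^sup>2 / A\<^sup>2 < 1"
    using t2 A by (auto simp: field_simps intro: less_le_trans[of _ 0])
  have sq: "sqrt (1 - (t\<^sup>2 / A\<^sup>2)\<^sup>2) = S / A\<^sup>2"
  proof (rule real_sqrt_unique)
    show "(S / A\<^sup>2)\<^sup>2 = 1 - (t\<^sup>2 / A\<^sup>2)\<^sup>2" using S A by (simp add: power_divide field_simps)
  qed (use S in simp)
  have d1: "((\<lambda>t. sqrt (A^4 - t^4)) has_real_derivative inverse (sqrt (A^4 - t^4)) / 2 * (- (4 * t^3))) (at t)"
    by (rule DERIV_chain2[OF DERIV_real_sqrt]) (use lt in \<open>auto intro!: derivative_eq_intros\<close>)
  have d3: "((\<lambda>t. t\<^sup>2) has_real_derivative 2 * t) (at t)" by (auto intro!: derivative_eq_intros)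
  have d2: "((\<lambda>t. arcsin (t\<^sup>2 / A\<^sup>2)) has_real_derivative
      inverse (sqrt (1 - (t\<^sup>2 / A\<^sup>2)\<^sup>2)) * (2 * t / A\<^sup>2)) (at t)"
    by (rule DERIV_chain2[where f = arcsin and g = "\<lambda>t. t\<^sup>2 / A\<^sup>2", OF DERIV_arcsin[OF q] DERIV_cdivide[OF d3]])
  have "(calib A has_real_derivative
     ((2 * t * sqrt (A^4 - t^4) + inverse (sqrt (A^4 - t^4)) / 2 * (- (4 * t^3)) * t\<^sup>2)
      + A^4 * (inverse (sqrt (1 - (t\<^sup>2 / A\<^sup>2)\<^sup>2)) * (2 * t / A\<^sup>2))) / 4) (at t)"
    unfolding calib_def[abs_def]
    by (rule DERIV_cdivide[OF DERIV_add[OF DERIV_mult[OF d3 d1] DERIV_cmult[OF d2]]])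
  also have "((2 * t * sqrt (A^4 - t^4) + inverse (sqrt (A^4 - t^4)) / 2 * (- (4 * t^3)) * t\<^sup>2)
      + A^4 * (inverse (sqrt (1 - (t\<^sup>2 / A\<^sup>2)\<^sup>2)) * (2 * t / A\<^sup>2))) / 4 = t * S"
  proof -
    have "A^4 * (inverse (S / A\<^sup>2) * (2 * t / A\<^sup>2)) = A^4 * (2 * t) / S"
      using A by (simp add: field_simps)
    moreover have "inverse S / 2 * (- (4 * t^3)) * t\<^sup>2 = - 2 * t^5 / S"
      by (simp add: field_simps eval_nat_numeral)
    moreover have "2 * t * S + (- 2 * t^5 / S) + A^4 * (2 * t) / S = 4 * (t * S)"
    proof -
      \<comment> \<open>Over the common denominator \<open>S\<close> the numerator is 4 t S^2,
        because S^2 = A^4 - t^4.\<close>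
      have "2 * t * S = 2 * t * S\<^sup>2 / S" using S(1) by (simp add: power2_eq_square)
      then have "2 * t * S + (- 2 * t^5 / S) + A^4 * (2 * t) / S = (2 * t * S\<^sup>2 - 2 * t^5 + A^4 * (2 * t)) / S"
        by (simp add: add_divide_distrib diff_divide_distrib)
      also have "2 * t * S\<^sup>2 - 2 * t^5 + A^4 * (2 * t) = 4 * t * S\<^sup>2"
        unfolding S(2) by (simp add: algebra_simps eval_nat_numeral)
      finally show ?thesis using S(1) by (simp add: power2_eq_square)
    qed
    ultimately show ?thesis unfolding sq S_def[symmetric] by simp
  qed
  finally show ?thesis by (simp add: S_def)
qed

lemma calib_continuous:
  assumes "A > 0" shows "continuous_on {-A..A} (calib A)"
proof -
  have "t\<^sup>2 \<le> A\<^sup>2" if "t \<in> {-A..A}" for t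
    using that assms abs_le_square_iff[of t A] by (auto simp: abs_le_iff)
  then show ?thesis unfolding calib_def[abs_def] using assms
    by (intro continuous_intros) (auto simp: field_simps intro: order_trans[of _ 0])
qed

lemma weight_continuous: "continuous_on S (weight A)"
  unfolding weight_def[abs_def] by (intro continuous_intros)

lemma weight_nonneg: "\<bar>t\<bar> \<le> A \<Longrightarrow> 0 \<le> weight A t"
  using power4_le by (simp add: weight_def)

lemma weight_le: "weight A t \<le> A\<^sup>2 * \<bar>t\<bar>"
proof -
  have "sqrt (A^4 - t^4) \<le> sqrt ((A\<^sup>2)\<^sup>2)" by (intro real_sqrt_le_mono) simp
  then have "sqrt (A^4 - t^4) \<le> A\<^sup>2" by (simp only: real_sqrt_abs) simp
  then show ?thesis unfolding weight_def by (subst mult.commute, intro mult_right_mono) auto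
qed

lemma weight_square: "\<bar>t\<bar> \<le> A \<Longrightarrow> (weight A t)\<^sup>2 = A^4 * t\<^sup>2 - t^6"
  using power4_le[of t A] by (simp add: weight_def power_mult_distrib algebra_simps eval_nat_numeral)

lemma calib_zero: "calib A 0 = 0" by (simp add: calib_def)

lemma calib_top: "A > 0 \<Longrightarrow> calib A A = pi * A^4 / 8" by (simp add: calib_def)

lemma calib_even: "calib A \<bar>t\<bar> = calib A t" by (simp add: calib_def)

lemma calib_strict_mono:
  assumes "0 \<le> s" "s < t" "t \<le> A"
  shows "calib A s < calib A t"
proof (rule DERIV_pos_imp_increasing_open[OF assms(2)])
  fix x assume x: "s < x" "x < t"
  then have "x * sqrt (A^4 - x^4) > 0" using assms power4_less[of x A] by simp
  then show "\<exists>y. (calib A has_real_derivative y) (at x) \<and> 0 < y"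
    using calib_deriv[of A x] x assms by auto
next
  show "continuous_on {s..t} (calib A)"
    using assms by (intro continuous_on_subset[OF calib_continuous]) auto
qed

lemma calib_mono: "0 \<le> s \<Longrightarrow> s \<le> t \<Longrightarrow> t \<le> A \<Longrightarrow> calib A s \<le> calib A t"
  using calib_strict_mono[of s t A] by (cases "s = t") auto

lemma calib_pos: "t \<noteq> 0 \<Longrightarrow> \<bar>t\<bar> \<le> A \<Longrightarrow> 0 < calib A t"
  using calib_strict_mono[of 0 "\<bar>t\<bar>" A] by (simp add: calib_zero calib_even)

text \<open>For |f| at most \<open>A\<close> this integral is the total variation of
  \<open>calib A\<close> composed with \<open>f\<close>; it dominates the length of the image and
  exceeds it when the composition backtracks.\<close>

definition edge_var :: "real \<Rightarrow> real set \<Rightarrow> (real \<Rightarrow> real) \<Rightarrow> (real \<Rightarrow> real) \<Rightarrow> real" where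
  "edge_var A D f f' = (LINT t:D|lborel. weight A (f t) * \<bar>f' t\<bar>)"

lemma set_integral_nonneg_real:
  fixes f :: "real \<Rightarrow> real"
  assumes "\<And>x. x \<in> D \<Longrightarrow> 0 \<le> f x" shows "0 \<le> (LINT t:D|lborel. f t)"
  unfolding set_lebesgue_integral_def by (rule integral_nonneg_AE) (use assms in \<open>auto simp: indicator_def\<close>)

context
  fixes D :: "real set" and f f' :: "real \<Rightarrow> real"
  assumes D: "ray_dom D" and H: "edge_H1 D f f'"
begin

text \<open>The derivative of f^2 is 2 f f', dominated by f^2 + f'^2, which is integrable over the
  whole domain. \<open>edge_H1_variation\<close> wants a bound on \<open>f\<close> beforehand;
  compactness of \<open>{0..x}\<close> gives one depending on \<open>x\<close>, and it drops out of
  the result.\<close>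

lemma edge_H1_bounded: "\<exists>B>0. \<forall>x\<in>D. \<bar>f x\<bar> \<le> B"
proof -
  have i: "set_integrable lborel D (\<lambda>x. (f x)\<^sup>2)" "set_integrable lborel D (\<lambda>x. (f' x)\<^sup>2)"
    using H by (auto simp: edge_H1_def)
  define I where "I = (LINT x:D|lborel. (f x)\<^sup>2 + (f' x)\<^sup>2)"
  have "(f x)\<^sup>2 \<le> (f 0)\<^sup>2 + I" if x: "x \<in> D" for x
  proof -
    have x0: "0 \<in> D" "0 \<le> x" "{0..x} \<subseteq> D" using ray_domD[OF D] x by auto
    have "compact (f ` {0..x})"
      using edge_H1_continuous_Icc[OF D H x] by (intro compact_continuous_image) auto
    then obtain A where A: "A > 0" "\<forall>v\<in>f ` {0..x}. norm v \<le> A"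
      using compact_imp_bounded bounded_pos by blast
    then have A': "\<bar>f t\<bar> \<le> A" if "t \<in> {0..x}" for t using that by auto
    have c: "continuous_on {-A..A} (\<lambda>s. 2 * \<bar>s\<bar>)" by (intro continuous_intros)
    have "\<bar>(f x)\<^sup>2 - (f 0)\<^sup>2\<bar> \<le> (LINT t:{0..x}|lborel. 2 * \<bar>f t\<bar> * \<bar>f' t\<bar>)"
      by (rule edge_H1_variation[OF D H x0(1) x x0(2) c A', where \<Phi>' = "\<lambda>s. 2 * s"])
         (auto intro!: continuous_intros derivative_eq_intros simp: abs_mult)
    also have "\<dots> \<le> (LINT t:{0..x}|lborel. (f t)\<^sup>2 + (f' t)\<^sup>2)"
    proof (rule set_integral_mono)
      show "set_integrable lborel {0..x} (\<lambda>t. 2 * \<bar>f t\<bar> * \<bar>f' t\<bar>)"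
        by (rule edge_H1_weighted_integrable_Icc[OF D H x0(1) x x0(2) c A'])
      show "set_integrable lborel {0..x} (\<lambda>t. (f t)\<^sup>2 + (f' t)\<^sup>2)"
        using i x0(3) by (intro set_integral_add(1)) (auto intro: set_integrable_subset)
      show "2 * \<bar>f t\<bar> * \<bar>f' t\<bar> \<le> (f t)\<^sup>2 + (f' t)\<^sup>2" for t
        using sum_squares_bound[of "\<bar>f t\<bar>" "\<bar>f' t\<bar>"] by simp
    qed
    also have "\<dots> \<le> I" unfolding I_def
      using i x0(3) by (intro set_integral_mono_subset set_integral_add(1)) auto
    finally show ?thesis by linarith
  qed
  then have "\<bar>f x\<bar> \<le> sqrt ((f 0)\<^sup>2 + I)" if "x \<in> D" for x
    using that real_le_rsqrt[of "\<bar>f x\<bar>"] by simp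
  then show ?thesis by (intro exI[of _ "\<bar>sqrt ((f 0)\<^sup>2 + I)\<bar> + 1"]) force
qed

text \<open>Otherwise the mass over the halfline would be infinite. A small value somewhere replaces
  the limit at infinity: it already brings the images under \<open>calib\<close> arbitrarily close
  to 0.\<close>

lemma edge_H1_liminf_zero:
  assumes "D = {0..}" "\<epsilon> > 0"
  shows "\<exists>x\<ge>0. \<bar>f x\<bar> < \<epsilon>"
proof (rule ccontr)
  assume "\<not> ?thesis"
  then have ge: "\<bar>f x\<bar> \<ge> \<epsilon>" if "x \<ge> 0" for x using that by (meson not_le)
  have i: "set_integrable lborel {0..} (\<lambda>x. (f x)\<^sup>2)" using H assms by (auto simp: edge_H1_def)
  have "set_integrable lborel {0..} (\<lambda>x::real. \<epsilon>\<^sup>2)"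
  proof (rule set_integrable_bound[OF i])
    show "AE x in lborel. x \<in> {0..} \<longrightarrow> norm (\<epsilon>\<^sup>2) \<le> norm ((f x)\<^sup>2)"
      using ge assms(2) by (auto simp: abs_le_square_iff[symmetric] intro!: AE_I2)
  qed (auto simp: set_borel_measurable_def)
  then have "integrable lborel (\<lambda>x::real. indicator {0..} x * \<epsilon>\<^sup>2)" by (simp add: set_integrable_def)
  then have "integrable lborel (indicator {0::real..} :: real \<Rightarrow> real)" using assms(2) by simp
  then have fin: "emeasure lborel {0::real..} < \<infinity>" by (simp add: integrable_indicator_iff)
  then obtain r where r: "r \<ge> 0" "emeasure lborel {0::real..} = ennreal r"
    by (auto simp: less_top elim: ennreal_cases)
  have "ennreal (r + 1) \<le> emeasure lborel {0::real..}"
    using emeasure_mono[of "{0..r + 1}" "{0::real..}" lborel] r(1) by simp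
  then show False using r by simp
qed

lemma edge_H1_L6_integrable: "set_integrable lborel D (\<lambda>x. (f x)^6)"
proof -
  obtain B where B: "B > 0" "\<And>x. x \<in> D \<Longrightarrow> \<bar>f x\<bar> \<le> B" using edge_H1_bounded by blast
  have i: "set_integrable lborel D (\<lambda>x. B^4 * (f x)\<^sup>2)" using H by (auto simp: edge_H1_def)
  have m: "set_borel_measurable lborel D (\<lambda>x. (f x)^6)"
    by (rule edge_H1_measurable_comp(1)[OF D H _ B(2)]) (auto intro!: continuous_intros)
  have le: "norm ((f x)^6) \<le> norm (B^4 * (f x)\<^sup>2)" if "x \<in> D" for x
  proof -
    have "(f x)^6 = (f x)^4 * (f x)\<^sup>2" by (simp add: eval_nat_numeral)
    then show ?thesis using mult_right_mono[OF power4_le[OF B(2)[OF that]], of "(f x)\<^sup>2"] by simp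
  qed
  show ?thesis by (rule set_integrable_bound[OF i m]) (rule AE_I2, use le in blast)
qed

context
  fixes A :: real
  assumes A: "A > 0" and fA: "\<And>x. x \<in> D \<Longrightarrow> \<bar>f x\<bar> \<le> A"
begin

lemma edge_H1_weight_integrable: "set_integrable lborel D (\<lambda>t. weight A (f t) * \<bar>f' t\<bar>)"
proof -
  have i: "set_integrable lborel D (\<lambda>x. A\<^sup>2 * ((f x)\<^sup>2 + (f' x)\<^sup>2))"
    using H by (auto simp: edge_H1_def)
  have m: "set_borel_measurable lborel D (\<lambda>t. weight A (f t) * \<bar>f' t\<bar>)"
    by (rule edge_H1_measurable_comp(2)[OF D H weight_continuous fA])
  have le: "norm (weight A (f t) * \<bar>f' t\<bar>) \<le> norm (A\<^sup>2 * ((f t)\<^sup>2 + (f' t)\<^sup>2))" if "t \<in> D" for t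
  proof -
    have "weight A (f t) * \<bar>f' t\<bar> \<le> A\<^sup>2 * (\<bar>f t\<bar> * \<bar>f' t\<bar>)"
      using mult_right_mono[OF weight_le] by (simp add: mult.assoc)
    also have "\<dots> \<le> A\<^sup>2 * ((f t)\<^sup>2 + (f' t)\<^sup>2)"
      using sum_squares_bound[of "\<bar>f t\<bar>" "\<bar>f' t\<bar>"] mult_nonneg_nonneg[of "\<bar>f t\<bar>" "\<bar>f' t\<bar>"]
      by (intro mult_left_mono) (simp_all del: mult_nonneg_nonneg)
    finally show ?thesis using weight_nonneg[OF fA[OF that]] by simp
  qed
  show ?thesis by (rule set_integrable_bound[OF i m]) (rule AE_I2, use le in blast)
qed

lemma edge_var_nonneg: "0 \<le> edge_var A D f f'"
  unfolding edge_var_def by (rule set_integral_nonneg_real) (use weight_nonneg[OF fA] in auto)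

lemma edge_var_Icc:
  assumes "x \<in> D" "y \<in> D" "x \<le> y"
  shows "\<bar>calib A (f y) - calib A (f x)\<bar> \<le> (LINT t:{x..y}|lborel. weight A (f t) * \<bar>f' t\<bar>)"
proof (rule edge_H1_variation[OF D H assms weight_continuous _ calib_continuous[OF A] calib_deriv])
  have "{x..y} \<subseteq> D" using ray_domD[OF D] assms by auto
  then show "\<bar>f t\<bar> \<le> A" if "t \<in> {x..y}" for t using that fA by auto
  show "\<bar>s * sqrt (A ^ 4 - s ^ 4)\<bar> \<le> weight A s" if "- A < s" "s < A" for s
    using power4_le[of s A] that by (simp add: weight_def abs_mult abs_less_iff)
qed (auto intro: weight_nonneg)

lemma edge_var_ge:
  assumes "x \<in> D" "y \<in> D"
  shows "\<bar>calib A (f y) - calib A (f x)\<bar> \<le> edge_var A D f f'"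
proof -
  have *: "\<bar>calib A (f y) - calib A (f x)\<bar> \<le> edge_var A D f f'" if "x \<in> D" "y \<in> D" "x \<le> y" for x y
  proof -
    have "{x..y} \<subseteq> D" using ray_domD[OF D] that by auto
    then show ?thesis
      using edge_var_Icc[OF that] set_integral_mono_subset[OF edge_H1_weight_integrable, of "{x..y}"]
        weight_nonneg[OF fA] by (fastforce simp: edge_var_def)
  qed
  show ?thesis
  proof (cases "x \<le> y")
    case True then show ?thesis using * assms by blast
  next
    case False then show ?thesis using *[of y x] assms by (simp add: abs_minus_commute)
  qed
qed

text \<open>The two arcs between \<open>x\<close> and \<open>y\<close> on the closed curve have the
  same end values, so each contributes the difference, and together they make up the whole
  variation.\<close>

lemma edge_var_loop:
  assumes "D = {0..l}" "f 0 = f l" "x \<in> D" "y \<in> D"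
  shows "\<bar>calib A (f y) - calib A (f x)\<bar> \<le> edge_var A D f f' / 2"
proof -
  let ?g = "\<lambda>t. weight A (f t) * \<bar>f' t\<bar>"
  have *: "\<bar>calib A (f y) - calib A (f x)\<bar> \<le> edge_var A D f f' / 2" if "x \<in> D" "y \<in> D" "x \<le> y" for x y
  proof -
    have i: "set_integrable lborel {0..l} ?g" using edge_H1_weight_integrable assms by simp
    then have i2: "set_integrable lborel {x..l} ?g" using that assms by (auto intro: set_integrable_subset)
    have "edge_var A D f f' = (LINT t:{0..x}|lborel. ?g t) + ((LINT t:{x..y}|lborel. ?g t) + (LINT t:{y..l}|lborel. ?g t))"
      unfolding edge_var_def assms(1)
      using set_integral_Icc_split[OF i, of x] set_integral_Icc_split[OF i2, of y] that assms by auto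
    moreover have "\<bar>calib A (f x) - calib A (f 0)\<bar> \<le> (LINT t:{0..x}|lborel. ?g t)"
      "\<bar>calib A (f y) - calib A (f x)\<bar> \<le> (LINT t:{x..y}|lborel. ?g t)"
      "\<bar>calib A (f l) - calib A (f y)\<bar> \<le> (LINT t:{y..l}|lborel. ?g t)"
      using that by (intro edge_var_Icc; simp add: assms(1))+
    ultimately show ?thesis unfolding assms(2) by linarith
  qed
  show ?thesis
  proof (cases "x \<le> y")
    case True then show ?thesis using * assms by blast
  next
    case False then show ?thesis using *[of y x] assms by (simp add: abs_minus_commute)
  qed
qed

text \<open>Since the square of \<open>weight\<close> is A^4 f^2 - f^6, the gap in the calibration
  is the integral of a square. Keeping it as an exact identity makes the equality case
  available.\<close>

lemma edge_deficit_eq: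
  "(LINT t:D|lborel. (\<bar>f' t\<bar> - k * weight A (f t))\<^sup>2) =
     (LINT t:D|lborel. (f' t)\<^sup>2) + k\<^sup>2 * (A^4 * (LINT t:D|lborel. (f t)\<^sup>2) - (LINT t:D|lborel. (f t)^6))
       - 2 * k * edge_var A D f f'"
  "set_integrable lborel D (\<lambda>t. (\<bar>f' t\<bar> - k * weight A (f t))\<^sup>2)"
proof -
  have i: "set_integrable lborel D (\<lambda>t. (f' t)\<^sup>2)" "set_integrable lborel D (\<lambda>t. (f t)\<^sup>2)"
    using H by (auto simp: edge_H1_def)
  let ?h = "\<lambda>t. (f' t)\<^sup>2 + k\<^sup>2 * (A^4 * (f t)\<^sup>2 - (f t)^6) - 2 * k * (weight A (f t) * \<bar>f' t\<bar>)"
  have eq: "(\<bar>f' t\<bar> - k * weight A (f t))\<^sup>2 = ?h t" if "t \<in> D" for t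
  proof -
    have "(\<bar>f' t\<bar> - k * weight A (f t))\<^sup>2 = (f' t)\<^sup>2 + k\<^sup>2 * (weight A (f t))\<^sup>2 - 2 * k * (weight A (f t) * \<bar>f' t\<bar>)"
      by (simp add: power2_diff power_mult_distrib algebra_simps)
    then show ?thesis using weight_square[OF fA[OF that]] by simp
  qed
  have b: "set_integrable lborel D (\<lambda>t. A^4 * (f t)\<^sup>2 - (f t)^6)"
    using i edge_H1_L6_integrable by simp
  show "set_integrable lborel D (\<lambda>t. (\<bar>f' t\<bar> - k * weight A (f t))\<^sup>2)"
  proof -
    have "set_integrable lborel D ?h" using i b edge_H1_weight_integrable by simp
    then show ?thesis using set_integrable_cong[of lborel lborel D D, OF refl refl eq] by simp
  qed
  have "(LINT t:D|lborel. (\<bar>f' t\<bar> - k * weight A (f t))\<^sup>2) = (LINT t:D|lborel. ?h t)"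
    using eq ray_domD[OF D] by (intro set_lebesgue_integral_cong) auto
  also have "\<dots> = (LINT t:D|lborel. (f' t)\<^sup>2) + k\<^sup>2 * (A^4 * (LINT t:D|lborel. (f t)\<^sup>2) - (LINT t:D|lborel. (f t)^6))
       - 2 * k * edge_var A D f f'"
    using i b edge_H1_weight_integrable edge_H1_L6_integrable by (simp add: edge_var_def)
  finally show "(LINT t:D|lborel. (\<bar>f' t\<bar> - k * weight A (f t))\<^sup>2) =
     (LINT t:D|lborel. (f' t)\<^sup>2) + k\<^sup>2 * (A^4 * (LINT t:D|lborel. (f t)\<^sup>2) - (LINT t:D|lborel. (f t)^6))
       - 2 * k * edge_var A D f f'" .
qed

lemma edge_deficit_zero_AE:
  assumes "(LINT t:D|lborel. (\<bar>f' t\<bar> - k * weight A (f t))\<^sup>2) = 0"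
  shows "AE t in lborel. t \<in> D \<longrightarrow> \<bar>f' t\<bar> = k * weight A (f t)"
proof -
  have "AE t in lborel. indicator D t *\<^sub>R (\<bar>f' t\<bar> - k * weight A (f t))\<^sup>2 = 0"
    using assms edge_deficit_eq(2)[of k]
      integral_nonneg_eq_0_iff_AE[of lborel "\<lambda>t. indicator D t *\<^sub>R (\<bar>f' t\<bar> - k * weight A (f t))\<^sup>2"]
    unfolding set_lebesgue_integral_def set_integrable_def by simp
  then show ?thesis by eventually_elim (auto simp: indicator_def split: if_splits)
qed

end

text \<open>A Gronwall-type uniqueness: on a short interval around a zero the maximum of |f| is at
  most half of itself. \<open>Bolzano\<close> carries the alternative along the edge.\<close>

lemma edge_H1_zero_propagates:
  assumes C: "AE t in lborel. t \<in> D \<longrightarrow> \<bar>f' t\<bar> \<le> C * \<bar>f t\<bar>" and xy: "x \<in> D" "y \<in> D" "x \<le> y"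
  shows "f x = 0 \<longleftrightarrow> f y = 0"
proof -
  have sub: "{x..y} \<subseteq> D" using ray_domD[OF D] xy by auto
  have fc: "continuous_on {x..y} f" by (rule continuous_on_subset[OF edge_H1_continuous[OF D H] sub])
  define P where "P a b \<longleftrightarrow> (a \<in> {x..y} \<and> b \<in> {x..y} \<longrightarrow> (f a = 0 \<longleftrightarrow> f b = 0))" for a b
  have "P x y" using xy(3)
  proof (induction rule: Bolzano)
    case (trans a b c)
    then show ?case unfolding P_def by auto
  next
    case (local z)
    then have z: "z \<in> {x..y}" by simp
    show ?case
    proof (cases "f z = 0")
      case False
      then obtain d where d: "d > 0" "\<And>t. t \<in> {x..y} \<Longrightarrow> dist t z < d \<Longrightarrow> dist (f t) (f z) < \<bar>f z\<bar>"
        using fc z zero_less_abs_iff[of "f z"] unfolding continuous_on_iff by blast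
      then have "f t \<noteq> 0" if "t \<in> {x..y}" "\<bar>t - z\<bar> < d" for t
        using that by (force simp: dist_real_def)
      then show ?thesis using d(1) unfolding P_def by (intro exI[of _ d]) auto
    next
      case True
      \<comment> \<open>This length gives |C| d at most 1/2; the added 1 covers
        \<open>C = 0\<close>.\<close>
      define d where "d = 1 / (2 * (\<bar>C\<bar> + 1))"
      have d: "d > 0" by (simp add: d_def)
      have zero: "f a = 0 \<and> f b = 0" if ab: "a \<le> z" "z \<le> b" "b - a < d" "a \<in> {x..y}" "b \<in> {x..y}" for a b
      proof -
        have cab: "continuous_on {a..b} (\<lambda>t. \<bar>f t\<bar>)"
          using ab by (intro continuous_intros continuous_on_subset[OF fc]) auto
        obtain m where m: "m \<in> {a..b}" "\<And>t. t \<in> {a..b} \<Longrightarrow> \<bar>f t\<bar> \<le> \<bar>f m\<bar>"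
          using continuous_attains_sup[OF _ _ cab] ab by auto
        have est: "\<bar>f q - f p\<bar> \<le> \<bar>C\<bar> * \<bar>f m\<bar> * d" if "p \<le> q" "p \<in> {a..b}" "q \<in> {a..b}" for p q
        proof -
          have pD: "p \<in> D" "q \<in> D" "{p..q} \<subseteq> D" using that ab sub by auto
          have "\<bar>f q - f p\<bar> \<le> (LINT t:{p..q}|lborel. \<bar>f' t\<bar>)"
            using edge_H1_abs_deriv_integrable(2)[OF D H pD(1,2) that(1)] .
          also have "\<dots> \<le> (LINT t:{p..q}|lborel. \<bar>C\<bar> * \<bar>f m\<bar>)"
          proof (rule set_integral_mono_AE)
            show "set_integrable lborel {p..q} (\<lambda>t. \<bar>f' t\<bar>)"
              using edge_H1_abs_deriv_integrable(1)[OF D H pD(1,2) that(1)] .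
            show "set_integrable lborel {p..q} (\<lambda>t. \<bar>C\<bar> * \<bar>f m\<bar>)"
              by (rule borel_integrable_atLeastAtMost') auto
            show "AE t\<in>{p..q} in lborel. \<bar>f' t\<bar> \<le> \<bar>C\<bar> * \<bar>f m\<bar>"
              using C
            proof eventually_elim
              case (elim t)
              show ?case
              proof
                assume t: "t \<in> {p..q}"
                then have "\<bar>f' t\<bar> \<le> C * \<bar>f t\<bar>" using elim pD by auto
                also have "\<dots> \<le> \<bar>C\<bar> * \<bar>f t\<bar>" by (intro mult_right_mono) auto
                also have "\<dots> \<le> \<bar>C\<bar> * \<bar>f m\<bar>" using m t that by (intro mult_left_mono) auto
                finally show "\<bar>f' t\<bar> \<le> \<bar>C\<bar> * \<bar>f m\<bar>" .
              qed
            qed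
          qed
          also have "\<dots> = (q - p) * (\<bar>C\<bar> * \<bar>f m\<bar>)"
            using that(1) by (simp add: set_lebesgue_integral_def)
          also have "\<dots> \<le> d * (\<bar>C\<bar> * \<bar>f m\<bar>)" using that ab by (intro mult_right_mono) auto
          finally show ?thesis by (simp add: mult.commute)
        qed
        have "\<bar>f m\<bar> \<le> \<bar>C\<bar> * \<bar>f m\<bar> * d"
        proof (cases "m \<le> z")
          case T: True
          then show ?thesis using est[of m z] m ab True by simp
        next
          case False
          then show ?thesis using est[of z m] m ab True by simp
        qed
        also have "\<dots> \<le> \<bar>f m\<bar> / 2" by (simp add: d_def field_simps)
        finally have "f m = 0" by simp
        then show ?thesis using m(2)[of a] m(2)[of b] ab by auto
      qed
      then show ?thesis using d unfolding P_def by (intro exI[of _ d]) blast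
    qed
  qed
  then show ?thesis using xy by (auto simp: P_def)
qed

end

section \<open>The sharp Gagliardo-Nirenberg inequality on a graph\<close>

lemma interval_emeasure_le:
  fixes I :: "real set"
  assumes I: "is_interval I" and V: "\<And>p q. p \<in> I \<Longrightarrow> q \<in> I \<Longrightarrow> \<bar>p - q\<bar> \<le> V" and "V \<ge> 0"
  shows "I \<in> sets borel" "emeasure lborel I \<le> ennreal V"
proof -
  show "I \<in> sets borel" using I by (simp add: is_interval_convex real_interval_borel_measurable)
  show "emeasure lborel I \<le> ennreal V"
  proof (cases "I = {}")
    case False
    then obtain p where p: "p \<in> I" by blast
    have bd: "bdd_below I" "bdd_above I"
      using V[OF p] by (auto intro!: bdd_belowI[of _ "p - V"] bdd_aboveI[of _ "p + V"]) (smt (verit))+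
    have "q - V \<le> Inf I" if "q \<in> I" for q
      using False V[OF that] by (intro cInf_greatest) force+
    then have "Sup I \<le> Inf I + V" using False by (intro cSup_least) force+
    moreover have "I \<subseteq> {Inf I..Sup I}" using bd by (auto intro: cInf_lower cSup_upper)
    then have "emeasure lborel I \<le> emeasure lborel {Inf I..Sup I}" by (intro emeasure_mono) auto
    moreover have "Inf I \<le> Sup I" using p bd by (meson cInf_lower cSup_upper order_trans)
    ultimately show ?thesis by (simp add: ennreal_leI order_trans)
  qed simp
qed

text \<open>Subadditivity of Lebesgue measure. In the application the bounds \<open>V\<close> are
  variations along edges, which may exceed the lengths of the sets.\<close>

lemma interval_cover_length:
  fixes I :: "'i \<Rightarrow> real set"
  assumes fin: "finite E" and int: "\<And>e. e \<in> E \<Longrightarrow> is_interval (I e)"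
    and V: "\<And>e p q. e \<in> E \<Longrightarrow> p \<in> I e \<Longrightarrow> q \<in> I e \<Longrightarrow> \<bar>p - q\<bar> \<le> V e"
    and V0: "\<And>e. e \<in> E \<Longrightarrow> V e \<ge> 0"
    and cover: "{0<..<T} \<subseteq> (\<Union>e\<in>E. I e)"
  shows "T \<le> sum V E"
proof (cases "T \<ge> 0")
  case True
  have meas: "I e \<in> sets lborel" "emeasure lborel (I e) \<le> ennreal (V e)" if "e \<in> E" for e
    using interval_emeasure_le[OF int V V0] that by auto
  have "ennreal T = emeasure lborel {0<..<T}" using True by simp
  also have "\<dots> \<le> emeasure lborel (\<Union>e\<in>E. I e)"
    using fin meas by (intro emeasure_mono[OF cover]) blast
  also have "\<dots> \<le> (\<Sum>e\<in>E. emeasure lborel (I e))"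
    using fin meas by (intro emeasure_subadditive_finite) auto
  also have "\<dots> \<le> (\<Sum>e\<in>E. ennreal (V e))"
using meas by (intro sum_mono) auto
  also have "\<dots> = ennreal (sum V E)" using V0 by simp
  finally show ?thesis using V0 by (simp add: ennreal_le_iff sum_nonneg)
next
  case False
  then show ?thesis using sum_nonneg[of E V] V0 by simp
qed

lemma interval_cover_overlap:
  fixes I :: "'i \<Rightarrow> real set"
  assumes fin: "finite E" and int: "\<And>e. e \<in> E \<Longrightarrow> is_interval (I e)"
    and V: "\<And>e p q. e \<in> E \<Longrightarrow> p \<in> I e \<Longrightarrow> q \<in> I e \<Longrightarrow> \<bar>p - q\<bar> \<le> V e"
    and V0: "\<And>e. e \<in> E \<Longrightarrow> V e \<ge> 0" and T: "T \<ge> 0"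
    and cover: "{0<..<T} \<subseteq> (\<Union>e\<in>E. I e)"
    and e: "a \<in> E" "b \<in> E" "a \<noteq> b" and pq: "p < q" "{p<..<q} \<subseteq> I a \<inter> I b"
  shows "T + (q - p) \<le> sum V E"
proof -
  \<comment> \<open>Removing \<open>{p<..<q}\<close> from one of the two sets leaves a cover, since
    the other still contains it, and lowers the total measure by \<open>q - p\<close>.\<close>
  let ?J = "I(a := I a - {p<..<q})"
  have meas: "I e \<in> sets lborel" "emeasure lborel (I e) \<le> ennreal (V e)" if "e \<in> E" for e
    using interval_emeasure_le[OF int V V0] that by auto
  have measJ: "?J e \<in> sets lborel" if "e \<in> E" for e using meas that e by auto
  have un: "(\<Union>e\<in>E. I e) \<subseteq> (\<Union>e\<in>E. ?J e)" using e pq by auto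
  have "ennreal T = emeasure lborel {0<..<T}" using T by simp
  also have "\<dots> \<le> emeasure lborel (\<Union>e\<in>E. ?J e)"
    by (rule emeasure_mono[OF order_trans[OF cover un]]) (use fin measJ in blast)
  also have "\<dots> \<le> (\<Sum>e\<in>E. emeasure lborel (?J e))"
    using fin measJ by (intro emeasure_subadditive_finite) blast+
  finally have "ennreal T + ennreal (q - p) \<le> (\<Sum>e\<in>E. emeasure lborel (?J e)) + ennreal (q - p)"
    by (rule add_right_mono)
  also have "\<dots> = (\<Sum>e\<in>E - {a}. emeasure lborel (I e)) + (emeasure lborel (I a - {p<..<q}) + emeasure lborel {p<..<q})"
    using fin e pq by (simp add: sum.remove[of E a] add_ac)
  also have "emeasure lborel (I a - {p<..<q}) + emeasure lborel {p<..<q} = emeasure lborel (I a)"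
  proof -
    have "emeasure lborel (I a) = emeasure lborel ((I a - {p<..<q}) \<union> {p<..<q})"
      using pq by (intro arg_cong[where f = "emeasure lborel"]) auto
    also have "\<dots> = emeasure lborel (I a - {p<..<q}) + emeasure lborel {p<..<q}"
      using meas[OF e(1)] by (intro plus_emeasure[symmetric]) auto
    finally show ?thesis by simp
  qed
  also have "(\<Sum>e\<in>E - {a}. emeasure lborel (I e)) + emeasure lborel (I a) = (\<Sum>e\<in>E. emeasure lborel (I e))"
    using fin e by (simp add: sum.remove[of E a] add_ac)
  also have "\<dots> \<le> (\<Sum>e\<in>E. ennreal (V e))" using meas by (intro sum_mono) auto
  also have "\<dots> = ennreal (sum V E)" using V0 by simp
  finally have "ennreal (T + (q - p)) \<le> ennreal (sum V E)" using T pq by simp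
  then show ?thesis using V0 by (simp add: ennreal_le_iff sum_nonneg)
qed

text \<open>Connectedness in the form in which it is consumed: for a set of vertices given by a
  condition on \<open>u\<close> it yields an edge across which the condition changes. It also passes
  to the graph without a leaf, with no rerouting of paths.\<close>

definition cut_connected :: "('v, 'e) mgraph \<Rightarrow> bool" where
  "cut_connected G \<longleftrightarrow> (\<forall>S \<subseteq> verts G. S \<noteq> {} \<longrightarrow> S \<noteq> verts G \<longrightarrow>
     (\<exists>e\<in>bedges G. (src G e \<in> S) \<noteq> (tgt G e \<in> S)))"

lemma mg_connected_imp_cut_connected:
  assumes "mg_connected G" shows "cut_connected G"
  unfolding cut_connected_def
proof (intro allI impI)
  fix S assume S: "S \<subseteq> verts G" "S \<noteq> {}" "S \<noteq> verts G"
  then obtain a b where ab: "a \<in> S" "b \<in> verts G" "b \<notin> S" by blast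
  then have "(a, b) \<in> (mg_adj G)\<^sup>*" using assms S by (auto simp: mg_connected_def)
  then have "b \<in> S \<or> (\<exists>e\<in>bedges G. (src G e \<in> S) \<noteq> (tgt G e \<in> S))"
  proof (induction rule: rtrancl_induct)
    case (step y z)
    then show ?case unfolding mg_adj_def by blast
  qed (use ab in simp)
  then show "\<exists>e\<in>bedges G. (src G e \<in> S) \<noteq> (tgt G e \<in> S)" using ab by blast
qed

section \<open>Functions on a graph, edge by edge\<close>

lemma edge_dom_ray:
  assumes "metric_graph G" "e \<in> edges G" shows "ray_dom (edge_dom G e)"
  using assms by (auto simp: ray_dom_def edge_dom_def metric_graph_def edges_def intro: less_imp_le)

lemma H1_pair_edge: "H1_pair G u u' \<Longrightarrow> e \<in> edges G \<Longrightarrow> edge_H1 (edge_dom G e) (u e) (u' e)"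
  by (auto simp: H1_pair_def edge_H1_def)

lemma H1_pair_vertex_values:
  assumes "metric_graph G" "H1_pair G u u'"
  shows "\<exists>c. (\<forall>e\<in>bedges G. u e 0 = c (src G e) \<and> u e (len G e) = c (tgt G e)) \<and>
             (\<forall>h\<in>hedges G. u h 0 = c (src G h))"
proof -
  have "\<forall>v\<in>verts G. \<exists>c.
        (\<forall>e\<in>bedges G. (src G e = v \<longrightarrow> u e 0 = c) \<and> (tgt G e = v \<longrightarrow> u e (len G e) = c)) \<and>
        (\<forall>h\<in>hedges G. src G h = v \<longrightarrow> u h 0 = c)" using assms by (simp add: H1_pair_def)
  from bchoice[OF this] obtain c where "\<forall>v\<in>verts G.
        (\<forall>e\<in>bedges G. (src G e = v \<longrightarrow> u e 0 = c v) \<and> (tgt G e = v \<longrightarrow> u e (len G e) = c v)) \<and>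
        (\<forall>h\<in>hedges G. src G h = v \<longrightarrow> u h 0 = c v)" ..
  then show ?thesis using assms(1) unfolding metric_graph_def by (intro exI[of _ c]) blast
qed

lemma mass_nonneg: "0 \<le> mass G w"
  unfolding mass_def by (intro sum_nonneg set_integral_nonneg_real) simp

locale H1_graph =
  fixes G :: "('v, 'e) mgraph" and u u' :: "'e \<Rightarrow> real \<Rightarrow> real"
  assumes mg: "metric_graph G" and con: "cut_connected G" and nc: "noncompact G"
    and H1: "H1_pair G u u'"
begin

abbreviation "dm \<equiv> edge_dom G"

lemma fin: "finite (edges G)" using mg by (simp add: metric_graph_def edges_def)

lemma ray: "e \<in> edges G \<Longrightarrow> ray_dom (dm e)" by (rule edge_dom_ray[OF mg])

lemma edge: "e \<in> edges G \<Longrightarrow> edge_H1 (dm e) (u e) (u' e)" by (rule H1_pair_edge[OF H1])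

lemma hedge: "h \<in> hedges G \<Longrightarrow> h \<in> edges G \<and> dm h = {0..}"
  using mg by (auto simp: edges_def edge_dom_def metric_graph_def)

lemma bedge: "e \<in> bedges G \<Longrightarrow> e \<in> edges G \<and> dm e = {0..len G e} \<and> 0 < len G e"
  using mg by (auto simp: edges_def edge_dom_def metric_graph_def)

definition vval :: "'v \<Rightarrow> real" where
  "vval = (SOME c. (\<forall>e\<in>bedges G. u e 0 = c (src G e) \<and> u e (len G e) = c (tgt G e)) \<and>
             (\<forall>h\<in>hedges G. u h 0 = c (src G h)))"

lemma vval:
  "e \<in> bedges G \<Longrightarrow> u e 0 = vval (src G e)" "e \<in> bedges G \<Longrightarrow> u e (len G e) = vval (tgt G e)"
  "e \<in> hedges G \<Longrightarrow> u e 0 = vval (src G e)" "e \<in> edges G \<Longrightarrow> u e 0 = vval (src G e)"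
  using someI_ex[OF H1_pair_vertex_values[OF mg H1], folded vval_def] by (auto simp: edges_def)

definition wimg :: "real \<Rightarrow> 'e \<Rightarrow> real set" where
  "wimg A e = (\<lambda>x. calib A (u e x)) ` dm e"

definition var :: "real \<Rightarrow> 'e \<Rightarrow> real" where
  "var A e = edge_var A (dm e) (u e) (u' e)"

definition "usup = Sup {\<bar>u e x\<bar> | e x. e \<in> edges G \<and> x \<in> dm e}"

lemma edges_ne: "edges G \<noteq> {}" using nc by (auto simp: noncompact_def edges_def)

lemma src_verts: "e \<in> edges G \<Longrightarrow> src G e \<in> verts G"
  using mg by (auto simp: metric_graph_def edges_def)

lemma bdd: "bdd_above {\<bar>u e x\<bar> | e x. e \<in> edges G \<and> x \<in> dm e}"
proof -
  have "\<forall>e\<in>edges G. \<exists>B>0. \<forall>x\<in>dm e. \<bar>u e x\<bar> \<le> B" using edge_H1_bounded[OF ray edge] by blast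
  then obtain B where B: "\<forall>e\<in>edges G. B e > 0 \<and> (\<forall>x\<in>dm e. \<bar>u e x\<bar> \<le> B e)" by metis
  then have "\<bar>u e x\<bar> \<le> sum B (edges G)" if "e \<in> edges G" "x \<in> dm e" for e x
    using that member_le_sum[of e "edges G" B] fin by (force intro: order_trans less_imp_le)
  then show ?thesis by (auto intro!: bdd_aboveI)
qed

lemma usup_upper: "e \<in> edges G \<Longrightarrow> x \<in> dm e \<Longrightarrow> \<bar>u e x\<bar> \<le> usup"
  unfolding usup_def by (rule cSup_upper[OF _ bdd]) auto

lemma usup_lt:
  assumes "s < usup" shows "\<exists>e\<in>edges G. \<exists>x\<in>dm e. s < \<bar>u e x\<bar>"
proof -
  have "{\<bar>u e x\<bar> | e x. e \<in> edges G \<and> x \<in> dm e} \<noteq> {}"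
    using edges_ne ray_domD(1)[OF ray] by blast
  from less_cSupD[OF this assms[unfolded usup_def]] show ?thesis by blast
qed

lemma usup_pos:
  assumes "mass G u \<noteq> 0" shows "0 < usup"
proof (rule ccontr)
  assume "\<not> 0 < usup"
  then have z: "u e x = 0" if "e \<in> edges G" "x \<in> dm e" for e x using usup_upper[OF that] by simp
  have "mass G u = (\<Sum>e\<in>edges G. 0)" unfolding mass_def
  proof (rule sum.cong)
    fix e assume e: "e \<in> edges G"
    have "(LINT x:dm e|lborel. (u e x)\<^sup>2) = (LINT x:dm e|lborel. 0)"
      using z[OF e] ray_domD(4)[OF ray[OF e]] by (intro set_lebesgue_integral_cong) auto
    then show "(LINT x:dm e|lborel. (u e x)\<^sup>2) = 0" by simp
  qed simp
  then show False using assms by simp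
qed

context
  fixes A :: real
  assumes A: "A > 0" and uA: "usup \<le> A"
begin

lemma u_le: "e \<in> edges G \<Longrightarrow> x \<in> dm e \<Longrightarrow> \<bar>u e x\<bar> \<le> A"
  using usup_upper uA by force

lemma var_nonneg: "e \<in> edges G \<Longrightarrow> 0 \<le> var A e"
  unfolding var_def by (rule edge_var_nonneg[OF ray edge A u_le])

lemma calib_u_continuous:
  assumes "e \<in> edges G" shows "continuous_on (dm e) (\<lambda>x. calib A (u e x))"
  by (rule continuous_on_compose2[OF calib_continuous[OF A] edge_H1_continuous[OF ray edge]])
     (use assms u_le[OF assms] in \<open>force simp: abs_le_iff\<close>)+

lemma wimg_interval:
  assumes "e \<in> edges G" shows "is_interval (wimg A e)"
  unfolding wimg_def is_interval_connected_1
  using ray_domD(5)[OF ray[OF assms]]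
  by (intro connected_continuous_image calib_u_continuous assms) (simp add: is_interval_connected_1)

lemma wimg_var: "e \<in> edges G \<Longrightarrow> p \<in> wimg A e \<Longrightarrow> q \<in> wimg A e \<Longrightarrow> \<bar>p - q\<bar> \<le> var A e"
  unfolding wimg_def var_def using edge_var_ge[OF ray edge A u_le] by auto

lemma halfline_small:
  assumes "h \<in> hedges G" "\<tau> > 0" shows "\<exists>p\<in>wimg A h. p < \<tau>"
proof -
  have h: "h \<in> edges G" "dm h = {0..}" using hedge assms by auto
  have "isCont (calib A) 0" using calib_deriv[of A 0] A DERIV_isCont by simp
  then obtain d where d: "d > 0" "\<And>t. dist t 0 < d \<Longrightarrow> dist (calib A t) (calib A 0) < \<tau>"
    using assms(2) unfolding continuous_at_eps_delta by (metis dist_real_def)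
  obtain x where "x \<ge> 0" "\<bar>u h x\<bar> < d" using edge_H1_liminf_zero[OF ray edge] h d(1) by blast
  then show ?thesis using d(2)[of "u h x"] h by (force simp: wimg_def calib_zero)
qed

text \<open>The intermediate value theorem on a graph. If no image contains \<tau>, every edge lies
  entirely below or entirely above it; a halfline lies below, \<open>e0\<close> lies above, and by
  \<open>cut_connected\<close> some bounded edge joins a vertex below to one above.\<close>

lemma wimg_cover:
  assumes e0: "e0 \<in> edges G" "x0 \<in> dm e0" and \<tau>: "0 < \<tau>" "\<tau> < calib A (u e0 x0)"
  shows "\<exists>e\<in>edges G. \<tau> \<in> wimg A e"
proof (rule ccontr)
  assume neg: "\<not> ?thesis"
  have side: "p < \<tau> \<longleftrightarrow> q < \<tau>" if "e \<in> edges G" "p \<in> wimg A e" "q \<in> wimg A e" for e p q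
    using neg wimg_interval[OF that(1)] that unfolding is_interval_1 by (smt (verit))
  obtain h where h: "h \<in> hedges G" using nc by (auto simp: noncompact_def)
  have w0: "calib A (vval (src G e)) \<in> wimg A e" if "e \<in> edges G" for e
    using vval(4)[OF that] ray_domD(1)[OF ray[OF that]] by (force simp: wimg_def)
  have w1: "calib A (vval (tgt G e)) \<in> wimg A e" if "e \<in> bedges G" for e
    unfolding wimg_def using vval(2)[OF that] bedge[OF that] by (intro image_eqI[of _ _ "len G e"]) auto
  let ?S = "{v \<in> verts G. calib A (vval v) < \<tau>}"
  have "src G h \<in> ?S"
    using side[of h] w0[of h] hedge[OF h] halfline_small[OF h \<tau>(1)] src_verts by blast
  moreover have "src G e0 \<notin> ?S"
    using side[OF e0(1) w0[OF e0(1)], of "calib A (u e0 x0)"] e0 \<tau> by (auto simp: wimg_def)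
  ultimately have "?S \<noteq> {}" "?S \<noteq> verts G" using src_verts[OF e0(1)] by auto
  moreover have "?S \<subseteq> verts G" by blast
  ultimately obtain e where e: "e \<in> bedges G" "(src G e \<in> ?S) \<noteq> (tgt G e \<in> ?S)"
    using con unfolding cut_connected_def by meson
  moreover have "src G e \<in> verts G" "tgt G e \<in> verts G" using mg e(1) by (auto simp: metric_graph_def)
  ultimately show False using side[of e, OF _ w0 w1] bedge[OF e(1)] by auto
qed

text \<open>The supremum is approached, not assumed to be attained: by continuity \<tau> is below
  \<open>calib A s\<close> for some \<open>s < usup\<close>, and |u| exceeds this \<open>s\<close>
  at some point.\<close>

lemma wimg_cover_usup: "{0<..<calib A usup} \<subseteq> (\<Union>e\<in>edges G. wimg A e)"
proof
  fix \<tau> assume \<tau>: "\<tau> \<in> {0<..<calib A usup}"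
  have up: "usup > 0"
  proof (rule ccontr)
    assume "\<not> usup > 0"
    moreover have "usup \<ge> 0"
      using edges_ne usup_upper ray_domD(1)[OF ray] by (meson abs_ge_zero equals0I order_trans)
    ultimately have "usup = 0" by simp
    then show False using \<tau> by (simp add: calib_zero)
  qed
  have "\<exists>s. 0 \<le> s \<and> s < usup \<and> \<tau> < calib A s"
  proof (rule ccontr)
    assume "\<not> ?thesis"
    then have "calib A ` {0..<usup} \<subseteq> {..\<tau>}" by force
    moreover have "continuous_on (closure {0..<usup}) (calib A)"
      using up uA by (auto intro: continuous_on_subset[OF calib_continuous[OF A]])
    ultimately have "calib A ` closure {0..<usup} \<subseteq> {..\<tau>}" by (intro image_closure_subset) auto
    moreover have "usup \<in> closure {0..<usup}" using up by simp
    ultimately have "calib A usup \<in> {..\<tau>}" by blast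
    then show False using \<tau> by simp
  qed
  then obtain s where s: "0 \<le> s" "s < usup" "\<tau> < calib A s" by blast
  obtain e x where ex: "e \<in> edges G" "x \<in> dm e" "s < \<bar>u e x\<bar>" using usup_lt[OF s(2)] by blast
  have "\<tau> < calib A (u e x)"
    using s calib_mono[of s "\<bar>u e x\<bar>" A] u_le[OF ex(1,2)] ex(3) by (simp add: calib_even)
  then show "\<tau> \<in> (\<Union>e\<in>edges G. wimg A e)" using wimg_cover[OF ex(1,2)] \<tau> by auto
qed

lemma var_total: "calib A usup \<le> (\<Sum>e\<in>edges G. var A e)"
  by (rule interval_cover_length[OF fin wimg_interval wimg_var var_nonneg wimg_cover_usup])

lemma deficit_total:
  "(\<Sum>e\<in>edges G. (LINT t:dm e|lborel. (\<bar>u' e t\<bar> - k * weight A (u e t))\<^sup>2)) =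
     mass G u' + k\<^sup>2 * (A^4 * mass G u - L6 G u) - 2 * k * (\<Sum>e\<in>edges G. var A e)"
proof -
  have "(\<Sum>e\<in>edges G. (LINT t:dm e|lborel. (\<bar>u' e t\<bar> - k * weight A (u e t))\<^sup>2)) =
    (\<Sum>e\<in>edges G. (LINT t:dm e|lborel. (u' e t)\<^sup>2) + k\<^sup>2 * (A^4 * (LINT t:dm e|lborel. (u e t)\<^sup>2)
       - (LINT t:dm e|lborel. (u e t)^6)) - 2 * k * var A e)"
    unfolding var_def by (intro sum.cong refl edge_deficit_eq(1)[OF ray edge A u_le])
  then show ?thesis
    by (simp add: mass_def L6_def sum.distrib sum_subtractf sum_distrib_left right_diff_distrib mult.assoc)
qed

lemma deficit_nonneg: "0 \<le> (LINT t:dm e|lborel. (\<bar>u' e t\<bar> - k * weight A (u e t))\<^sup>2)"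
  by (rule set_integral_nonneg_real) simp

lemma calibration_inequality:
  assumes "k \<ge> 0"
  shows "2 * k * calib A usup \<le> mass G u' + k\<^sup>2 * (A^4 * mass G u - L6 G u)"
proof -
  have "2 * k * calib A usup \<le> 2 * k * (\<Sum>e\<in>edges G. var A e)"
    using var_total assms by (intro mult_left_mono) auto
  moreover have "0 \<le> (\<Sum>e\<in>edges G. (LINT t:dm e|lborel. (\<bar>u' e t\<bar> - k * weight A (u e t))\<^sup>2))"
    by (intro sum_nonneg deficit_nonneg)
  ultimately show ?thesis using deficit_total[of k] by simp
qed

end

lemma Gagliardo_Nirenberg: "L6 G u \<le> 16 / pi\<^sup>2 * (mass G u)\<^sup>2 * mass G u'"
proof (cases "mass G u = 0")
  case False
  then have m: "mass G u > 0" using mass_nonneg[of G u] by simp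
  have M: "usup > 0" using usup_pos False by simp
  \<comment> \<open>The \<open>k\<close> for which \<open>2 * k * calib usup usup\<close> equals
    \<open>k\<^sup>2 * usup^4 * mass G u\<close>.\<close>
  define k where "k = pi / (4 * mass G u)"
  have k: "k > 0" "k * mass G u = pi / 4" using m by (auto simp: k_def)
  have "2 * k * calib usup usup \<le> mass G u' + k\<^sup>2 * (usup^4 * mass G u - L6 G u)"
    using calibration_inequality[OF M order_refl, of k] k by simp
  also have "k\<^sup>2 * (usup^4 * mass G u - L6 G u) = k * usup^4 * (k * mass G u) - k\<^sup>2 * L6 G u"
    by (simp add: algebra_simps power2_eq_square)
  finally have "k\<^sup>2 * L6 G u \<le> mass G u'" unfolding calib_top[OF M] k(2) by simp
  then show ?thesis unfolding k_def using m by (simp add: field_simps power_divide)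
next
  case True
  \<comment> \<open>With zero mass, where the \<open>k\<close> above would divide by 0,
    \<open>u\<close> vanishes almost everywhere on each edge.\<close>
  have "L6 G u = 0"
  proof -
    have z: "(LINT x:dm e|lborel. (u e x)\<^sup>2) = 0" if "e \<in> edges G" for e
      using True that fin unfolding mass_def
      by (subst (asm) sum_nonneg_eq_0_iff) (auto intro: set_integral_nonneg_real)
    have "(LINT x:dm e|lborel. (u e x)^6) = 0" if "e \<in> edges G" for e
    proof -
      have i: "integrable lborel (\<lambda>x. indicator (dm e) x *\<^sub>R (u e x)\<^sup>2)"
        using edge[OF that] by (simp add: edge_H1_def set_integrable_def)
      have "AE x in lborel. indicator (dm e) x *\<^sub>R (u e x)\<^sup>2 = 0"
        using z[OF that] integral_nonneg_eq_0_iff_AE[OF i] by (simp add: set_lebesgue_integral_def)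
      then have "AE x in lborel. indicator (dm e) x *\<^sub>R (u e x)^6 = 0"
        by eventually_elim (auto simp: indicator_def split: if_splits)
      then show ?thesis unfolding set_lebesgue_integral_def by (rule integral_eq_zero_AE)
    qed
    then show ?thesis by (simp add: L6_def)
  qed
  then show ?thesis using True by simp
qed

end

section \<open>The equality case\<close>

text \<open>The angle complementary to arctan d has sine 1 / sqrt (1 + d^2). This evaluates the
  arcsin in \<open>calib A usup\<close> at the perturbed parameter of
  \<open>var_pos\<close>.\<close>

lemma arcsin_inverse_sqrt: "arcsin (1 / sqrt (1 + d\<^sup>2)) = pi / 2 - arctan d" if "d > 0" for d :: real
proof -
  have "1 / sqrt (1 + d\<^sup>2) = sin (pi / 2 - arctan d)" by (simp add: sin_diff cos_arctan)
  moreover have "- (pi / 2) \<le> pi / 2 - arctan d" "pi / 2 - arctan d \<le> pi / 2"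
    using arctan_ubound[of d] arctan_lbound[of d] zero_less_arctan_iff[of d] that pi_gt_zero by linarith+
  ultimately show ?thesis by (metis arcsin_sin)
qed

locale extremal = H1_graph +
  assumes mass_crit: "mass G u = pi * sqrt 3 / 4" and energy_zero: "energy G u u' = 0"
begin

lemma usup_gt: "usup > 0" using usup_pos mass_crit by simp

lemma L6_eq: "L6 G u = 3 * mass G u'" using energy_zero by (simp add: energy_def)

text \<open>At the critical mass \<open>k = pi / (4 * mass G u)\<close> is 1 / sqrt 3, so k^2
  \<open>L6 G u\<close> cancels \<open>mass G u'\<close> by \<open>L6_eq\<close>; the constant
  \<open>pi * sqrt 3 / 12\<close> is k^2 times the critical mass.\<close>

lemma deficit_sum:
  assumes "A > 0" "usup \<le> A"
  shows "(\<Sum>e\<in>edges G. (LINT t:dm e|lborel. (\<bar>u' e t\<bar> - 1 / sqrt 3 * weight A (u e t))\<^sup>2))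
    \<le> A^4 * (pi * sqrt 3 / 12) - 2 / sqrt 3 * (\<Sum>e\<in>edges G. var A e)"
  unfolding deficit_total[OF assms] L6_eq mass_crit by (simp add: power_divide diff_divide_distrib)

lemma crit_const: "2 / sqrt 3 * (pi * x / 8) = x * (pi * sqrt 3 / 12)"
  by (simp add: field_simps)

text \<open>For \<open>A = usup\<close> the bound of \<open>deficit_sum\<close> is at most 0 by
  \<open>var_total\<close> and \<open>crit_const\<close>, so both inequalities behind the estimate,
  the pointwise square and the covering of levels, are equalities.\<close>

lemma
  shows deficit_zero: "e \<in> edges G \<Longrightarrow>
      (LINT t:dm e|lborel. (\<bar>u' e t\<bar> - 1 / sqrt 3 * weight usup (u e t))\<^sup>2) = 0"
    and var_sum: "(\<Sum>e\<in>edges G. var usup e) = calib usup usup"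
proof -
  let ?d = "\<lambda>e. (LINT t:dm e|lborel. (\<bar>u' e t\<bar> - 1 / sqrt 3 * weight usup (u e t))\<^sup>2)"
  have ge: "2 / sqrt 3 * calib usup usup \<le> 2 / sqrt 3 * (\<Sum>e\<in>edges G. var usup e)"
    by (intro mult_left_mono var_total[OF usup_gt]) auto
  have nn: "0 \<le> ?d e" for e by (rule set_integral_nonneg_real) simp
  have top: "2 / sqrt 3 * calib usup usup = usup^4 * (pi * sqrt 3 / 12)"
    unfolding calib_top[OF usup_gt] by (rule crit_const)
  have sum0: "sum ?d (edges G) \<le> 0" using deficit_sum[OF usup_gt order_refl] ge top by linarith
  then have "sum ?d (edges G) = 0" using nn by (simp add: antisym sum_nonneg)
  then show "e \<in> edges G \<Longrightarrow> ?d e = 0" for e using nn fin by (simp add: sum_nonneg_eq_0_iff)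
  have "2 / sqrt 3 * (\<Sum>e\<in>edges G. var usup e) = 2 / sqrt 3 * calib usup usup"
    using deficit_sum[OF usup_gt order_refl] ge top \<open>sum ?d (edges G) = 0\<close> by linarith
  then show "(\<Sum>e\<in>edges G. var usup e) = calib usup usup" by simp
qed

text \<open>Equality gives |u'| = weight / sqrt 3 almost everywhere, hence at most a multiple of
  |u|, which is what \<open>edge_H1_zero_propagates\<close> asks for.\<close>

lemma zero_propagates:
  assumes e: "e \<in> edges G" and xy: "x \<in> dm e" "y \<in> dm e" and z: "u e x = 0"
  shows "u e y = 0"
proof -
  have "AE t in lborel. t \<in> dm e \<longrightarrow> \<bar>u' e t\<bar> = 1 / sqrt 3 * weight usup (u e t)"
    by (rule edge_deficit_zero_AE[OF ray edge usup_gt usup_upper deficit_zero]) (use e in auto)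
  then have "AE t in lborel. t \<in> dm e \<longrightarrow> \<bar>u' e t\<bar> \<le> usup\<^sup>2 / sqrt 3 * \<bar>u e t\<bar>"
  proof eventually_elim
    case (elim t)
    then show ?case using weight_le[of usup "u e t"] by (auto simp: divide_right_mono)
  qed
  then show ?thesis
    using edge_H1_zero_propagates[OF ray[OF e] edge[OF e]] xy z by (meson le_cases)
qed

text \<open>A zero spreads over its edge, then to every vertex across the edges found by
  \<open>cut_connected\<close>, and \<open>u\<close> would vanish identically, against
  \<open>usup_gt\<close>.\<close>

lemma nonvanishing:
  assumes e0: "e0 \<in> edges G" "x0 \<in> dm e0" shows "u e0 x0 \<noteq> 0"
proof
  assume z0: "u e0 x0 = 0"
  let ?S = "{v \<in> verts G. vval v = 0}"
  have dom0: "0 \<in> dm e" if "e \<in> edges G" for e using ray_domD(1)[OF ray[OF that]] .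
  have "vval (src G e0) = 0" using zero_propagates[OF e0 dom0[OF e0(1)] z0] vval(4)[OF e0(1)] by simp
  then have ne: "?S \<noteq> {}" using src_verts[OF e0(1)] by blast
  have "?S = verts G"
  proof (rule ccontr)
    assume "?S \<noteq> verts G"
    moreover have "?S \<subseteq> verts G" by blast
    ultimately obtain e where e: "e \<in> bedges G" "(src G e \<in> ?S) \<noteq> (tgt G e \<in> ?S)"
      using con ne unfolding cut_connected_def by meson
    have be: "e \<in> edges G" "0 \<in> dm e" "len G e \<in> dm e" using bedge[OF e(1)] by auto
    have "src G e \<in> verts G" "tgt G e \<in> verts G" using mg e(1) by (auto simp: metric_graph_def)
    then show False
      using e zero_propagates[OF be] zero_propagates[OF be(1,3,2)] vval(1,2)[OF e(1)] by auto
  qed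
  then have "u e x = 0" if "e \<in> edges G" "x \<in> dm e" for e x
    using zero_propagates[OF that(1) dom0[OF that(1)] that(2)] vval(4)[OF that(1)] src_verts[OF that(1)] by auto
  then show False using usup_lt[OF usup_gt] by auto
qed

text \<open>The positive quantity that the estimate in \<open>var_pos\<close> would make smaller
  than half of itself.\<close>

lemma edge_mass_pos:
  assumes e: "e \<in> edges G" shows "0 < (LINT t:dm e|lborel. (u e t)\<^sup>2)"
proof (rule ccontr)
  assume "\<not> ?thesis"
  moreover have "0 \<le> (LINT t:dm e|lborel. (u e t)\<^sup>2)" by (rule set_integral_nonneg_real) simp
  ultimately have z: "(LINT t:dm e|lborel. (u e t)\<^sup>2) = 0" by simp
  have i: "integrable lborel (\<lambda>x. indicator (dm e) x *\<^sub>R (u e x)\<^sup>2)"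
    using edge[OF e] by (simp add: edge_H1_def set_integrable_def)
  have "AE x in lborel. indicator (dm e) x *\<^sub>R (u e x)\<^sup>2 = 0"
    using z integral_nonneg_eq_0_iff_AE[OF i] by (simp add: set_lebesgue_integral_def)
  then have ae: "AE x in lborel. x \<notin> dm e"
    by eventually_elim (use nonvanishing[OF e] in \<open>auto simp: indicator_def split: if_splits\<close>)
  obtain l where l: "l > 0" "{0..l} \<subseteq> dm e"
    using e bedge[of e] hedge[of e] by (cases "e \<in> bedges G") (auto simp: edges_def intro: that[of 1])
  have "AE x in lborel. x \<notin> {0..l}" using ae by eventually_elim (use l in blast)
  then have "emeasure lborel {0..l} = 0" by (subst (asm) AE_iff_measurable[of "{0..l}"]) auto
  then show False using l by simp
qed

text \<open>An edge with \<open>var usup e = 0\<close> would carry the constant \<open>usup\<close>. Raising the parameter from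
  \<open>usup\<close> to \<open>A\<close> with \<open>A\<^sup>4 = usup\<^sup>4 (1 + d\<^sup>2)\<close> costs only order \<open>d\<^sup>3\<close> in the calibration inequality,
  while the deficit of such an edge is of order \<open>d\<^sup>2\<close>.\<close>

lemma var_pos:
  assumes e: "e \<in> edges G" shows "0 < var usup e"
proof (rule ccontr)
  assume "\<not> ?thesis"
  then have v0: "var usup e = 0" using var_nonneg[OF usup_gt order_refl e] by simp
  define m where "m = (LINT t:dm e|lborel. (u e t)\<^sup>2)"
  define D where "D = (LINT t:dm e|lborel. (u' e t)\<^sup>2)"
  define l where "l = (LINT t:dm e|lborel. (u e t)^6)"
  have m: "m > 0" using edge_mass_pos[OF e] by (simp add: m_def)
  have i: "set_integrable lborel (dm e) (\<lambda>t. (u e t)\<^sup>2)" using edge[OF e] by (simp add: edge_H1_def)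
  have D0: "D \<ge> 0" unfolding D_def by (rule set_integral_nonneg_real) simp
  have "l \<le> (LINT t:dm e|lborel. usup^4 * (u e t)\<^sup>2)" unfolding l_def
  proof (rule set_integral_mono)
    show "set_integrable lborel (dm e) (\<lambda>t. (u e t)^6)"
      by (rule edge_H1_L6_integrable[OF ray[OF e] edge[OF e]])
    show "(u e t)^6 \<le> usup^4 * (u e t)\<^sup>2" if "t \<in> dm e" for t
      using mult_right_mono[OF power4_le[OF usup_upper[OF e that]], of "(u e t)\<^sup>2"]
      by (simp add: power_add[symmetric])
  qed (use i in simp)
  then have l: "l \<le> usup^4 * m" by (simp add: m_def)
  have eq: "0 = D + 1/3 * (usup^4 * m - l)"
    using edge_deficit_eq(1)[OF ray[OF e] edge[OF e] usup_gt usup_upper[OF e], of "1 / sqrt 3"]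
      deficit_zero[OF e] v0 unfolding var_def m_def D_def l_def by (simp add: power_divide)
  have "0 \<le> 1/3 * (usup^4 * m - l)" using l by simp
  then have "D = 0" using eq D0 by linarith
  then have Dl: "D = 0" "l = usup^4 * m" using eq by auto
  have i': "integrable lborel (\<lambda>t. indicator (dm e) t *\<^sub>R (u' e t)\<^sup>2)"
    using edge[OF e] by (simp add: edge_H1_def set_integrable_def)
  have ae: "AE t in lborel. indicator (dm e) t *\<^sub>R (u' e t)\<^sup>2 = 0"
    using Dl(1) integral_nonneg_eq_0_iff_AE[OF i'] by (simp add: D_def set_lebesgue_integral_def)
  have varA: "var A e = 0" for A
    unfolding var_def edge_var_def set_lebesgue_integral_def
    by (rule integral_eq_zero_AE) (use ae in eventually_elim, auto simp: indicator_def split: if_splits)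
  have small: "m \<le> sqrt 3 / 2 * d" if d: "d > 0" for d
  proof -
    define r where "r = sqrt (1 + d\<^sup>2)"
    have r: "r > 1" "r\<^sup>2 = 1 + d\<^sup>2" using d by (auto simp: r_def)
    \<comment> \<open>With this choice \<open>sqrt (A^4 - usup^4)\<close> is
      \<open>usup\<^sup>2 * d\<close> and the arcsin in \<open>calib A usup\<close> is
      \<open>pi / 2 - arctan d\<close>, so the cost is explicit in \<open>d\<close>.\<close>
    define A where "A = usup * sqrt r"
    have A2: "A\<^sup>2 = usup\<^sup>2 * r" using r by (simp add: A_def power_mult_distrib)
    have "A^4 = (A\<^sup>2)\<^sup>2" by simp
    then have A4: "A^4 = usup^4 * (1 + d\<^sup>2)" unfolding A2 using r by (simp add: power_mult_distrib)
    have A: "A > 0" "usup \<le> A" using usup_gt r by (auto simp: A_def)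
    let ?d = "\<lambda>e. (LINT t:dm e|lborel. (\<bar>u' e t\<bar> - 1 / sqrt 3 * weight A (u e t))\<^sup>2)"
    have "1/3 * (A^4 * m - usup^4 * m) = ?d e"
      using edge_deficit_eq(1)[OF ray[OF e] edge[OF e] A(1) u_le[OF A e], of "1 / sqrt 3"]
        varA[of A] Dl unfolding var_def m_def D_def l_def by (simp add: power_divide)
    also have "\<dots> \<le> sum ?d (edges G)"
      using e fin by (intro member_le_sum) (auto intro: set_integral_nonneg_real)
    also have "\<dots> \<le> A^4 * (pi * sqrt 3 / 12) - 2 / sqrt 3 * calib A usup"
      using deficit_sum[OF A] mult_left_mono[OF var_total[OF A], of "2 / sqrt 3"] by simp
    also have "calib A usup = usup^4 / 4 * (d + (1 + d\<^sup>2) * (pi / 2 - arctan d))"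
    proof -
      have "sqrt (A^4 - usup^4) = usup\<^sup>2 * d"
        unfolding A4 using d by (intro real_sqrt_unique) (auto simp: algebra_simps power_mult_distrib)
      moreover have "usup\<^sup>2 / A\<^sup>2 = 1 / sqrt (1 + d\<^sup>2)" using usup_gt r by (simp add: A2 r_def)
      ultimately have "calib A usup = (usup\<^sup>2 * (usup\<^sup>2 * d) + usup^4 * (1 + d\<^sup>2) * (pi / 2 - arctan d)) / 4"
        using arcsin_inverse_sqrt[OF d] by (simp add: calib_def A4)
      moreover have "usup\<^sup>2 * (usup\<^sup>2 * d) = usup^4 * d" by (simp add: mult.assoc[symmetric] power_add[symmetric])
      moreover have "(x * d + x * y * t) / 4 = x / 4 * (d + y * t)" for x y t :: real by (simp add: field_simps)
      ultimately show ?thesis by (simp only:)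
    qed
    finally have "usup^4 * (d\<^sup>2 * m / 3) \<le> usup^4 * ((1 + d\<^sup>2) * (pi * sqrt 3 / 12)
        - 2 / sqrt 3 * (1/4) * (d + (1 + d\<^sup>2) * (pi / 2 - arctan d)))"
    proof -
      have "1/3 * (x * (1 + d\<^sup>2) * m - x * m) = x * (d\<^sup>2 * m / 3)"
        "x * (1 + d\<^sup>2) * c - k * (x / 4 * t) = x * ((1 + d\<^sup>2) * c - k * (1/4) * t)" for x c k t :: real
        by (simp_all add: algebra_simps)
      moreover assume "1/3 * (A^4 * m - usup^4 * m) \<le> A^4 * (pi * sqrt 3 / 12)
        - 2 / sqrt 3 * (usup^4 / 4 * (d + (1 + d\<^sup>2) * (pi / 2 - arctan d)))"
      ultimately show ?thesis unfolding A4 by (simp only:)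
    qed
    then have "d\<^sup>2 * m / 3 \<le> (1 + d\<^sup>2) * (pi * sqrt 3 / 12)
        - 2 / sqrt 3 * (1/4) * (d + (1 + d\<^sup>2) * (pi / 2 - arctan d))"
      using usup_gt by (subst (asm) mult_le_cancel_left_pos) auto
    also have "\<dots> = (1 + d\<^sup>2) * (pi * sqrt 3 / 12)
        - sqrt 3 / 6 * (d + (1 + d\<^sup>2) * (pi / 2 - arctan d))"
    proof -
      have "2 / sqrt 3 * (1/4) = sqrt 3 / 6" by (simp add: field_simps)
      then show ?thesis by (simp only:)
    qed
    also have "\<dots> = sqrt 3 / 6 * ((1 + d\<^sup>2) * arctan d - d)" by (simp add: algebra_simps)
    \<comment> \<open>The linear terms in \<open>d\<close> have cancelled; since arctan d is at most
      d, what remains is bounded by d^3.\<close>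
    also have "\<dots> \<le> sqrt 3 / 6 * ((1 + d\<^sup>2) * d - d)"
      using arctan_le_self[of d] d by (intro mult_left_mono diff_right_mono) auto
    also have "\<dots> = d\<^sup>2 * (sqrt 3 / 2 * d) / 3" by (simp add: algebra_simps power2_eq_square)
    finally show ?thesis using d by simp
  qed
  \<comment> \<open>For this \<open>d\<close> the right-hand side is \<open>m / 2\<close>.\<close>
  have "m \<le> sqrt 3 / 2 * (m / sqrt 3)" using small[of "m / sqrt 3"] m by simp
  then show False using m by simp
qed

section \<open>The shape of the graph forced by tight images\<close>

abbreviation "img \<equiv> wimg usup"

text \<open>By \<open>var_sum\<close> the variations add up exactly to the length they cover, so
  none can be replaced by a smaller bound on the diameter of its image: \<open>calib usup\<close> of
  \<open>u\<close> runs along each edge without turning back.\<close>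

lemma img_tight:
  assumes e: "e \<in> edges G" and v: "v \<ge> 0" "\<And>p q. p \<in> img e \<Longrightarrow> q \<in> img e \<Longrightarrow> \<bar>p - q\<bar> \<le> v"
  shows "var usup e \<le> v"
proof -
  have "calib usup usup \<le> sum ((var usup)(e := v)) (edges G)"
    by (rule interval_cover_length[OF fin wimg_interval[OF usup_gt order_refl] _ _
          wimg_cover_usup[OF usup_gt order_refl]])
       (use v wimg_var[OF usup_gt order_refl] var_nonneg[OF usup_gt order_refl] in \<open>auto split: if_splits\<close>)
  also have "\<dots> = sum (var usup) (edges G) - var usup e + v"
    using fin e by (simp add: sum.remove[of "edges G" e] cong: sum.cong_simp)
  finally show ?thesis using var_sum by simp
qed

text \<open>Two images sharing an interval would cover the length \<open>q - p\<close> twice, and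
  the exact total \<open>var_sum\<close> has no room for that.\<close>

lemma img_no_overlap:
  assumes "a \<in> edges G" "b \<in> edges G" "a \<noteq> b" "p < q" "{p<..<q} \<subseteq> img a" "{p<..<q} \<subseteq> img b"
  shows False
proof -
  have "0 \<le> calib usup usup" using calib_pos[of usup usup] usup_gt by simp
  then have "calib usup usup + (q - p) \<le> sum (var usup) (edges G)"
    by (intro interval_cover_overlap[where I = img and a = a and b = b] fin wimg_interval wimg_var
        var_nonneg wimg_cover_usup) (use assms usup_gt in auto)
  then show False using var_sum assms(4) by simp
qed

lemma img_between:
  assumes "e \<in> edges G" "p \<in> img e" "q \<in> img e" shows "{p<..<q} \<subseteq> img e"
  using wimg_interval[OF usup_gt order_refl assms(1)] assms(2,3)
  unfolding is_interval_1 by (meson greaterThanLessThan_iff less_imp_le subsetI)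

text \<open>An image of diameter 0 would give variation 0 by \<open>img_tight\<close>, against
  \<open>var_pos\<close>.\<close>

lemma img_not_const:
  assumes "e \<in> edges G" shows "\<exists>p\<in>img e. p \<noteq> c"
proof (rule ccontr)
  assume "\<not> ?thesis"
  then have c: "\<forall>p\<in>img e. p = c" by blast
  have "\<bar>p - q\<bar> \<le> 0" if "p \<in> img e" "q \<in> img e" for p q
    using bspec[OF c that(1)] bspec[OF c that(2)] by simp
  then have "var usup e \<le> 0" using assms by (intro img_tight) simp_all
  then show False using var_pos[OF assms] by simp
qed

text \<open>A loop runs over its image at least twice, so by \<open>edge_var_loop\<close> the
  diameter compared with the variation in \<open>img_tight\<close> is only half of it.\<close>

lemma no_loop:
  assumes e: "e \<in> bedges G" shows "src G e \<noteq> tgt G e"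
proof
  assume eq: "src G e = tgt G e"
  have b: "e \<in> edges G" "dm e = {0..len G e}" "u e 0 = u e (len G e)"
    using bedge[OF e] vval(1,2)[OF e] eq by auto
  have "var usup e \<le> var usup e / 2"
    using b var_nonneg[OF usup_gt order_refl b(1)]
      edge_var_loop[OF ray[OF b(1)] edge[OF b(1)] usup_gt usup_upper[OF b(1)] b(2,3)]
    by (intro img_tight) (auto simp: wimg_def var_def)
  then show False using var_pos[OF b(1)] by simp
qed

text \<open>Along a halfline \<open>u\<close> comes close to 0 but never vanishes, so the image
  contains some \<open>{0<..<r}\<close>; two halflines would share such an interval.\<close>

lemma hedges_unique:
  assumes "a \<in> hedges G" "b \<in> hedges G" shows "a = b"
proof (rule ccontr)
  assume ne: "a \<noteq> b"
  have pos: "0 < p" if "h \<in> edges G" "p \<in> img h" for h p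
    using that nonvanishing usup_upper by (auto simp: wimg_def intro!: calib_pos)
  have ab: "a \<in> edges G" "b \<in> edges G" using hedge assms by auto
  have img: "img a \<noteq> {}" "img b \<noteq> {}" using img_not_const ab by blast+
  obtain p q where pq: "p \<in> img a" "q \<in> img b" using img by blast
  have sub: "{0<..<r} \<subseteq> img h" if h: "h \<in> hedges G" "r \<in> img h" for h r
  proof
    fix x assume x: "x \<in> {0<..<r}"
    obtain s where s: "s \<in> img h" "s < x" using halfline_small[OF usup_gt order_refl h(1)] x by auto
    then show "x \<in> img h" using img_between[OF _ s(1) h(2)] hedge[OF h(1)] x by auto
  qed
  show False
    by (rule img_no_overlap[OF ab ne, of 0 "min p q"])
       (use sub[OF assms(1) pq(1)] sub[OF assms(2) pq(2)] pos[OF ab(1) pq(1)] pos[OF ab(2) pq(2)] in auto)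
qed

lemma incident_img:
  assumes "e \<in> edges G" "src G e = v \<or> (e \<in> bedges G \<and> tgt G e = v)"
  shows "calib usup (vval v) \<in> img e"
  using assms(2)
proof
  assume "src G e = v"
  then show ?thesis unfolding wimg_def using vval(4)[OF assms(1)] ray_domD(1)[OF ray[OF assms(1)]]
    by (intro image_eqI[of _ _ 0]) auto
next
  assume "e \<in> bedges G \<and> tgt G e = v"
  then show ?thesis unfolding wimg_def using vval(2)[of e] bedge[of e]
    by (intro image_eqI[of _ _ "len G e"]) auto
qed

text \<open>The images of the edges at \<open>v\<close> all contain the level \<open>c\<close> of
  the vertex and reach strictly above or below it. Among three edges two reach to the same side and
  overlap there.\<close>

lemma degree_le_2: "degree G v \<le> 2"
proof (rule ccontr)
  let ?X = "{e \<in> bedges G. src G e = v}" and ?Y = "{e \<in> bedges G. tgt G e = v}" and ?Z = "{h \<in> hedges G. src G h = v}"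
  assume "\<not> degree G v \<le> 2"
  have f: "finite (bedges G)" "finite (hedges G)" "bedges G \<inter> hedges G = {}"
    using mg by (auto simp: metric_graph_def)
  \<comment> \<open>\<open>no_loop\<close> keeps outgoing and incoming edges apart, so the degree
    counts distinct edges.\<close>
  have "card (?X \<union> ?Y \<union> ?Z) = degree G v" unfolding degree_def
    using f by (subst card_Un_disjoint, simp, simp, blast, subst card_Un_disjoint) (use no_loop in force)+
  then have "3 \<le> card (?X \<union> ?Y \<union> ?Z)" using \<open>\<not> degree G v \<le> 2\<close> by simp
  then obtain T where T: "T \<subseteq> ?X \<union> ?Y \<union> ?Z" "card T = 3" by (meson obtain_subset_with_card_n)
  then obtain a b d where abd: "T = {a, b, d}" "a \<noteq> b" "a \<noteq> d" "b \<noteq> d" by (auto simp: card_3_iff)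
  define c where "c = calib usup (vval v)"
  have inc: "e \<in> edges G" "c \<in> img e" if "e \<in> T" for e
    using that T(1) incident_img[of e v] by (auto simp: edges_def c_def)
  have up: False if "e \<in> T" "e' \<in> T" "e \<noteq> e'" "p \<in> img e" "q \<in> img e'" "c < p" "c < q" for e e' p q
  proof (rule img_no_overlap[OF inc(1)[OF that(1)] inc(1)[OF that(2)] that(3), of c "min p q"])
    show "{c<..<min p q} \<subseteq> img e" using img_between[OF inc[OF that(1)] that(4)] by auto
    show "{c<..<min p q} \<subseteq> img e'" using img_between[OF inc[OF that(2)] that(5)] by auto
  qed (use that in simp)
  have down: False if "e \<in> T" "e' \<in> T" "e \<noteq> e'" "p \<in> img e" "q \<in> img e'" "p < c" "q < c" for e e' p q
  proof (rule img_no_overlap[OF inc(1)[OF that(1)] inc(1)[OF that(2)] that(3), of "max p q" c])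
    show "{max p q<..<c} \<subseteq> img e" using img_between[OF inc(1)[OF that(1)] that(4) inc(2)[OF that(1)]] by auto
    show "{max p q<..<c} \<subseteq> img e'" using img_between[OF inc(1)[OF that(2)] that(5) inc(2)[OF that(2)]] by auto
  qed (use that in simp)
  obtain p q r where pqr: "p \<in> img a" "p \<noteq> c" "q \<in> img b" "q \<noteq> c" "r \<in> img d" "r \<noteq> c"
    using img_not_const[of a c] img_not_const[of b c] img_not_const[of d c] inc(1) abd(1) by blast
  then show False
    using up[of a b p q] up[of a d p r] up[of b d q r] down[of a b p q] down[of a d p r] down[of b d q r] abd
    by (auto simp: neq_iff)
qed

lemma halfline: "is_halfline G"
proof -
  obtain h where h: "h \<in> hedges G" using nc by (auto simp: noncompact_def)
  then have "hedges G = {h}" using hedges_unique by blast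
  then show ?thesis using degree_le_2 by (simp add: is_halfline_def)
qed

end

section \<open>Constructing functions on a graph\<close>

lemma set_integral_affine:
  fixes g :: "real \<Rightarrow> real"
  assumes c: "c \<noteq> 0" and S: "\<And>x. x \<in> S \<longleftrightarrow> t + c * x \<in> S'"
  shows "(LINT x:S'|lborel. g x) = \<bar>c\<bar> * (LINT x:S|lborel. g (t + c * x))"
    and "set_integrable lborel S' g \<longleftrightarrow> set_integrable lborel S (\<lambda>x. g (t + c * x))"
proof -
  have eq: "indicator S' (t + c * x) *\<^sub>R g (t + c * x) = indicator S x *\<^sub>R g (t + c * x)" for x
    using S[of x] by (auto simp: indicator_def)
  show "(LINT x:S'|lborel. g x) = \<bar>c\<bar> * (LINT x:S|lborel. g (t + c * x))"
    unfolding set_lebesgue_integral_def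
    using lborel_integral_real_affine[OF c, of "\<lambda>x. indicator S' x *\<^sub>R g x" t] unfolding eq by simp
  show "set_integrable lborel S' g \<longleftrightarrow> set_integrable lborel S (\<lambda>x. g (t + c * x))"
    unfolding set_integrable_def
    using lborel_integrable_real_affine_iff[OF c, of "\<lambda>x. indicator S' x *\<^sub>R g x" t] by (simp only: eq)
qed

lemma set_integral_support:
  fixes g h :: "real \<Rightarrow> real"
  assumes "\<And>x. x \<in> B \<Longrightarrow> x \<in> A \<and> g x = h x" "\<And>x. x \<in> A \<Longrightarrow> x \<notin> B \<Longrightarrow> g x = 0"
  shows "(LINT x:A|lborel. g x) = (LINT x:B|lborel. h x)"
    and "set_integrable lborel A g \<longleftrightarrow> set_integrable lborel B h"
proof -
  have "indicator A x *\<^sub>R g x = indicator B x *\<^sub>R h x" for x using assms[of x] by (auto simp: indicator_def)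
  then show "(LINT x:A|lborel. g x) = (LINT x:B|lborel. h x)"
    "set_integrable lborel A g \<longleftrightarrow> set_integrable lborel B h"
    by (simp_all add: set_lebesgue_integral_def set_integrable_def)
qed

lemma FTC_Icc:
  assumes "a \<le> b" "\<And>x. a \<le> x \<Longrightarrow> x \<le> b \<Longrightarrow> (F has_real_derivative f x) (at x)" "continuous_on {a..b} f"
  shows "(LINT x:{a..b}|lborel. f x) = F b - F a" "set_integrable lborel {a..b} f"
  using integral_FTC_atLeastAtMost[OF assms(1) _ assms(3), of F] assms(2) borel_integrable_atLeastAtMost'[OF assms(3)]
  by (auto simp: set_lebesgue_integral_def has_real_derivative_iff_has_vector_derivative
      intro: has_vector_derivative_at_within)

lemma edge_H1_C1:
  assumes "0 \<le> l" "\<And>x. 0 \<le> x \<Longrightarrow> x \<le> l \<Longrightarrow> (f has_real_derivative f' x) (at x)" "continuous_on {0..l} f'"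
  shows "edge_H1 {0..l} f f'"
  unfolding edge_H1_def
proof (intro conjI ballI)
  fix x assume x: "x \<in> {0..l}"
  have c: "continuous_on {0..x} f'" using x by (intro continuous_on_subset[OF assms(3)]) auto
  show "set_integrable lborel {0..x} f'" by (rule borel_integrable_atLeastAtMost'[OF c])
  have "(LINT t:{0..x}|lborel. f' t) = f x - f 0" using x assms(2) by (intro FTC_Icc(1)[OF _ _ c]) auto
  then show "f x = f 0 + (LINT t:{0..x}|lborel. f' t)" by simp
next
  have "continuous_on {0..l} f" using assms(2) by (intro DERIV_continuous_on) (auto intro: DERIV_subset)
  then show "set_integrable lborel {0..l} (\<lambda>x. (f x)\<^sup>2)"
    by (intro borel_integrable_atLeastAtMost' continuous_intros)
  show "set_integrable lborel {0..l} (\<lambda>x. (f' x)\<^sup>2)"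
    by (intro borel_integrable_atLeastAtMost' continuous_intros assms(3))
qed

lemma edge_H1_extend_zero:
  assumes "0 \<le> l" "edge_H1 {0..l} f f'" "f l = 0"
  shows "edge_H1 {0..} (\<lambda>x. if x \<le> l then f x else 0) (\<lambda>x. if x \<le> l then f' x else 0)"
  unfolding edge_H1_def
proof (intro conjI ballI)
  fix x :: real assume x: "x \<in> {0..}"
  let ?m = "min x l"
  have m: "?m \<in> {0..l}" using x assms by auto
  have sup: "(LINT t:{0..x}|lborel. if t \<le> l then f' t else 0) = (LINT t:{0..?m}|lborel. f' t)"
    "set_integrable lborel {0..x} (\<lambda>t. if t \<le> l then f' t else 0) \<longleftrightarrow> set_integrable lborel {0..?m} f'"
    by (rule set_integral_support; auto)+
  show "set_integrable lborel {0..x} (\<lambda>t. if t \<le> l then f' t else 0)"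
    using sup(2) assms(2) m unfolding edge_H1_def by blast
  have "f ?m = f 0 + (LINT t:{0..?m}|lborel. f' t)" using assms(2) m unfolding edge_H1_def by blast
  then show "(if x \<le> l then f x else 0) = (if 0 \<le> l then f 0 else 0) + (LINT t:{0..x}|lborel. if t \<le> l then f' t else 0)"
    unfolding sup(1) using assms(1,3) by (cases "x \<le> l") (simp_all add: min_def)
next
  have *: "set_integrable lborel {0..} (\<lambda>x. (if x \<le> l then g x else 0)\<^sup>2) \<longleftrightarrow> set_integrable lborel {0..l} (\<lambda>x. (g x)\<^sup>2)"
    for g :: "real \<Rightarrow> real" by (rule set_integral_support(2)) simp_all
  show "set_integrable lborel {0..} (\<lambda>x. (if x \<le> l then f x else 0)\<^sup>2)"
    "set_integrable lborel {0..} (\<lambda>x. (if x \<le> l then f' x else 0)\<^sup>2)"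
    using assms(2) unfolding edge_H1_def * by blast+
qed

lemma edge_H1_restrict:
  assumes "edge_H1 {0..} f f'" shows "edge_H1 {0..l} f f'"
  unfolding edge_H1_def
proof (intro conjI)
  have "set_integrable lborel {0..} (\<lambda>x. (f x)\<^sup>2)" "set_integrable lborel {0..} (\<lambda>x. (f' x)\<^sup>2)"
    using assms unfolding edge_H1_def by blast+
  then show "set_integrable lborel {0..l} (\<lambda>x. (f x)\<^sup>2)" "set_integrable lborel {0..l} (\<lambda>x. (f' x)\<^sup>2)"
    by (auto elim!: set_integrable_subset)
  have "{0..l} \<subseteq> {0..}" by auto
  then show "\<forall>x\<in>{0..l}. set_integrable lborel {0..x} f' \<and> f x = f 0 + (LINT t:{0..x}|lborel. f' t)"
    using assms unfolding edge_H1_def by blast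
qed

text \<open>Profiles start at 0, while a terminal point may sit at the other end \<open>len\<close>
  of its edge.\<close>

lemma edge_H1_reflect:
  assumes "edge_H1 {0..l} f f'"
  shows "edge_H1 {0..l} (\<lambda>x. f (l - x)) (\<lambda>x. - f' (l - x))"
  unfolding edge_H1_def
proof (intro conjI ballI)
  have D: "ray_dom {0..l}" if "l \<ge> 0" using that by (auto simp: ray_dom_def)
  fix x assume x: "x \<in> {0..l}"
  then have l: "l - x \<in> {0..l}" "l \<in> {0..l}" "l - x \<le> l" "l \<ge> 0" by auto
  note d = edge_H1_diff[OF D[OF l(4)] assms l(1,2,3)]
  have a: "(LINT t:{l-x..l}|lborel. f' t) = (LINT t:{0..x}|lborel. f' (l - t))"
    "set_integrable lborel {l-x..l} f' \<longleftrightarrow> set_integrable lborel {0..x} (\<lambda>t. f' (l - t))"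
    using set_integral_affine[of "-1" "{0..x}" l "{l-x..l}" f'] by auto
  show "set_integrable lborel {0..x} (\<lambda>x. - f' (l - x))" using d(1) a(2) set_integrable_mult_right[of "-1"] by fastforce
  have "(LINT t:{0..x}|lborel. - f' (l - t)) = - (LINT t:{0..x}|lborel. f' (l - t))"
    using d(1) a(2) by (intro set_integral_uminus) auto
  then show "f (l - x) = f (l - 0) + (LINT t:{0..x}|lborel. - f' (l - t))" using d(2) a(1) by simp
next
  have "set_integrable lborel {0..l} g \<longleftrightarrow> set_integrable lborel {0..l} (\<lambda>t. g (l - t))" for g :: "real \<Rightarrow> real"
    using set_integral_affine(2)[of "-1" "{0..l}" l "{0..l}" g] by auto
  from this[of "\<lambda>x. (f x)\<^sup>2"] this[of "\<lambda>x. (f' x)\<^sup>2"]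
  show "set_integrable lborel {0..l} (\<lambda>x. (f (l - x))\<^sup>2)" "set_integrable lborel {0..l} (\<lambda>x. (- f' (l - x))\<^sup>2)"
    using assms by (auto simp: edge_H1_def)
qed

lemma set_integral_reflect_Icc:
  fixes g :: "real \<Rightarrow> real"
  shows "(LINT x:{0..l}|lborel. g (l - x)) = (LINT x:{0..l}|lborel. g x)"
proof -
  have "x \<in> {0..l} \<longleftrightarrow> l + - 1 * x \<in> {0..l}" for x by auto
  from set_integral_affine(1)[OF _ this, of g] show ?thesis by simp
qed

lemma set_integral_scale_Ici:
  fixes g :: "real \<Rightarrow> real"
  assumes "k > 0"
  shows "(LINT x:{0..}|lborel. g (k * x)) = (LINT x:{0..}|lborel. g x) / k"
    "set_integrable lborel {0..} (\<lambda>x. g (k * x)) \<longleftrightarrow> set_integrable lborel {0..} g"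
  using set_integral_affine[of k "{0..}" 0 "{0..}" g] assms by (auto simp: zero_le_mult_iff)

lemma edge_H1_scale:
  assumes H: "edge_H1 {0..} f f'" and k: "k > 0"
  shows "edge_H1 {0..} (\<lambda>x. s * f (k * x)) (\<lambda>x. s * k * f' (k * x))"
  unfolding edge_H1_def
proof (intro conjI ballI)
  fix x :: real assume x: "x \<in> {0..}"
  have a: "(LINT t:{0..k*x}|lborel. f' t) = k * (LINT t:{0..x}|lborel. f' (k * t))"
    "set_integrable lborel {0..k*x} f' \<longleftrightarrow> set_integrable lborel {0..x} (\<lambda>t. f' (k * t))"
    using set_integral_affine[of k "{0..x}" 0 "{0..k*x}" f'] k by (auto simp: zero_le_mult_iff)
  have kx: "k * x \<in> {0..}" using x k by simp
  show "set_integrable lborel {0..x} (\<lambda>t. s * k * f' (k * t))"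
    using a(2) H kx unfolding edge_H1_def by (metis set_integrable_mult_right)
  have "f (k * x) = f 0 + (LINT t:{0..k*x}|lborel. f' t)" using H kx unfolding edge_H1_def by blast
  then show "s * f (k * x) = s * f (k * 0) + (LINT t:{0..x}|lborel. s * k * f' (k * t))"
    using a(1) by (simp add: algebra_simps)
next
  show "set_integrable lborel {0..} (\<lambda>x. (s * f (k * x))\<^sup>2)" "set_integrable lborel {0..} (\<lambda>x. (s * k * f' (k * x))\<^sup>2)"
    using set_integral_scale_Ici(2)[OF k, of "\<lambda>x. (f x)\<^sup>2"] set_integral_scale_Ici(2)[OF k, of "\<lambda>x. (f' x)\<^sup>2"] H
    by (auto simp: edge_H1_def power_mult_distrib)
qed

text \<open>The factor \<open>s\<close> and the dilation \<open>k\<close> are separate so that the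
  mass can be prescribed: for s^2 proportional to \<open>k\<close> it is constant in
  \<open>k\<close>, and the other two integrals grow like k^2, which is the criticality of the
  exponent 6.\<close>

lemma scaled_integrals:
  fixes f f' :: "real \<Rightarrow> real"
  assumes "k > 0"
  shows "(LINT x:{0..}|lborel. (s * f (k * x))\<^sup>2) = s\<^sup>2 / k * (LINT x:{0..}|lborel. (f x)\<^sup>2)"
    "(LINT x:{0..}|lborel. (s * k * f' (k * x))\<^sup>2) = s\<^sup>2 * k * (LINT x:{0..}|lborel. (f' x)\<^sup>2)"
    "(LINT x:{0..}|lborel. (s * f (k * x))^6) = s^6 / k * (LINT x:{0..}|lborel. (f x)^6)"
proof -
  note * = set_integral_scale_Ici(1)[OF assms]
  show "(LINT x:{0..}|lborel. (s * f (k * x))\<^sup>2) = s\<^sup>2 / k * (LINT x:{0..}|lborel. (f x)\<^sup>2)"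
    unfolding power_mult_distrib using *[of "\<lambda>x. (f x)\<^sup>2"] by simp
  show "(LINT x:{0..}|lborel. (s * k * f' (k * x))\<^sup>2) = s\<^sup>2 * k * (LINT x:{0..}|lborel. (f' x)\<^sup>2)"
    unfolding power_mult_distrib using *[of "\<lambda>x. (f' x)\<^sup>2"] by (simp add: power2_eq_square)
  show "(LINT x:{0..}|lborel. (s * f (k * x))^6) = s^6 / k * (LINT x:{0..}|lborel. (f x)^6)"
    unfolding power_mult_distrib using *[of "\<lambda>x. (f x)^6"] by simp
qed

section \<open>Vertices of degree one and functions supported on one edge\<close>

lemma degree_one_src:
  assumes "metric_graph G" "degree G v = 1" "e \<in> bedges G" "src G e = v"
  shows "{e \<in> bedges G. src G e = v} = {e}" "{e \<in> bedges G. tgt G e = v} = {}" "{h \<in> hedges G. src G h = v} = {}"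
proof -
  have f: "finite {e \<in> bedges G. src G e = v}" "finite {e \<in> bedges G. tgt G e = v}" "finite {h \<in> hedges G. src G h = v}"
    using assms by (auto simp: metric_graph_def)
  have "card {e \<in> bedges G. src G e = v} \<noteq> 0" using f(1) assms by (subst card_0_eq) auto
  then have c: "card {e \<in> bedges G. src G e = v} = 1" "card {e \<in> bedges G. tgt G e = v} = 0"
    "card {h \<in> hedges G. src G h = v} = 0" using assms(2) unfolding degree_def by linarith+
  show "{e \<in> bedges G. tgt G e = v} = {}" "{h \<in> hedges G. src G h = v} = {}"
    using c f card_0_eq by metis+
  obtain x where "{e \<in> bedges G. src G e = v} = {x}" using c(1) by (rule card_1_singletonE)
  moreover have "e \<in> {e \<in> bedges G. src G e = v}" using assms(3,4) by simp
  ultimately show "{e \<in> bedges G. src G e = v} = {e}" by simp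
qed

lemma degree_one_tgt:
  assumes "metric_graph G" "degree G v = 1" "e \<in> bedges G" "tgt G e = v"
  shows "{e \<in> bedges G. tgt G e = v} = {e}" "{e \<in> bedges G. src G e = v} = {}" "{h \<in> hedges G. src G h = v} = {}"
proof -
  have f: "finite {e \<in> bedges G. src G e = v}" "finite {e \<in> bedges G. tgt G e = v}" "finite {h \<in> hedges G. src G h = v}"
    using assms by (auto simp: metric_graph_def)
  have "card {e \<in> bedges G. tgt G e = v} \<noteq> 0" using f(2) assms by (subst card_0_eq) auto
  then have c: "card {e \<in> bedges G. tgt G e = v} = 1" "card {e \<in> bedges G. src G e = v} = 0"
    "card {h \<in> hedges G. src G h = v} = 0" using assms(2) unfolding degree_def by linarith+
  show "{e \<in> bedges G. src G e = v} = {}" "{h \<in> hedges G. src G h = v} = {}"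
    using c f card_0_eq by metis+
  obtain x where "{e \<in> bedges G. tgt G e = v} = {x}" using c(1) by (rule card_1_singletonE)
  moreover have "e \<in> {e \<in> bedges G. tgt G e = v}" using assms(3,4) by simp
  ultimately show "{e \<in> bedges G. tgt G e = v} = {e}" by simp
qed

lemma degree_one_halfline:
  assumes "metric_graph G" "degree G v = 1" "e \<in> hedges G" "src G e = v"
  shows "{h \<in> hedges G. src G h = v} = {e}" "{e \<in> bedges G. src G e = v} = {}" "{e \<in> bedges G. tgt G e = v} = {}"
proof -
  have f: "finite {e \<in> bedges G. src G e = v}" "finite {e \<in> bedges G. tgt G e = v}" "finite {h \<in> hedges G. src G h = v}"
    using assms by (auto simp: metric_graph_def)
  have "card {h \<in> hedges G. src G h = v} \<noteq> 0" using f(3) assms by (subst card_0_eq) auto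
  then have c: "card {h \<in> hedges G. src G h = v} = 1" "card {e \<in> bedges G. src G e = v} = 0"
    "card {e \<in> bedges G. tgt G e = v} = 0" using assms(2) unfolding degree_def by linarith+
  show "{e \<in> bedges G. src G e = v} = {}" "{e \<in> bedges G. tgt G e = v} = {}"
    using c f card_0_eq by metis+
  obtain x where "{h \<in> hedges G. src G h = v} = {x}" using c(1) by (rule card_1_singletonE)
  moreover have "e \<in> {h \<in> hedges G. src G h = v}" using assms(3,4) by simp
  ultimately show "{h \<in> hedges G. src G h = v} = {e}" by simp
qed

lemma degree_one_cases:
  assumes "degree G v = 1"
  obtains e where "e \<in> hedges G" "src G e = v" | e where "e \<in> bedges G" "src G e = v"
    | e where "e \<in> bedges G" "tgt G e = v"
proof -
  have "{e \<in> bedges G. src G e = v} \<noteq> {} \<or> {e \<in> bedges G. tgt G e = v} \<noteq> {} \<or> {h \<in> hedges G. src G h = v} \<noteq> {}"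
    using assms unfolding degree_def by (metis add.right_neutral card.empty zero_neq_one)
  then show ?thesis using that by blast
qed

definition on_edge :: "'e \<Rightarrow> (real \<Rightarrow> real) \<Rightarrow> 'e \<Rightarrow> real \<Rightarrow> real" where
  "on_edge e f = (\<lambda>_ _. 0)(e := f)"

lemma on_edge_simps [simp]: "on_edge e f e = f" "e' \<noteq> e \<Longrightarrow> on_edge e f e' = (\<lambda>_. 0)"
  by (auto simp: on_edge_def)

lemma on_edge_sums:
  assumes "metric_graph G" "e \<in> edges G"
  shows "mass G (on_edge e f) = (LINT x:edge_dom G e|lborel. (f x)\<^sup>2)"
    "L6 G (on_edge e f) = (LINT x:edge_dom G e|lborel. (f x)^6)"
proof -
  have fin: "finite (edges G)" using assms by (simp add: metric_graph_def edges_def)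
  have "(\<Sum>e'\<in>edges G. LINT x:edge_dom G e'|lborel. (on_edge e f e' x)^n) = (LINT x:edge_dom G e|lborel. (f x)^n)"
    if "n > 0" for n
    unfolding sum.remove[OF fin assms(2)] using that by (simp add: zero_power)
  then show "mass G (on_edge e f) = (LINT x:edge_dom G e|lborel. (f x)\<^sup>2)"
    "L6 G (on_edge e f) = (LINT x:edge_dom G e|lborel. (f x)^6)" by (auto simp: mass_def L6_def)
qed

text \<open>Extension by zero is continuous at a vertex where \<open>f\<close> vanishes and at a
  vertex met by no other edge end. The condition on the target makes at most one end value
  nonzero.\<close>

lemma on_edge_H1:
  assumes mg: "metric_graph G" and e: "e \<in> edges G" and H: "edge_H1 (edge_dom G e) f f'"
    and v: "f 0 = 0 \<or> degree G (src G e) = 1"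
      "e \<in> bedges G \<Longrightarrow> f (len G e) = 0 \<or> degree G (tgt G e) = 1 \<and> f 0 = 0"
  shows "H1_pair G (on_edge e f) (on_edge e f')"
proof -
  have "edge_H1 (edge_dom G e') (on_edge e f e') (on_edge e f' e')" if "e' \<in> edges G" for e'
  proof (cases "e' = e")
    case False
    then show ?thesis by (simp add: edge_H1_def set_integrable_def)
  qed (use H in simp)
  moreover have "\<exists>c. (\<forall>e'\<in>bedges G. (src G e' = w \<longrightarrow> on_edge e f e' 0 = c) \<and>
        (tgt G e' = w \<longrightarrow> on_edge e f e' (len G e') = c)) \<and>
        (\<forall>h\<in>hedges G. src G h = w \<longrightarrow> on_edge e f h 0 = c)" (is "\<exists>c. ?P w c") if "w \<in> verts G" for w
  proof -
    have dj: "bedges G \<inter> hedges G = {}" using mg by (simp add: metric_graph_def)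
    consider "f 0 = 0" "e \<in> bedges G \<longrightarrow> f (len G e) = 0"
      | "degree G (src G e) = 1" "e \<in> bedges G" "f (len G e) = 0"
      | "degree G (src G e) = 1" "e \<in> hedges G"
      | "e \<in> bedges G" "degree G (tgt G e) = 1" "f 0 = 0"
      using v e by (auto simp: edges_def)
    then show ?thesis
    proof cases
      case 1
      then have "?P w 0" by (auto simp: on_edge_def)
      then show ?thesis ..
    next
      case 2
      note d = degree_one_src[OF mg 2(1,2) refl]
      have "?P w (if w = src G e then f 0 else 0)" using d 2 dj by (auto simp: on_edge_def)
      then show ?thesis ..
    next
      case 3
      note d = degree_one_halfline[OF mg 3 refl]
      have "?P w (if w = src G e then f 0 else 0)" using d 3 dj by (auto simp: on_edge_def)
      then show ?thesis ..
    next
      case 4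
      note d = degree_one_tgt[OF mg 4(2,1) refl]
      have "?P w (if w = tgt G e then f (len G e) else 0)" using d 4 dj by (auto simp: on_edge_def)
      then show ?thesis ..
    qed
  qed
  ultimately show ?thesis unfolding H1_pair_def edge_H1_def by blast
qed

text \<open>A function on the halfline with support near 0 fits on the edge at a terminal point,
  with 0 placed at that point, where no other edge prescribes a value.\<close>

lemma terminal_transplant:
  assumes mg: "metric_graph G" and t: "terminal_point G v"
  shows "\<exists>L>0. \<forall>f f'. edge_H1 {0..} f f' \<longrightarrow> (\<forall>x\<ge>L. f x = 0 \<and> f' x = 0) \<longrightarrow>
    (\<exists>u u'. H1_pair G u u' \<and> mass G u = (LINT x:{0..}|lborel. (f x)\<^sup>2) \<and>
      mass G u' = (LINT x:{0..}|lborel. (f' x)\<^sup>2) \<and> L6 G u = (LINT x:{0..}|lborel. (f x)^6))"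
proof -
  have deg: "degree G v = 1" using t by (simp add: terminal_point_def)
  have sup: "(LINT x:{0..}|lborel. (f x)^n) = (LINT x:{0..L}|lborel. (f x)^n)"
    if "\<forall>x\<ge>L. f x = 0" "n > 0" for L n and f :: "real \<Rightarrow> real"
    using that by (intro set_integral_support(1)) auto
  show ?thesis using deg
  proof (cases rule: degree_one_cases)
    case (1 e)
    then have e: "e \<in> edges G" "e \<notin> bedges G" "edge_dom G e = {0..}"
      using mg by (auto simp: edges_def metric_graph_def edge_dom_def)
    show ?thesis
    \<comment> \<open>The edge is a full halfline here, so every positive number can serve as the
      length.\<close>
    proof (rule exI[of _ 1], intro conjI allI impI)
      fix f f' assume H: "edge_H1 {0..} f f'"
      have "H1_pair G (on_edge e f) (on_edge e f')"
        by (rule on_edge_H1[OF mg e(1)]) (use H e 1 deg in simp_all)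
      then show "\<exists>u u'. H1_pair G u u' \<and> mass G u = (LINT x:{0..}|lborel. (f x)\<^sup>2) \<and>
        mass G u' = (LINT x:{0..}|lborel. (f' x)\<^sup>2) \<and> L6 G u = (LINT x:{0..}|lborel. (f x)^6)"
        using on_edge_sums[OF mg e(1)] unfolding e(3) by blast
    qed simp
  next
    case (2 e)
    then have e: "e \<in> edges G" "edge_dom G e = {0..len G e}" "len G e > 0"
      using mg by (auto simp: edges_def metric_graph_def edge_dom_def)
    show ?thesis
    proof (rule exI[of _ "len G e"], intro conjI allI impI)
      fix f f' assume H: "edge_H1 {0..} f f'" and z: "\<forall>x\<ge>len G e. f x = 0 \<and> f' x = 0"
      have "H1_pair G (on_edge e f) (on_edge e f')"
        by (rule on_edge_H1[OF mg e(1)]) (use edge_H1_restrict[OF H] e 2 deg z in simp_all)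
      moreover have "(LINT x:{0..}|lborel. (f x)^n) = (LINT x:{0..len G e}|lborel. (f x)^n)"
        "(LINT x:{0..}|lborel. (f' x)^n) = (LINT x:{0..len G e}|lborel. (f' x)^n)" if "n > 0" for n
        using z that by (intro sup; simp)+
      ultimately show "\<exists>u u'. H1_pair G u u' \<and> mass G u = (LINT x:{0..}|lborel. (f x)\<^sup>2) \<and>
        mass G u' = (LINT x:{0..}|lborel. (f' x)\<^sup>2) \<and> L6 G u = (LINT x:{0..}|lborel. (f x)^6)"
        using on_edge_sums[OF mg e(1)] unfolding e(2) by (metis zero_less_numeral)
    qed (use e in simp)
  next
    case (3 e)
    then have e: "e \<in> edges G" "edge_dom G e = {0..len G e}" "len G e > 0"
      using mg by (auto simp: edges_def metric_graph_def edge_dom_def)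
    let ?r = "\<lambda>f x. f (len G e - x)"
    show ?thesis
    proof (rule exI[of _ "len G e"], intro conjI allI impI)
      fix f f' :: "real \<Rightarrow> real" assume H: "edge_H1 {0..} f f'" and z: "\<forall>x\<ge>len G e. f x = 0 \<and> f' x = 0"
      have refl: "(LINT x:{0..len G e}|lborel. (?r g x)^n) = (LINT x:{0..len G e}|lborel. (g x)^n)"
        for n and g :: "real \<Rightarrow> real" by (rule set_integral_reflect_Icc[where g = "\<lambda>x. (g x)^n"])
      have H1: "H1_pair G (on_edge e (?r f)) (on_edge e (\<lambda>x. - ?r f' x))"
        by (rule on_edge_H1[OF mg e(1)])
           (use edge_H1_reflect[OF edge_H1_restrict[OF H], of "len G e"] e 3 deg z in simp_all)
      have "mass G (on_edge e (?r f)) = (LINT x:{0..}|lborel. (f x)\<^sup>2)"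
        unfolding on_edge_sums[OF mg e(1)] e(2) refl using z by (intro sup[symmetric]) auto
      moreover have "mass G (on_edge e (\<lambda>x. - ?r f' x)) = (LINT x:{0..}|lborel. (f' x)\<^sup>2)"
        unfolding on_edge_sums[OF mg e(1)] e(2) power2_minus refl using z by (intro sup[symmetric]) auto
      moreover have "L6 G (on_edge e (?r f)) = (LINT x:{0..}|lborel. (f x)^6)"
        unfolding on_edge_sums[OF mg e(1)] e(2) refl using z by (intro sup[symmetric]) auto
      ultimately show "\<exists>u u'. H1_pair G u u' \<and> mass G u = (LINT x:{0..}|lborel. (f x)\<^sup>2) \<and>
        mass G u' = (LINT x:{0..}|lborel. (f' x)\<^sup>2) \<and> L6 G u = (LINT x:{0..}|lborel. (f x)^6)"
        using H1 by blast
    qed (use e in simp)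
  qed
qed

section \<open>Near-optimal functions from the soliton\<close>

text \<open>The profile with maximum 1 at 0 that satisfies |f'| = weight / 2, the equality case of
  the calibration with \<open>A = 1\<close> and \<open>k = 1/2\<close>; its mass over
  \<open>{0..}\<close> is \<open>pi / 2\<close>.\<close>

definition soliton :: "real \<Rightarrow> real" where "soliton x = 1 / sqrt (cosh x)"
definition soliton' :: "real \<Rightarrow> real" where "soliton' x = - sinh x / (2 * cosh x * sqrt (cosh x))"
text \<open>The Gudermannian function; by \<open>soliton_powers\<close> it and the primitive of 1 /
  cosh^3 give the mass, gradient and sixth-power integrals of the soliton.\<close>

definition prim_sech :: "real \<Rightarrow> real" where "prim_sech x = arctan (sinh x)"
definition prim_sech3 :: "real \<Rightarrow> real" where "prim_sech3 x = (sinh x / (cosh x)\<^sup>2 + arctan (sinh x)) / 2"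

lemma soliton_deriv: "(soliton has_real_derivative soliton' x) (at x)"
  unfolding soliton_def[abs_def] soliton'_def
  using cosh_real_pos[of x] by (auto intro!: derivative_eq_intros simp: field_simps simp del: cosh_real_pos)

lemma soliton'_continuous: "continuous_on S soliton'"
  unfolding soliton'_def[abs_def] by (intro continuous_intros) auto

lemma soliton_continuous: "continuous_on S soliton"
  unfolding soliton_def[abs_def] by (intro continuous_intros) auto

lemma soliton_powers:
  "(soliton x)\<^sup>2 = 1 / cosh x" "(soliton x)^6 = 1 / (cosh x)^3"
  "(soliton' x)\<^sup>2 = (1 / cosh x - 1 / (cosh x)^3) / 4"
proof -
  have s: "(sqrt (cosh x))\<^sup>2 = cosh x" by (simp add: less_imp_le)
  show "(soliton x)\<^sup>2 = 1 / cosh x" using s by (simp add: soliton_def power_divide)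
  have "(sqrt (cosh x))^6 = ((sqrt (cosh x))\<^sup>2)^3" unfolding power_mult[symmetric] by simp
  then show "(soliton x)^6 = 1 / (cosh x)^3" unfolding s by (simp add: soliton_def power_divide)
  have "(soliton' x)\<^sup>2 = (sinh x)\<^sup>2 / (4 * (cosh x)\<^sup>2 * cosh x)"
    using s by (simp add: soliton'_def power_divide power_mult_distrib)
  also have "\<dots> = (1 / cosh x - 1 / (cosh x)^3) / 4"
    unfolding sinh_square_eq by (simp add: field_simps eval_nat_numeral)
  finally show "(soliton' x)\<^sup>2 = (1 / cosh x - 1 / (cosh x)^3) / 4" .
qed

lemma soliton_bounds: "0 < soliton x" "soliton x \<le> 1"
  using cosh_real_ge_1[of x] by (auto simp: soliton_def)

lemma soliton_antimono: "0 \<le> x \<Longrightarrow> x \<le> y \<Longrightarrow> soliton y \<le> soliton x"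
  using cosh_real_nonneg_le_iff[of x y] cosh_real_pos[of x] by (simp add: soliton_def frac_le)

lemma prim_sech_deriv: "(prim_sech has_real_derivative 1 / cosh x) (at x)"
proof -
  have "(prim_sech has_real_derivative cosh x / (1 + (sinh x)\<^sup>2)) (at x)"
    unfolding prim_sech_def[abs_def] by (auto intro!: derivative_eq_intros simp: field_simps)
  also have "cosh x / (1 + (sinh x)\<^sup>2) = 1 / cosh x"
    unfolding sinh_square_eq by (simp add: power2_eq_square)
  finally show ?thesis .
qed

lemma prim_sech3_deriv: "(prim_sech3 has_real_derivative 1 / (cosh x)^3) (at x)"
proof -
  have a: "((\<lambda>x. arctan (sinh x)) has_real_derivative 1 / cosh x) (at x)"
    using prim_sech_deriv by (simp add: prim_sech_def[abs_def])
  have b: "((\<lambda>x. sinh x / (cosh x)\<^sup>2) has_real_derivative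
      (cosh x * (cosh x)\<^sup>2 - sinh x * (2 * cosh x * sinh x)) / ((cosh x)\<^sup>2 * (cosh x)\<^sup>2)) (at x)"
    by (auto intro!: derivative_eq_intros)
  have "(prim_sech3 has_real_derivative
      ((cosh x * (cosh x)\<^sup>2 - sinh x * (2 * cosh x * sinh x)) / ((cosh x)\<^sup>2 * (cosh x)\<^sup>2) + 1 / cosh x) / 2) (at x)"
    unfolding prim_sech3_def[abs_def] by (rule DERIV_cdivide[OF DERIV_add[OF b a]])
  also have "((cosh x * (cosh x)\<^sup>2 - sinh x * (2 * cosh x * sinh x)) / ((cosh x)\<^sup>2 * (cosh x)\<^sup>2) + 1 / cosh x) / 2
    = 1 / (cosh x)^3"
  proof -
    have "cosh x * (cosh x)\<^sup>2 - sinh x * (2 * cosh x * sinh x) = cosh x * ((cosh x)\<^sup>2 - 2 * (sinh x)\<^sup>2)"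
      by (simp add: algebra_simps power2_eq_square)
    also have "\<dots> = cosh x * (2 - (cosh x)\<^sup>2)" unfolding sinh_square_eq by simp
    finally have "cosh x * (cosh x)\<^sup>2 - sinh x * (2 * cosh x * sinh x) = cosh x * (2 - (cosh x)\<^sup>2)" .
    moreover have "(y * (2 - y\<^sup>2) / (y\<^sup>2 * y\<^sup>2) + 1 / y) / 2 = 1 / y^3" if "y > 0" for y :: real
      using that by (simp add: field_simps eval_nat_numeral)
    ultimately show ?thesis using cosh_real_pos[of x] by simp
  qed
  finally show ?thesis .
qed

lemma prim_limits: "(prim_sech \<longlongrightarrow> pi / 2) at_top" "(prim_sech3 \<longlongrightarrow> pi / 4) at_top"
  unfolding prim_sech_def[abs_def] prim_sech3_def[abs_def] sinh_field_def cosh_field_def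
  by real_asymp+

lemma prim_zero: "prim_sech 0 = 0" "prim_sech3 0 = 0" by (auto simp: prim_sech_def prim_sech3_def)

text \<open>The soliton on the halfline has mass pi / 2, gradient integral pi / 16 and sixth-power
  integral pi / 4, hence quotient 16 / pi^2. Subtracting its value at \<open>R\<close> and cutting
  there gives bounded support at a cost that tends to 0.\<close>

lemma near_optimal:
  assumes q: "0 \<le> q" "q < 16 / pi\<^sup>2"
  shows "\<exists>R>0. \<exists>f f'. edge_H1 {0..} f f' \<and> (\<forall>x>R. f x = 0 \<and> f' x = 0) \<and>
    q * (LINT x:{0..}|lborel. (f x)\<^sup>2)\<^sup>2 * (LINT x:{0..}|lborel. (f' x)\<^sup>2) < (LINT x:{0..}|lborel. (f x)^6)"
proof -
  \<comment> \<open>The expression is a lower bound for the sixth-power integral of the truncated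
    soliton, proved as \<open>L\<close> below; \<open>pi^3 / 64\<close> bounds mass squared times
    gradient integral.\<close>
  have lim: "((\<lambda>R. arctan (sinh R) / 2 - 3 * pi / sqrt (cosh R)) \<longlongrightarrow> pi / 4) at_top"
    unfolding sinh_field_def cosh_field_def by real_asymp
  have "q * (pi^3 / 64) < 16 / pi\<^sup>2 * (pi^3 / 64)" using q by (intro mult_strict_right_mono) auto
  also have "\<dots> = pi / 4" by (simp add: eval_nat_numeral)
  finally have "eventually (\<lambda>R. q * (pi^3 / 64) < arctan (sinh R) / 2 - 3 * pi / sqrt (cosh R)) at_top"
    using order_tendstoD(1)[OF lim] by blast
  then have "eventually (\<lambda>R. R > 0 \<and> q * (pi^3 / 64) < arctan (sinh R) / 2 - 3 * pi / sqrt (cosh R)) at_top"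
    using eventually_gt_at_top[of 0] by eventually_elim simp
  then obtain R :: real where R: "R > 0" "q * (pi^3 / 64) < arctan (sinh R) / 2 - 3 * pi / sqrt (cosh R)"
    by (auto dest: eventually_happens)
  define d where "d = soliton R"
  have d: "0 < d" using soliton_bounds by (simp add: d_def)
  let ?f = "\<lambda>x. soliton x - d"
  have H: "edge_H1 {0..R} ?f soliton'"
    using R(1) soliton_deriv by (intro edge_H1_C1 soliton'_continuous) (auto intro!: derivative_eq_intros)
  have le: "0 \<le> ?f x \<and> ?f x \<le> soliton x" if "x \<in> {0..R}" for x
    using soliton_antimono[of x R] that d by (auto simp: d_def)
  have c: "continuous_on {0..R} (\<lambda>x. 1 / cosh x)" "continuous_on {0..R} (\<lambda>x. 1 / (cosh x)^3)"
    by (intro continuous_intros; simp)+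
  have I1: "(LINT x:{0..R}|lborel. 1 / cosh x) = prim_sech R" "set_integrable lborel {0..R} (\<lambda>x. 1 / cosh x)"
    using FTC_Icc[OF _ prim_sech_deriv c(1)] R(1) by (auto simp: prim_zero)
  have I3: "(LINT x:{0..R}|lborel. 1 / (cosh x)^3) = prim_sech3 R" "set_integrable lborel {0..R} (\<lambda>x. 1 / (cosh x)^3)"
    using FTC_Icc[OF _ prim_sech3_deriv c(2)] R(1) by (auto simp: prim_zero)
  have at: "arctan (sinh R) \<le> pi / 2" using arctan_ubound by (simp add: less_imp_le)
  have m: "(LINT x:{0..R}|lborel. (?f x)\<^sup>2) \<le> pi / 2"
  proof -
    have "(LINT x:{0..R}|lborel. (?f x)\<^sup>2) \<le> (LINT x:{0..R}|lborel. 1 / cosh x)"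
    proof (rule set_integral_mono)
      show "set_integrable lborel {0..R} (\<lambda>x. (?f x)\<^sup>2)" using H by (simp add: edge_H1_def)
      show "(?f x)\<^sup>2 \<le> 1 / cosh x" if "x \<in> {0..R}" for x
        using power_mono[of "?f x" "soliton x" 2] le[OF that] by (simp add: soliton_powers)
    qed (rule I1)
    then show ?thesis using at I1 by (simp add: prim_sech_def)
  qed
  have D: "(LINT x:{0..R}|lborel. (soliton' x)\<^sup>2) \<le> pi / 16"
  proof -
    have "(LINT x:{0..R}|lborel. (soliton' x)\<^sup>2) = (prim_sech R - prim_sech3 R) / 4"
      unfolding soliton_powers using I1 I3 by simp
    also have "\<dots> = arctan (sinh R) / 8 - sinh R / (cosh R)\<^sup>2 / 8"
      unfolding prim_sech_def prim_sech3_def by (simp add: add_divide_distrib diff_divide_distrib)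
    also have "\<dots> \<le> pi / 16"
    proof -
      have "0 \<le> sinh R / (cosh R)\<^sup>2 / 8" using R(1) by simp
      then show ?thesis using at by linarith
    qed
    finally show ?thesis .
  qed
  have L: "arctan (sinh R) / 2 - 3 * pi / sqrt (cosh R) \<le> (LINT x:{0..R}|lborel. (?f x)^6)"
  proof -
    have "arctan (sinh R) / 2 - 3 * pi / sqrt (cosh R) \<le> prim_sech3 R - 6 * d * prim_sech R"
    proof -
      have "6 * d * prim_sech R \<le> 6 * d * (pi / 2)" using at d by (intro mult_left_mono) (auto simp: prim_sech_def)
      also have "\<dots> = 3 * pi / sqrt (cosh R)" by (simp add: d_def soliton_def)
      finally have "6 * d * prim_sech R \<le> 3 * pi / sqrt (cosh R)" .
      moreover have "prim_sech3 R = sinh R / (cosh R)\<^sup>2 / 2 + arctan (sinh R) / 2"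
        unfolding prim_sech3_def by (rule add_divide_distrib)
      moreover have "0 \<le> sinh R / (cosh R)\<^sup>2 / 2" using R(1) by simp
      ultimately show ?thesis by linarith
    qed
    also have "\<dots> = (LINT x:{0..R}|lborel. 1 / (cosh x)^3 - 6 * d * (1 / cosh x))"
      using I1 I3 by (subst set_integral_diff(2)) (simp_all only: set_integrable_mult_right set_integral_mult_right)
    also have "\<dots> \<le> (LINT x:{0..R}|lborel. (?f x)^6)"
    proof (rule set_integral_mono)
      show "set_integrable lborel {0..R} (\<lambda>x. 1 / (cosh x)^3 - 6 * d * (1 / cosh x))"
        using I1(2) I3(2) by (intro set_integral_diff(1) set_integrable_mult_right)
      show "set_integrable lborel {0..R} (\<lambda>x. (?f x)^6)"
        by (intro borel_integrable_atLeastAtMost' continuous_intros soliton_continuous)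
      show "1 / (cosh x)^3 - 6 * d * (1 / cosh x) \<le> (?f x)^6" if "x \<in> {0..R}" for x
      proof -
        let ?s = "soliton x"
        have s: "0 < ?s" "?s \<le> 1" using soliton_bounds by auto
        \<comment> \<open>Bernoulli gives (s - d)^6 at least s^6 - 6 d s^5; then s^5 is replaced by
          s^2, as s is at most 1, because the integral of s^2 = 1 / cosh is explicit.\<close>
        have "1 + real 6 * (- d / ?s) \<le> (1 + - d / ?s) ^ 6"
          using le[OF that] s by (intro Bernoulli_inequality) (simp add: field_simps)
        then have "?s^6 * (1 - 6 * d / ?s) \<le> ?s^6 * (1 - d / ?s) ^ 6"
          using s by (intro mult_left_mono) auto
        also have "\<dots> = (?f x)^6" using s by (simp flip: power_mult_distrib add: right_diff_distrib)
        also have "?s^6 * (1 - 6 * d / ?s) = ?s^6 - 6 * d * ?s^5"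
          using s by (simp add: field_simps eval_nat_numeral)
        finally have "?s^6 - 6 * d * ?s^5 \<le> (?f x)^6" .
        moreover have "?s^5 \<le> ?s^2" using s by (intro power_decreasing) auto
        then have "6 * d * ?s^5 \<le> 6 * d * ?s^2" using d by (intro mult_left_mono) auto
        ultimately show ?thesis unfolding soliton_powers by linarith
      qed
    qed
    finally show ?thesis .
  qed
  define F where "F x = (if x \<le> R then ?f x else 0)" for x
  define F' where "F' x = (if x \<le> R then soliton' x else 0)" for x
  have "edge_H1 {0..} F F'"
    unfolding F_def[abs_def] F'_def[abs_def] using R(1) H by (intro edge_H1_extend_zero) (auto simp: d_def)
  moreover have "(LINT x:{0..}|lborel. (F x)^n) = (LINT x:{0..R}|lborel. (?f x)^n)"
     "(LINT x:{0..}|lborel. (F' x)^n) = (LINT x:{0..R}|lborel. (soliton' x)^n)" if "n > 0" for n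
    using that by (intro set_integral_support(1); auto simp: F_def F'_def)+
  then have I: "(LINT x:{0..}|lborel. (F x)\<^sup>2) = (LINT x:{0..R}|lborel. (?f x)\<^sup>2)"
     "(LINT x:{0..}|lborel. (F' x)\<^sup>2) = (LINT x:{0..R}|lborel. (soliton' x)\<^sup>2)"
     "(LINT x:{0..}|lborel. (F x)^6) = (LINT x:{0..R}|lborel. (?f x)^6)" by simp_all
  have "q * (LINT x:{0..}|lborel. (F x)\<^sup>2)\<^sup>2 * (LINT x:{0..}|lborel. (F' x)\<^sup>2) < (LINT x:{0..}|lborel. (F x)^6)"
  proof -
    have "q * (LINT x:{0..R}|lborel. (?f x)\<^sup>2)\<^sup>2 * (LINT x:{0..R}|lborel. (soliton' x)\<^sup>2) \<le> q * (pi/2)\<^sup>2 * (pi/16)"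
      using q m D by (intro mult_mono power_mono mult_left_mono mult_nonneg_nonneg set_integral_nonneg_real) auto
    also have "\<dots> = q * (pi^3 / 64)" by (simp add: field_simps eval_nat_numeral)
    finally show ?thesis unfolding I using R(2) L by linarith
  qed
  ultimately show ?thesis using R(1) by (intro exI[of _ R] conjI exI[of _ F] exI[of _ F']) (auto simp: F_def F'_def)
qed

text \<open>A large dilation \<open>k\<close> pushes the support inside the terminal edge. The
  inequality between \<open>q\<close>, \<open>m\<close>, \<open>D\<close> and \<open>L\<close>
  concerns the fixed profile and is therefore uniform in \<open>k\<close> and
  \<open>s\<close>.\<close>

lemma terminal_scaled:
  assumes mg: "metric_graph G" and t: "terminal_point G v" and q: "0 \<le> q" "q < 16 / pi\<^sup>2"
  shows "\<exists>m D L k0. q * m\<^sup>2 * D < L \<and> 0 < k0 \<and> (\<forall>k\<ge>k0. \<forall>s. \<exists>u u'. H1_pair G u u' \<and>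
    mass G u = s\<^sup>2 / k * m \<and> mass G u' = s\<^sup>2 * k * D \<and> L6 G u = s^6 / k * L)"
proof -
  obtain R f f' where f: "R > 0" "edge_H1 {0..} f f'" "\<forall>x>R. f x = 0 \<and> f' x = 0"
    "q * (LINT x:{0..}|lborel. (f x)\<^sup>2)\<^sup>2 * (LINT x:{0..}|lborel. (f' x)\<^sup>2) < (LINT x:{0..}|lborel. (f x)^6)"
    using near_optimal[OF q] by auto
  obtain L where L: "L > 0" "\<And>f f'. edge_H1 {0..} f f' \<Longrightarrow> (\<forall>x\<ge>L. f x = 0 \<and> f' x = 0) \<Longrightarrow>
    (\<exists>u u'. H1_pair G u u' \<and> mass G u = (LINT x:{0..}|lborel. (f x)\<^sup>2) \<and>
      mass G u' = (LINT x:{0..}|lborel. (f' x)\<^sup>2) \<and> L6 G u = (LINT x:{0..}|lborel. (f x)^6))"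
    using terminal_transplant[OF mg t] by auto
  let ?m = "(LINT x:{0..}|lborel. (f x)\<^sup>2)" and ?D = "(LINT x:{0..}|lborel. (f' x)\<^sup>2)" and ?L = "(LINT x:{0..}|lborel. (f x)^6)"
  \<comment> \<open>The numerator \<open>R + 1\<close> gives \<open>k * x > R\<close> strictly for
    \<open>x \<ge> L\<close>; at \<open>R\<close> itself the cut derivative need not vanish.\<close>
  have "\<exists>u u'. H1_pair G u u' \<and> mass G u = s\<^sup>2 / k * ?m \<and> mass G u' = s\<^sup>2 * k * ?D \<and> L6 G u = s^6 / k * ?L"
    if k: "k \<ge> (R + 1) / L" for k s
  proof -
    have k0: "k > 0" using k f(1) L(1) by (meson add_pos_pos divide_pos_pos less_le_trans zero_less_one)
    have "k * x > R" if "x \<ge> L" for x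
    proof -
      have "R < (R + 1) / L * L" using L(1) by simp
      also have "\<dots> \<le> k * x" using k that f(1) L(1) k0 by (intro mult_mono) auto
      finally show ?thesis .
    qed
    then show ?thesis
      using L(2)[OF edge_H1_scale[OF f(2) k0, of s]] f(3)
      unfolding scaled_integrals(2)[OF k0] unfolding scaled_integrals(1,3)[OF k0] by simp
  qed
  then show ?thesis using f(1,4) L(1)
    by (intro exI[of _ ?m] exI[of _ ?D] exI[of _ ?L] exI[of _ "(R + 1) / L"]) auto
qed

text \<open>The polynomial bump vanishes at both ends, so it can be spread along a halfline by every
  \<open>k > 0\<close>; small \<open>k\<close> yields energies near 0 at a prescribed mass.\<close>

lemma halfline_scaled:
  assumes mg: "metric_graph G" and nc: "noncompact G"
  shows "\<exists>m D L. 0 < m \<and> (\<forall>k>0. \<forall>s. \<exists>u u'. H1_pair G u u' \<and>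
    mass G u = s\<^sup>2 / k * m \<and> mass G u' = s\<^sup>2 * k * D \<and> L6 G u = s^6 / k * L)"
proof -
  obtain e where e0: "e \<in> hedges G" using nc by (auto simp: noncompact_def)
  then have e: "e \<in> edges G" "e \<notin> bedges G" "edge_dom G e = {0..}"
    using mg by (auto simp: edges_def metric_graph_def edge_dom_def)
  let ?b = "\<lambda>x::real. x * (1 - x)" and ?b' = "\<lambda>x::real. 1 - 2 * x"
  define f where "f x = (if x \<le> 1 then ?b x else 0)" for x
  define f' where "f' x = (if x \<le> 1 then ?b' x else 0)" for x
  have H: "edge_H1 {0..} f f'"
    unfolding f_def[abs_def] f'_def[abs_def]
    by (intro edge_H1_extend_zero edge_H1_C1) (auto intro!: derivative_eq_intros continuous_intros)
  let ?m = "(LINT x:{0..}|lborel. (f x)\<^sup>2)" and ?D = "(LINT x:{0..}|lborel. (f' x)\<^sup>2)" and ?L = "(LINT x:{0..}|lborel. (f x)^6)"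
  have "?m = (LINT x:{0..1}|lborel. (?b x)\<^sup>2)" by (rule set_integral_support(1)) (auto simp: f_def)
  also have "\<dots> = (1^3/3 - 1^4/2 + 1^5/5) - (0^3/3 - 0^4/2 + 0^5/5)"
    by (rule FTC_Icc(1)) (auto intro!: derivative_eq_intros continuous_intros simp: algebra_simps eval_nat_numeral)
  finally have m: "?m > 0" by simp
  have "\<exists>u u'. H1_pair G u u' \<and> mass G u = s\<^sup>2 / k * ?m \<and> mass G u' = s\<^sup>2 * k * ?D \<and> L6 G u = s^6 / k * ?L"
    if k: "k > 0" for k s
  proof -
    let ?g = "\<lambda>x. s * f (k * x)" and ?g' = "\<lambda>x. s * k * f' (k * x)"
    have "H1_pair G (on_edge e ?g) (on_edge e ?g')"
      using edge_H1_scale[OF H k] e by (intro on_edge_H1[OF mg e(1)]) (auto simp: f_def)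
    moreover have "mass G (on_edge e ?g) = s\<^sup>2 / k * ?m" "L6 G (on_edge e ?g) = s^6 / k * ?L"
      using on_edge_sums[OF mg e(1), of ?g] unfolding e(3) scaled_integrals[OF k] .
    moreover have "mass G (on_edge e ?g') = s\<^sup>2 * k * ?D"
      using on_edge_sums(1)[OF mg e(1), of ?g'] unfolding e(3) scaled_integrals(2)[OF k] .
    ultimately show ?thesis by blast
  qed
  then show ?thesis using m by blast
qed

section \<open>Transplanting a function to a graph that is a halfline\<close>

text \<open>Peels the end edge off a chain, for the induction in
  \<open>halfline_transplant\<close>.\<close>

definition remove_leaf :: "('v, 'e) mgraph \<Rightarrow> 'v \<Rightarrow> 'e \<Rightarrow> ('v, 'e) mgraph" where
  "remove_leaf G v e = G\<lparr>verts := verts G - {v}, bedges := bedges G - {e}\<rparr>"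

lemma remove_leaf_simps [simp]:
  "verts (remove_leaf G v e) = verts G - {v}" "bedges (remove_leaf G v e) = bedges G - {e}"
  "hedges (remove_leaf G v e) = hedges G" "src (remove_leaf G v e) = src G"
  "tgt (remove_leaf G v e) = tgt G" "len (remove_leaf G v e) = len G"
  by (simp_all add: remove_leaf_def)

locale leaf =
  fixes G :: "('v, 'e) mgraph" and v w :: 'v and e :: 'e
  assumes mg: "metric_graph G" and e: "e \<in> bedges G" and vw: "v \<noteq> w"
    and ends: "src G e = v \<and> tgt G e = w \<or> src G e = w \<and> tgt G e = v"
    and other: "\<And>e'. e' \<in> bedges G \<Longrightarrow> e' \<noteq> e \<Longrightarrow> src G e' \<noteq> v \<and> tgt G e' \<noteq> v"
    and otherh: "\<And>h. h \<in> hedges G \<Longrightarrow> src G h \<noteq> v"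
begin

abbreviation "G' \<equiv> remove_leaf G v e"

lemma metric_graph': "metric_graph G'"
  using mg other otherh unfolding metric_graph_def by auto

lemma verts_ends: "v \<in> verts G" "w \<in> verts G"
  using mg e ends unfolding metric_graph_def by auto

lemma e_not: "e \<notin> hedges G" using mg e unfolding metric_graph_def by auto

lemma edges_eq: "edges G = insert e (edges G')" "e \<notin> edges G'"
  using e e_not by (auto simp: edges_def)

lemma edge_dom': "e' \<in> edges G' \<Longrightarrow> edge_dom G' e' = edge_dom G e'"
  using edges_eq(2) by (auto simp: edge_dom_def edges_def)

text \<open>The removed vertex \<open>v\<close> is put on the side of its neighbour
  \<open>w\<close>, so \<open>e\<close> is not the edge that crosses the cut.\<close>

lemma cut_connected':
  assumes "cut_connected G" shows "cut_connected G'"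
  unfolding cut_connected_def
proof (intro allI impI)
  fix S assume S: "S \<subseteq> verts G'" "S \<noteq> {}" "S \<noteq> verts G'"
  define T where "T = (if w \<in> S then insert v S else S)"
  have "T \<subseteq> verts G" "T \<noteq> {}" "T \<noteq> verts G"
    using S verts_ends vw by (auto simp: T_def split: if_splits)
  then obtain b where b: "b \<in> bedges G" "(src G b \<in> T) \<noteq> (tgt G b \<in> T)"
    using assms unfolding cut_connected_def by meson
  have "b \<noteq> e" using b(2) ends S(1) by (auto simp: T_def split: if_splits)
  then have "b \<in> bedges G'" "(src G' b \<in> S) \<noteq> (tgt G' b \<in> S)"
    using b other[OF b(1)] by (auto simp: T_def split: if_splits)
  then show "\<exists>e\<in>bedges G'. (src G' e \<in> S) \<noteq> (tgt G' e \<in> S)" by blast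
qed

lemma degree_w: "degree G w = degree G' w + 1"
proof -
  have f: "finite (bedges G)" using mg by (simp add: metric_graph_def)
  show ?thesis using ends
  proof
    assume a: "src G e = v \<and> tgt G e = w"
    then have "{e' \<in> bedges G. src G e' = w} = {e' \<in> bedges G - {e}. src G e' = w}"
      "{e' \<in> bedges G. tgt G e' = w} = insert e {e' \<in> bedges G - {e}. tgt G e' = w}" using vw e by auto
    then show ?thesis using f by (simp add: degree_def)
  next
    assume a: "src G e = w \<and> tgt G e = v"
    then have "{e' \<in> bedges G. tgt G e' = w} = {e' \<in> bedges G - {e}. tgt G e' = w}"
      "{e' \<in> bedges G. src G e' = w} = insert e {e' \<in> bedges G - {e}. src G e' = w}" using vw e by auto
    then show ?thesis using f by (simp add: degree_def)
  qed
qed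

lemma degree_le: "degree G' x \<le> degree G x"
  using mg unfolding degree_def metric_graph_def by (intro add_mono card_mono) auto

lemma is_halfline':
  assumes "is_halfline G" shows "is_halfline G'"
  using assms degree_le unfolding is_halfline_def by (auto intro: order_trans)

text \<open>Losing \<open>e\<close> brings the degree of \<open>w\<close> from at most 2 to at most
  1. It is not 0: an isolated \<open>w\<close> would be the whole remaining graph, and the halfline
  must start somewhere.\<close>

lemma terminal':
  assumes "is_halfline G" "cut_connected G" shows "terminal_point G' w"
proof -
  have "degree G w \<le> 2" using assms(1) verts_ends by (simp add: is_halfline_def)
  then have le: "degree G' w \<le> 1" using degree_w by simp
  have w: "w \<in> verts G'" using verts_ends vw by simp
  have fin: "finite (bedges G)" "finite (hedges G)" using mg by (auto simp: metric_graph_def)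
  have "degree G' w \<noteq> 0"
  proof
    assume "degree G' w = 0"
    then have none: "{e' \<in> bedges G'. src G e' = w} = {}" "{e' \<in> bedges G'. tgt G e' = w} = {}"
      "{h \<in> hedges G. src G h = w} = {}" using fin by (auto simp: degree_def)
    show False
    proof (cases "verts G' = {w}")
      case True
      obtain h where h: "h \<in> hedges G" using assms(1) by (auto simp: is_halfline_def card_1_singleton_iff)
      then have "src G h \<in> verts G'" using metric_graph' by (simp add: metric_graph_def)
      then show False using True none(3) h by auto
    next
      case False
      then obtain b where "b \<in> bedges G'" "(src G' b \<in> {w}) \<noteq> (tgt G' b \<in> {w})"
        using cut_connected'[OF assms(2)] w unfolding cut_connected_def by (metis empty_subsetI insert_not_empty insert_subset)
      then show False using none(1,2) by auto
    qed
  qed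
  then show ?thesis using le w by (simp add: terminal_point_def)
qed

text \<open>\<open>H1_pair\<close> on the smaller graph says that a common value at \<open>w\<close>
  exists, not which one it is; the conditions on \<open>q\<close> supply it, and \<open>p\<close> at
  the leaf is free. The condition \<open>val\<close> covers both orientations of
  \<open>e\<close>.\<close>

lemma extend:
  assumes H': "H1_pair G' u u'" and F: "edge_H1 {0..len G e} F F'"
    and val: "src G e = v \<and> F 0 = p \<and> F (len G e) = q \<or> tgt G e = v \<and> F 0 = q \<and> F (len G e) = p"
    and w1: "\<And>b. b \<in> bedges G' \<Longrightarrow> src G b = w \<Longrightarrow> u b 0 = q"
    and w2: "\<And>b. b \<in> bedges G' \<Longrightarrow> tgt G b = w \<Longrightarrow> u b (len G b) = q"
    and w3: "\<And>h. h \<in> hedges G \<Longrightarrow> src G h = w \<Longrightarrow> u h 0 = q"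
  shows "H1_pair G (u(e := F)) (u'(e := F'))"
    "mass G (u(e := F)) = (LINT x:{0..len G e}|lborel. (F x)\<^sup>2) + mass G' u"
    "mass G (u'(e := F')) = (LINT x:{0..len G e}|lborel. (F' x)\<^sup>2) + mass G' u'"
    "L6 G (u(e := F)) = (LINT x:{0..len G e}|lborel. (F x)^6) + L6 G' u"
proof -
  have de: "edge_dom G e = {0..len G e}" using e by (simp add: edge_dom_def)
  have fin: "finite (edges G')" using metric_graph' by (simp add: metric_graph_def edges_def)
  have sum: "(\<Sum>b\<in>edges G. LINT x:edge_dom G b|lborel. ((h(e := K)) b x)^n)
    = (LINT x:{0..len G e}|lborel. (K x)^n) + (\<Sum>b\<in>edges G'. LINT x:edge_dom G' b|lborel. (h b x)^n)"
    for h K and n :: nat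
  proof -
    have "(\<Sum>b\<in>edges G'. LINT x:edge_dom G b|lborel. ((h(e := K)) b x)^n)
      = (\<Sum>b\<in>edges G'. LINT x:edge_dom G' b|lborel. (h b x)^n)"
      using edges_eq(2) edge_dom' by (intro sum.cong) auto
    then show ?thesis unfolding edges_eq(1) using fin edges_eq(2) de by simp
  qed
  show "mass G (u(e := F)) = (LINT x:{0..len G e}|lborel. (F x)\<^sup>2) + mass G' u"
    "mass G (u'(e := F')) = (LINT x:{0..len G e}|lborel. (F' x)\<^sup>2) + mass G' u'"
    "L6 G (u(e := F)) = (LINT x:{0..len G e}|lborel. (F x)^6) + L6 G' u"
    unfolding mass_def L6_def by (rule sum)+
  have "edge_H1 (edge_dom G b) ((u(e := F)) b) ((u'(e := F')) b)" if b: "b \<in> edges G" for b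
  proof (cases "b = e")
    case False
    then have "b \<in> edges G'" using b edges_eq by auto
    then show ?thesis using H1_pair_edge[OF H', of b] edge_dom'[of b] False by simp
  qed (use F de in simp)
  moreover have "\<exists>c. (\<forall>b\<in>bedges G. (src G b = x \<longrightarrow> (u(e := F)) b 0 = c) \<and>
        (tgt G b = x \<longrightarrow> (u(e := F)) b (len G b) = c)) \<and>
        (\<forall>h\<in>hedges G. src G h = x \<longrightarrow> (u(e := F)) h 0 = c)" (is "\<exists>c. ?P x c") if x: "x \<in> verts G" for x
  proof -
    consider "x = v" | "x = w" | "x \<noteq> v" "x \<noteq> w" by blast
    then show ?thesis
    proof cases
      case 1
      have "?P x p" using 1 other otherh val ends vw by auto
      then show ?thesis ..
    next
      case 2
      have "?P x q" using 2 w1 w2 w3 val ends vw e_not by auto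
      then show ?thesis ..
    next
      case 3
      then have "x \<in> verts G'" using x by simp
      then obtain c where "(\<forall>b\<in>bedges G'. (src G' b = x \<longrightarrow> u b 0 = c) \<and> (tgt G' b = x \<longrightarrow> u b (len G' b) = c)) \<and>
        (\<forall>h\<in>hedges G'. src G' h = x \<longrightarrow> u h 0 = c)" using H' unfolding H1_pair_def by blast
      then have "?P x c" using 3 ends e_not by auto
      then show ?thesis ..
    qed
  qed
  ultimately show "H1_pair G (u(e := F)) (u'(e := F'))" unfolding H1_pair_def edge_H1_def by blast
qed

end

lemma set_integral_shift:
  fixes g :: "real \<Rightarrow> real"
  shows "(LINT x:{0..}|lborel. g (a + x)) = (LINT x:{a..}|lborel. g x)"
    "set_integrable lborel {0..} (\<lambda>x. g (a + x)) \<longleftrightarrow> set_integrable lborel {a..} g"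
    "(LINT x:{0..l}|lborel. g (a + x)) = (LINT x:{a..a+l}|lborel. g x)"
  using set_integral_affine[of 1 "{0..}" a "{a..}" g] set_integral_affine[of 1 "{0..l}" a "{a..a+l}" g] by auto

lemma set_integral_Ici_split:
  fixes g :: "real \<Rightarrow> real"
  assumes "set_integrable lborel {0..} g" "0 \<le> a" "0 \<le> l"
  shows "(LINT x:{a..}|lborel. g x) = (LINT x:{a..a+l}|lborel. g x) + (LINT x:{a+l..}|lborel. g x)"
proof -
  have "{a..a+l} \<subseteq> {0..}" "{a+l<..} \<subseteq> {0..}" "{a+l..} \<subseteq> {0..}" using assms(2,3) by auto
  then have i: "set_integrable lborel {a..a+l} g" "set_integrable lborel {a+l<..} g" "set_integrable lborel {a+l..} g"
    using assms(1) by (auto elim!: set_integrable_subset)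
  have "{a..} = {a..a+l} \<union> {a+l<..}" using assms by auto
  then have "(LINT x:{a..}|lborel. g x) = (LINT x:{a..a+l}|lborel. g x) + (LINT x:{a+l<..}|lborel. g x)"
    using set_integral_Un[OF _ i(1,2)] by (simp add: ivl_disj_int)
  also have "(LINT x:{a+l<..}|lborel. g x) = (LINT x:{a+l..}|lborel. g x)"
    by (rule set_integral_discrete_difference[of "{a+l}"]) auto
  finally show ?thesis .
qed

context
  fixes f f' :: "real \<Rightarrow> real"
  assumes deriv: "\<And>x. (f has_real_derivative f' x) (at x)" and cont: "continuous_on UNIV f'"
    and int: "set_integrable lborel {0..} (\<lambda>x. (f x)\<^sup>2)" "set_integrable lborel {0..} (\<lambda>x. (f' x)\<^sup>2)"
      "set_integrable lborel {0..} (\<lambda>x. (f x)^6)"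
begin

lemma shift_C1:
  shows "((\<lambda>x. f (a + x)) has_real_derivative f' (a + x)) (at x)" "continuous_on S (\<lambda>x. f' (a + x))"
proof -
  show "((\<lambda>x. f (a + x)) has_real_derivative f' (a + x)) (at x)"
    using DERIV_shift[of f "f' (a + x)" x a] deriv by (simp add: add.commute)
  show "continuous_on S (\<lambda>x. f' (a + x))"
    by (rule continuous_on_compose2[OF cont]) (auto intro: continuous_intros)
qed

lemma shift_H1_Icc: "0 \<le> l \<Longrightarrow> edge_H1 {0..l} (\<lambda>x. f (a + x)) (\<lambda>x. f' (a + x))"
  by (rule edge_H1_C1) (auto intro: shift_C1)

lemma shift_H1_Ici:
  assumes "a \<ge> 0" shows "edge_H1 {0..} (\<lambda>x. f (a + x)) (\<lambda>x. f' (a + x))"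
  unfolding edge_H1_def
proof (intro conjI)
  show "\<forall>x\<in>{0..}. set_integrable lborel {0..x} (\<lambda>x. f' (a + x)) \<and> f (a + x) = f (a + 0) + (LINT t:{0..x}|lborel. f' (a + t))"
  proof
    fix x :: real assume "x \<in> {0..}"
    then have "edge_H1 {0..x} (\<lambda>x. f (a + x)) (\<lambda>x. f' (a + x))" "x \<in> {0..x}" using shift_H1_Icc by auto
    then show "set_integrable lborel {0..x} (\<lambda>x. f' (a + x)) \<and> f (a + x) = f (a + 0) + (LINT t:{0..x}|lborel. f' (a + t))"
      unfolding edge_H1_def by blast
  qed
  have "{a..} \<subseteq> {0..}" using assms by auto
  then have "set_integrable lborel {a..} (\<lambda>x. (f x)\<^sup>2)" "set_integrable lborel {a..} (\<lambda>x. (f' x)\<^sup>2)"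
    using int by (auto elim!: set_integrable_subset)
  then show "set_integrable lborel {0..} (\<lambda>x. (f (a + x))\<^sup>2)" "set_integrable lborel {0..} (\<lambda>x. (f' (a + x))\<^sup>2)"
    using set_integral_shift(2)[of "\<lambda>x. (f x)\<^sup>2" a] set_integral_shift(2)[of "\<lambda>x. (f' x)\<^sup>2" a] by auto
qed

text \<open>Induction on the number of bounded edges, peeling from the terminal point. Passing to
  the tail of \<open>f\<close> from \<open>a\<close> on, and recording the value \<open>f a\<close>
  at \<open>v\<close>, is what lets the step glue the next edge.\<close>

lemma halfline_transplant:
  assumes "metric_graph G" "cut_connected G" "is_halfline G" "terminal_point G v" "a \<ge> 0"
  shows "\<exists>u u'. H1_pair G u u' \<and> mass G u = (LINT x:{a..}|lborel. (f x)\<^sup>2) \<and>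
     mass G u' = (LINT x:{a..}|lborel. (f' x)\<^sup>2) \<and> L6 G u = (LINT x:{a..}|lborel. (f x)^6) \<and>
     (\<forall>b\<in>bedges G. (src G b = v \<longrightarrow> u b 0 = f a) \<and> (tgt G b = v \<longrightarrow> u b (len G b) = f a)) \<and>
     (\<forall>h\<in>hedges G. src G h = v \<longrightarrow> u h 0 = f a)"
  using assms
proof (induction "card (bedges G)" arbitrary: G v a rule: less_induct)
  case less
  note mg = less.prems(1) and con = less.prems(2) and hl = less.prems(3) and a = less.prems(5)
  have deg: "degree G v = 1" "v \<in> verts G" using less.prems(4) by (auto simp: terminal_point_def)
  show ?case
  proof (cases "\<exists>h\<in>hedges G. src G h = v")
    case True
    then obtain h where h: "h \<in> hedges G" "src G h = v" by blast
    have he: "h \<in> edges G" "h \<notin> bedges G" "edge_dom G h = {0..}"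
      using mg h by (auto simp: edges_def metric_graph_def edge_dom_def)
    note d = degree_one_halfline[OF mg deg(1) h]
    let ?u = "on_edge h (\<lambda>x. f (a + x))" and ?u' = "on_edge h (\<lambda>x. f' (a + x))"
    have H1: "H1_pair G ?u ?u'"
      by (rule on_edge_H1[OF mg he(1)]) (use shift_H1_Ici[OF a] he deg h in auto)
    have "mass G ?u = (LINT x:{a..}|lborel. (f x)\<^sup>2)" "mass G ?u' = (LINT x:{a..}|lborel. (f' x)\<^sup>2)"
      "L6 G ?u = (LINT x:{a..}|lborel. (f x)^6)"
      unfolding on_edge_sums[OF mg he(1)] he(3)
      using set_integral_shift(1)[of "\<lambda>x. (f x)\<^sup>2" a] set_integral_shift(1)[of "\<lambda>x. (f' x)\<^sup>2" a]
        set_integral_shift(1)[of "\<lambda>x. (f x)^6" a] by auto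
    moreover have "(\<forall>b\<in>bedges G. (src G b = v \<longrightarrow> ?u b 0 = f a) \<and> (tgt G b = v \<longrightarrow> ?u b (len G b) = f a)) \<and>
     (\<forall>h\<in>hedges G. src G h = v \<longrightarrow> ?u h 0 = f a)" using d by (auto simp: on_edge_def)
    ultimately show ?thesis using H1 by blast
  next
    case False
    then obtain e where e: "e \<in> bedges G" "src G e = v \<or> tgt G e = v"
      using degree_one_cases[OF deg(1)] by metis
    define w where "w = (if src G e = v then tgt G e else src G e)"
    have lf: "leaf G v w e"
    proof (cases "src G e = v")
      case T: True
      note d = degree_one_src[OF mg deg(1) e(1) T]
      show ?thesis by unfold_locales (use mg d e T False in \<open>auto simp: w_def\<close>)
    next
      case F: False
      then have t: "tgt G e = v" using e by simp
      note d = degree_one_tgt[OF mg deg(1) e(1) t]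
      show ?thesis by unfold_locales (use mg d e F t False in \<open>auto simp: w_def\<close>)
    qed
    interpret leaf G v w e by (rule lf)
    let ?l = "len G e"
    have l: "?l > 0" using mg e by (auto simp: metric_graph_def)
    have "finite (bedges G)" using mg by (simp add: metric_graph_def)
    then have "card (bedges G') < card (bedges G)" using card_Diff1_less[OF _ e(1)] by simp
    \<comment> \<open>The remaining chain receives the tail from \<open>a + ?l\<close>, starting at
      \<open>w\<close>, which is now terminal.\<close>
    from less.hyps[OF this metric_graph' cut_connected'[OF con] is_halfline'[OF hl] terminal'[OF hl con], of "a + ?l"]
    obtain u u' where u: "H1_pair G' u u'" "mass G' u = (LINT x:{a + ?l..}|lborel. (f x)\<^sup>2)"
      "mass G' u' = (LINT x:{a + ?l..}|lborel. (f' x)\<^sup>2)" "L6 G' u = (LINT x:{a + ?l..}|lborel. (f x)^6)"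
      "\<forall>b\<in>bedges G'. (src G b = w \<longrightarrow> u b 0 = f (a + ?l)) \<and> (tgt G b = w \<longrightarrow> u b (len G b) = f (a + ?l))"
      "\<forall>h\<in>hedges G. src G h = w \<longrightarrow> u h 0 = f (a + ?l)" using a l by auto
    \<comment> \<open>The edge \<open>e\<close> carries \<open>f\<close> on
      \<open>{a..a+?l}\<close>, reflected when its parameter runs towards \<open>v\<close>.\<close>
    have "\<exists>F F'. edge_H1 {0..?l} F F' \<and>
      (src G e = v \<and> F 0 = f a \<and> F ?l = f (a + ?l) \<or> tgt G e = v \<and> F 0 = f (a + ?l) \<and> F ?l = f a) \<and>
      (LINT x:{0..?l}|lborel. (F x)\<^sup>2) = (LINT x:{a..a+?l}|lborel. (f x)\<^sup>2) \<and>
      (LINT x:{0..?l}|lborel. (F' x)\<^sup>2) = (LINT x:{a..a+?l}|lborel. (f' x)\<^sup>2) \<and>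
      (LINT x:{0..?l}|lborel. (F x)^6) = (LINT x:{a..a+?l}|lborel. (f x)^6)"
    proof -
      have H: "edge_H1 {0..?l} (\<lambda>x. f (a + x)) (\<lambda>x. f' (a + x))" using shift_H1_Icc l by simp
      note s = set_integral_shift(3)[where g = "\<lambda>x. (f x)\<^sup>2" and l = ?l and a = a] set_integral_shift(3)[where g = "\<lambda>x. (f' x)\<^sup>2" and l = ?l and a = a]
        set_integral_shift(3)[where g = "\<lambda>x. (f x)^6" and l = ?l and a = a]
      show ?thesis
      proof (cases "src G e = v")
        case True
        then show ?thesis
          using H s by (intro exI[of _ "\<lambda>x. f (a + x)"] exI[of _ "\<lambda>x. f' (a + x)"]) simp
      next
        case False
        note r = set_integral_reflect_Icc[where l = ?l and g = "\<lambda>x. (f (a + x))\<^sup>2"]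
          set_integral_reflect_Icc[where l = ?l and g = "\<lambda>x. (f' (a + x))\<^sup>2"]
          set_integral_reflect_Icc[where l = ?l and g = "\<lambda>x. (f (a + x))^6"]
        show ?thesis
          by (rule exI[of _ "\<lambda>x. f (a + (?l - x))"], rule exI[of _ "\<lambda>x. - f' (a + (?l - x))"], intro conjI)
             (use edge_H1_reflect[OF H] False ends s r in \<open>simp_all only: power2_minus, simp_all\<close>)
      qed
    qed
    then obtain F F' where F: "edge_H1 {0..?l} F F'"
      "src G e = v \<and> F 0 = f a \<and> F ?l = f (a + ?l) \<or> tgt G e = v \<and> F 0 = f (a + ?l) \<and> F ?l = f a"
      "(LINT x:{0..?l}|lborel. (F x)\<^sup>2) = (LINT x:{a..a+?l}|lborel. (f x)\<^sup>2)"
      "(LINT x:{0..?l}|lborel. (F' x)\<^sup>2) = (LINT x:{a..a+?l}|lborel. (f' x)\<^sup>2)"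
      "(LINT x:{0..?l}|lborel. (F x)^6) = (LINT x:{a..a+?l}|lborel. (f x)^6)" by blast
    have ext: "H1_pair G (u(e := F)) (u'(e := F'))"
      "mass G (u(e := F)) = (LINT x:{0..?l}|lborel. (F x)\<^sup>2) + mass G' u"
      "mass G (u'(e := F')) = (LINT x:{0..?l}|lborel. (F' x)\<^sup>2) + mass G' u'"
      "L6 G (u(e := F)) = (LINT x:{0..?l}|lborel. (F x)^6) + L6 G' u"
      by (rule extend[OF u(1) F(1,2)]; use u(5,6) in auto)+
    have "mass G (u(e := F)) = (LINT x:{a..}|lborel. (f x)\<^sup>2)"
      "mass G (u'(e := F')) = (LINT x:{a..}|lborel. (f' x)\<^sup>2)"
      "L6 G (u(e := F)) = (LINT x:{a..}|lborel. (f x)^6)"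
      unfolding ext(2-4) F(3-5) u(2-4) using l a by (intro set_integral_Ici_split[symmetric] int; simp)+
    moreover have "(\<forall>b\<in>bedges G. (src G b = v \<longrightarrow> (u(e := F)) b 0 = f a) \<and> (tgt G b = v \<longrightarrow> (u(e := F)) b (len G b) = f a)) \<and>
     (\<forall>h\<in>hedges G. src G h = v \<longrightarrow> (u(e := F)) h 0 = f a)" using other otherh F(2) ends vw by auto
    ultimately show ?thesis using ext(1) by blast
  qed
qed

end

section \<open>The soliton on the halfline and the theorem\<close>

lemma FTC_Ici:
  assumes c: "continuous_on UNIV f" and F: "\<And>x. (F has_real_derivative f x) (at x)"
    and nn: "\<And>x. 0 \<le> f x" and lim: "(F \<longlongrightarrow> T) at_top" and T: "F 0 \<le> T"
  shows "set_integrable lborel {0..} f" "(LINT x:{0..}|lborel. f x) = T - F 0"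
proof -
  have m: "f \<in> borel_measurable borel" using c by (simp add: borel_measurable_continuous_onI)
  have "(\<integral>\<^sup>+x. ennreal (f x) * indicator {0..} x \<partial>lborel) = ennreal (T - F 0)"
    by (rule nn_integral_FTC_atLeast[OF m F nn lim])
  also have "(\<integral>\<^sup>+x. ennreal (f x) * indicator {0..} x \<partial>lborel) = (\<integral>\<^sup>+x. ennreal (indicator {0..} x *\<^sub>R f x) \<partial>lborel)"
    by (intro nn_integral_cong) (auto simp: indicator_def)
  finally have "integrable lborel (\<lambda>x. indicator {0..} x *\<^sub>R f x) \<and> (LINT x|lborel. indicator {0..} x *\<^sub>R f x) = T - F 0"
    using m nn T by (subst (asm) nn_integral_eq_integrable) auto
  then show "set_integrable lborel {0..} f" "(LINT x:{0..}|lborel. f x) = T - F 0"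
    by (auto simp: set_integrable_def set_lebesgue_integral_def)
qed

lemma sech_integrals:
  "set_integrable lborel {0..} (\<lambda>x::real. 1 / cosh x)" "(LINT x:{0..}|lborel. 1 / cosh x) = pi / 2"
  "set_integrable lborel {0..} (\<lambda>x::real. 1 / (cosh x)^3)" "(LINT x:{0..}|lborel. 1 / (cosh x)^3) = pi / 4"
proof -
  have c: "continuous_on UNIV (\<lambda>x::real. 1 / cosh x)" "continuous_on UNIV (\<lambda>x::real. 1 / (cosh x)^3)"
    by (intro continuous_intros; simp)+
  show "set_integrable lborel {0..} (\<lambda>x::real. 1 / cosh x)" "(LINT x:{0..}|lborel. 1 / cosh x) = pi / 2"
    using FTC_Ici[OF c(1) prim_sech_deriv _ prim_limits(1)] by (auto simp: prim_zero less_imp_le)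
  show "set_integrable lborel {0..} (\<lambda>x::real. 1 / (cosh x)^3)" "(LINT x:{0..}|lborel. 1 / (cosh x)^3) = pi / 4"
    using FTC_Ici[OF c(2) prim_sech3_deriv _ prim_limits(2)] by (auto simp: prim_zero less_imp_le)
qed

lemma halfline_attained:
  assumes "metric_graph G" "cut_connected G" "is_halfline G" "terminal_point G v"
  shows "\<exists>u u'. H1_pair G u u' \<and> mass G u = pi * sqrt 3 / 4 \<and> energy G u u' = 0"
proof -
  \<comment> \<open>\<open>c\<^sup>2 * (pi / 2)\<close> has to be the critical mass; then
    \<open>c^4\<close> is 3/4, which is also the condition for zero energy.\<close>
  define c where "c = sqrt (sqrt 3 / 2)"
  have c2: "c\<^sup>2 = sqrt 3 / 2" by (simp add: c_def)
  have "c^6 = (c\<^sup>2)^3" unfolding power_mult[symmetric] by simp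
  also have "\<dots> = 3 * sqrt 3 / 8" unfolding c2 by (simp add: power_divide eval_nat_numeral)
  finally have c6: "c^6 = 3 * sqrt 3 / 8" .
  let ?f = "\<lambda>x. c * soliton x" and ?f' = "\<lambda>x. c * soliton' x"
  have d: "(?f has_real_derivative ?f' x) (at x)" for x by (rule DERIV_cmult[OF soliton_deriv])
  have ct: "continuous_on UNIV ?f'" by (intro continuous_intros soliton'_continuous)
  have i: "set_integrable lborel {0..} (\<lambda>x. (?f x)\<^sup>2)" "set_integrable lborel {0..} (\<lambda>x. (?f' x)\<^sup>2)"
      "set_integrable lborel {0..} (\<lambda>x. (?f x)^6)"
    unfolding power_mult_distrib soliton_powers
    by (intro set_integrable_mult_right set_integrable_divide set_integral_diff(1) sech_integrals)+
  have I: "(LINT x:{0..}|lborel. (?f x)\<^sup>2) = c\<^sup>2 * (pi / 2)" "(LINT x:{0..}|lborel. (?f' x)\<^sup>2) = c\<^sup>2 * (pi / 16)"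
      "(LINT x:{0..}|lborel. (?f x)^6) = c^6 * (pi / 4)"
    unfolding power_mult_distrib soliton_powers set_integral_mult_right set_integral_divide_zero
      set_integral_diff(2)[OF sech_integrals(1,3)] sech_integrals by simp_all
  obtain u u' where u: "H1_pair G u u'" "mass G u = c\<^sup>2 * (pi / 2)" "mass G u' = c\<^sup>2 * (pi / 16)" "L6 G u = c^6 * (pi / 4)"
    using halfline_transplant[OF d ct i assms order_refl] unfolding I by blast
  have "mass G u = pi * sqrt 3 / 4" unfolding u c2 by simp
  moreover have "energy G u u' = 0" unfolding energy_def u c2 c6 by simp
  ultimately show ?thesis using u(1) by blast
qed

theorem theorem7p1:
  fixes G :: "('v, 'e) mgraph"
  assumes "metric_graph G" and "mg_connected G" and "noncompact G"
    and "\<exists>v. terminal_point G v"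
  shows "crit_mass G = pi * sqrt 3 / 4 \<and>
         (\<forall>\<mu>::real. pi * sqrt 3 / 4 < \<mu> \<and> \<mu> \<le> pi * sqrt 3 / 2 \<longrightarrow> ground_energy G \<mu> = -\<infinity>) \<and>
         ground_energy G (pi * sqrt 3 / 4) = 0 \<and>
         ((\<exists>u u'. H1_pair G u u' \<and> mass G u = pi * sqrt 3 / 4 \<and> energy G u u' = 0)
            \<longleftrightarrow> is_halfline G)"
proof -
  obtain v where v: "terminal_point G v" using assms(4) by blast
  note mg = assms(1) and con = mg_connected_imp_cut_connected[OF assms(2)] and nc = assms(3)
  have GN: "L6 G u \<le> 16 / pi\<^sup>2 * (mass G u)\<^sup>2 * mass G u'" if "H1_pair G u u'" for u u'
    using H1_graph.Gagliardo_Nirenberg[of G u u'] mg con nc that by (simp add: H1_graph_def)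

  have K: "GN_const G = ereal (16 / pi\<^sup>2)"
  proof (rule antisym)
    show "GN_const G \<le> ereal (16 / pi\<^sup>2)"
      unfolding GN_const_def
    proof (rule Sup_least, clarify)
      fix u u' assume H: "H1_pair G u u'" and m: "mass G u \<noteq> 0"
      have "L6 G u / ((mass G u)\<^sup>2 * mass G u') \<le> 16 / pi\<^sup>2"
      proof (cases "mass G u' = 0")
        \<comment> \<open>In the other case \<open>mass G u'\<close> is 0 and the quotient is 0 by
          the convention for division by zero.\<close>
        case False
        then have "(mass G u)\<^sup>2 * mass G u' > 0" using m mass_nonneg[of G u'] by simp
        then show ?thesis using GN[OF H] by (simp add: pos_divide_le_eq mult.assoc)
      qed simp
      then show "ereal (L6 G u / ((mass G u)\<^sup>2 * mass G u')) \<le> ereal (16 / pi\<^sup>2)" by simp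
    qed
    have q: "ereal q \<le> GN_const G" if q: "0 \<le> q" "q < 16 / pi\<^sup>2" for q
    proof -
      obtain m D L k0 where t: "q * m\<^sup>2 * D < L" "0 < k0" "\<forall>k\<ge>k0. \<forall>s. \<exists>u u'. H1_pair G u u' \<and>
         mass G u = s\<^sup>2 / k * m \<and> mass G u' = s\<^sup>2 * k * D \<and> L6 G u = s^6 / k * L"
        using terminal_scaled[OF mg v q] by blast
      define k where "k = k0"
      obtain u u' where u: "H1_pair G u u'" "mass G u = 1\<^sup>2 / k * m" "mass G u' = 1\<^sup>2 * k * D" "L6 G u = 1^6 / k * L"
        using t(3)[rule_format, of k 1] by (auto simp: k_def)
      have k: "k > 0" using t by (simp add: k_def)
      have "q * (mass G u)\<^sup>2 * mass G u' = (q * m\<^sup>2 * D) / k"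
        unfolding u using k by (simp add: field_simps power2_eq_square)
      also have "\<dots> < L6 G u" unfolding u using t(1) k by (simp add: divide_strict_right_mono)
      finally have lt: "q * (mass G u)\<^sup>2 * mass G u' < L6 G u" .
      have L0: "0 < L6 G u" using lt q mass_nonneg[of G u'] by (smt (verit) mult_nonneg_nonneg zero_le_power2)
      have "mass G u \<noteq> 0" "mass G u' \<noteq> 0" using GN[OF u(1)] L0 by auto
      then have "0 < (mass G u)\<^sup>2 * mass G u'" using mass_nonneg[of G u'] by simp
      then have "q \<le> L6 G u / ((mass G u)\<^sup>2 * mass G u')" using lt by (simp add: pos_le_divide_eq mult.assoc)
      then have "ereal q \<le> ereal (L6 G u / ((mass G u)\<^sup>2 * mass G u'))" by simp
      also have "\<dots> \<le> GN_const G"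
        unfolding GN_const_def using u(1) \<open>mass G u \<noteq> 0\<close> by (intro Sup_upper) blast
      finally show ?thesis .
    qed
    show "ereal (16 / pi\<^sup>2) \<le> GN_const G"
    proof (rule dense_le)
      fix y assume y: "y < ereal (16 / pi\<^sup>2)"
      show "y \<le> GN_const G"
      proof (cases y)
        case (real r)
        \<comment> \<open>\<open>q\<close> wants a nonnegative number, and a negative
          \<open>r\<close> lies below \<open>max r 0\<close>.\<close>
        then have "ereal (max r 0) \<le> GN_const G" using y by (intro q) auto
        then show ?thesis using real by (meson ereal_less_eq(3) max.cobounded1 order_trans)
      qed (use y in auto)
    qed
  qed
  have crit: "crit_mass G = pi * sqrt 3 / 4"
    unfolding crit_mass_def K by (simp add: real_sqrt_divide real_sqrt_mult)

  have inf: "ground_energy G \<mu> = -\<infinity>" if \<mu>: "pi * sqrt 3 / 4 < \<mu>" for \<mu>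
  proof -
    have \<mu>0: "\<mu> > 0" using \<mu> by (meson divide_pos_pos less_trans mult_pos_pos pi_gt_zero real_sqrt_gt_zero zero_less_numeral)
    have "(pi * sqrt 3 / 4)\<^sup>2 < \<mu>\<^sup>2" using \<mu> by (intro power_strict_mono) auto
    \<comment> \<open>The energy is negative when \<open>L6\<close> exceeds 3 times the mass of the
      derivative, that is, at mass \<mu>, when the quotient exceeds 3 / \<mu>^2; such functions
      exist because this is below the sharp constant.\<close>
    then have q: "3 / \<mu>\<^sup>2 < 16 / pi\<^sup>2" using \<mu>0 by (simp add: power_divide power_mult_distrib field_simps)
    obtain m D L k0 where t: "3 / \<mu>\<^sup>2 * m\<^sup>2 * D < L" "0 < k0" "\<And>k s. k \<ge> k0 \<Longrightarrow> \<exists>u u'. H1_pair G u u' \<and>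
         mass G u = s\<^sup>2 / k * m \<and> mass G u' = s\<^sup>2 * k * D \<and> L6 G u = s^6 / k * L"
      using terminal_scaled[OF mg v _ q] by (auto simp: less_imp_le)
    have m: "m > 0"
    proof -
      obtain u u' where u: "H1_pair G u u'" "mass G u = 1\<^sup>2 / k0 * m" "mass G u' = 1\<^sup>2 * k0 * D" "L6 G u = 1^6 / k0 * L"
        using t(3)[of k0 1] by auto
      have mD: "m \<ge> 0" "D \<ge> 0" using mass_nonneg[of G u] mass_nonneg[of G u'] u t(2) by (auto simp: zero_le_divide_iff zero_le_mult_iff)
      have "m \<noteq> 0"
      proof
        assume "m = 0"
        then have "L6 G u \<le> 0" using GN[OF u(1)] u(2) by simp
        then show False using u(4) t(1,2) \<open>m = 0\<close> by (simp add: divide_le_0_iff)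
      qed
      then show ?thesis using mD by simp
    qed
    \<comment> \<open>With \<open>s\<^sup>2 = c * k\<close> the mass is \<open>c * m = \<mu>\<close>
      for every \<open>k\<close>, and the energy is \<open>- (k\<^sup>2 * \<beta>)\<close>.\<close>
    define c where "c = \<mu> / m"
    have c: "c > 0" using \<mu>0 m by (simp add: c_def)
    define \<beta> where "\<beta> = c^3 * L / 6 - c * D / 2"
    have \<beta>: "\<beta> > 0"
    proof -
      have "c * D / 2 = c^3 * (3 / \<mu>\<^sup>2 * m\<^sup>2 * D) / 6"
        using \<mu>0 m by (simp add: c_def field_simps eval_nat_numeral)
      also have "\<dots> < c^3 * L / 6" using t(1) c by (intro divide_strict_right_mono mult_strict_left_mono) auto
      finally show ?thesis by (simp add: \<beta>_def)
    qed
    have low: "ground_energy G \<mu> \<le> ereal (- (k\<^sup>2 * \<beta>))" if k: "k \<ge> k0" for k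
    proof -
      have k0: "k > 0" using k t(2) by simp
      define s where "s = sqrt (c * k)"
      have s2: "s\<^sup>2 = c * k" using c k0 by (simp add: s_def)
      have "s^6 = (s\<^sup>2)^3" unfolding power_mult[symmetric] by simp
      then have s6: "s^6 = c^3 * k^3" unfolding s2 by (simp add: power_mult_distrib)
      obtain u u' where u: "H1_pair G u u'" "mass G u = s\<^sup>2 / k * m" "mass G u' = s\<^sup>2 * k * D" "L6 G u = s^6 / k * L"
        using t(3)[OF k, of s] by blast
      have "mass G u = \<mu>" unfolding u(2) s2 using k0 m by (simp add: c_def)
      moreover have "energy G u u' = - (k\<^sup>2 * \<beta>)"
        unfolding energy_def u(3,4) s2 s6 \<beta>_def using k0 by (simp add: field_simps eval_nat_numeral)
      ultimately show ?thesis unfolding ground_energy_def using u(1) by (intro Inf_lower) force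
    qed
    show ?thesis
    proof (rule ereal_bot)
      fix B :: real
      \<comment> \<open>The 1 in the maximum makes k^2 at least k, so that k^2 \<beta> reaches
        |B|.\<close>
      define k where "k = max k0 (max 1 (\<bar>B\<bar> / \<beta>))"
      have "\<bar>B\<bar> / \<beta> \<le> k" "1 \<le> k" "k0 \<le> k" by (auto simp: k_def)
      then have "\<bar>B\<bar> \<le> k * \<beta>" using \<beta> by (simp add: pos_divide_le_eq)
      also have "\<dots> \<le> k\<^sup>2 * \<beta>" using \<open>1 \<le> k\<close> \<beta> by (intro mult_right_mono) (auto simp: power2_eq_square)
      finally have "- (k\<^sup>2 * \<beta>) \<le> B" by linarith
      then show "ground_energy G \<mu> \<le> ereal B" using low[OF \<open>k0 \<le> k\<close>] by (meson ereal_less_eq(3) order_trans)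
    qed
  qed

  have zero: "ground_energy G (pi * sqrt 3 / 4) = 0"
  proof (rule antisym)
    have "0 \<le> energy G u u'" if H: "H1_pair G u u'" and m: "mass G u = pi * sqrt 3 / 4" for u u'
    proof -
      \<comment> \<open>The critical mass is the one at which the sharp constant times its square
        equals 3, the ratio of the coefficients 1/2 and 1/6 of the energy.\<close>
      have "16 / pi\<^sup>2 * (mass G u)\<^sup>2 = 3" unfolding m by (simp add: power_divide power_mult_distrib)
      then show ?thesis using GN[OF H] by (simp add: energy_def)
    qed
    then show "0 \<le> ground_energy G (pi * sqrt 3 / 4)"
      unfolding ground_energy_def by (intro Inf_greatest) auto
    obtain m D L where t: "0 < m" "\<And>k s. k > 0 \<Longrightarrow> \<exists>u u'. H1_pair G u u' \<and>
         mass G u = s\<^sup>2 / k * m \<and> mass G u' = s\<^sup>2 * k * D \<and> L6 G u = s^6 / k * L"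
      using halfline_scaled[OF mg nc] by blast
    define c where "c = pi * sqrt 3 / 4 / m"
    have c: "c > 0" using t(1) by (simp add: c_def)
    define \<beta> where "\<beta> = c * D / 2 - c^3 * L / 6"
    have up: "ground_energy G (pi * sqrt 3 / 4) \<le> ereal (k\<^sup>2 * \<beta>)" if k: "k > 0" for k
    proof -
      define s where "s = sqrt (c * k)"
      have s2: "s\<^sup>2 = c * k" using c k by (simp add: s_def)
      have "s^6 = (s\<^sup>2)^3" unfolding power_mult[symmetric] by simp
      then have s6: "s^6 = c^3 * k^3" unfolding s2 by (simp add: power_mult_distrib)
      obtain u u' where u: "H1_pair G u u'" "mass G u = s\<^sup>2 / k * m" "mass G u' = s\<^sup>2 * k * D" "L6 G u = s^6 / k * L"
        using t(2)[OF k, of s] by blast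
      have "mass G u = pi * sqrt 3 / 4" unfolding u(2) s2 using k t(1) by (simp add: c_def)
      moreover have "energy G u u' = k\<^sup>2 * \<beta>"
        unfolding energy_def u(3,4) s2 s6 \<beta>_def using k by (simp add: field_simps eval_nat_numeral)
      ultimately show ?thesis unfolding ground_energy_def using u(1) by (intro Inf_lower) force
    qed
    \<comment> \<open>Spreading out: as \<open>k\<close> tends to 0 the energies tend to 0, whatever
      the sign of \<beta>.\<close>
    have "((\<lambda>k. ereal (k\<^sup>2 * \<beta>)) \<longlongrightarrow> ereal (0\<^sup>2 * \<beta>)) (at_right 0)"
      by (intro tendsto_intros)
    then have lim: "((\<lambda>k. ereal (k\<^sup>2 * \<beta>)) \<longlongrightarrow> 0) (at_right 0)" by (simp add: zero_ereal_def)
    show "ground_energy G (pi * sqrt 3 / 4) \<le> 0"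
      by (rule tendsto_lowerbound[OF lim eventually_at_rightI[of 0 1]]) (auto intro: up)
  qed

  have "(\<exists>u u'. H1_pair G u u' \<and> mass G u = pi * sqrt 3 / 4 \<and> energy G u u' = 0) \<longleftrightarrow> is_halfline G"
  proof
    assume "\<exists>u u'. H1_pair G u u' \<and> mass G u = pi * sqrt 3 / 4 \<and> energy G u u' = 0"
    then obtain u u' where "H1_pair G u u'" "mass G u = pi * sqrt 3 / 4" "energy G u u' = 0" by blast
    then have "extremal G u u'" using mg con nc by (simp add: extremal_def H1_graph_def extremal_axioms_def)
    then show "is_halfline G" by (rule extremal.halfline)
  qed (rule halfline_attained[OF mg con _ v])
  then show ?thesis using crit inf zero by blast
qed

end
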